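(* Let $\alpha>0$ and let $A,B\in\mathbb{C}^{n\times n}$ with $\|A\|_2\le1$ and $\|B\|_2\le1$. Let $(\widetilde A,\widetilde B)=(A+\gamma G_1,B+\gamma G_2)$ for $G_1,G_2$ two independent complex Ginibre matrices and $0<\gamma<\frac12$. Let $g$ be the grid $$g=\mathrm{grid}(z,\omega,\lceil8/\omega\rceil,\lceil8/\omega\rceil)\quad\text{with}\quad \omega=\frac{\gamma^4}{4}n^{-\frac{8\alpha+13}{3}},$$ where $z$ is chosen uniformly at random (independently of $G_1,G_2$) from the square with bottom left corner $-4-4i$ and side length $\omega$. Then $\|\widetilde A\|_2\le3$, $\|\widetilde B\|_2\le3$, and $\Lambda_\epsilon(\widetilde A,n^\alpha\widetilde B)$ is shattered with respect to $g$ for $$\epsilon=\frac{\gamma^5}{64n^{\frac{11\alpha+25}{3}}+\gamma^5}$$ with probability at least $$\left[1-\frac{82}{n}-\frac{531441}{16n^2}\right]\left[1-\frac{n^{2-2\alpha}}{\gamma^2}-4e^{-n}\right]$$ (the bound being vacuous if one of the bracketed factors is negative).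
   Context: $\|\cdot\|_2$ is the spectral norm. A complex Ginibre matrix is a random $G\in\mathbb{C}^{n\times n}$ with i.i.d. entries distributed as the complex normal $\mathcal N_{\mathbb C}(0,\frac1n)$. For $z_0\in\mathbb{C}$, $\omega>0$ and positive integers $s_1,s_2$, $\mathrm{grid}(z_0,\omega,s_1,s_2)$ is the union of the boundaries of the boxes of an $s_1\times s_2$ lattice of $\omega\times\omega$ squares in $\mathbb{C}$ whose lower left corner is $z_0$, with grid lines parallel to the real and imaginary axes. The $\epsilon$-pseudospectrum of a pencil is $$\Lambda_\epsilon(A,B)=\{z\in\mathbb{C}:\exists\,u\neq0,\ (A+\Delta A)u=z(B+\Delta B)u\text{ for some }\|\Delta A\|_2,\|\Delta B\|_2\le\epsilon\}.$$ $\Lambda_\epsilon(A,B)$ is shattered with respect to a grid $g$ if $\Lambda_\epsilon(A,B)\cap g=\emptyset$ and each eigenvalue of $(A,B)$ is contained in a unique box of $g$ (every eigenvalue lies in some box and no two eigenvalues share a box). *)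

theory Defs
  imports
    "HOL-Probability.Probability"
    "HOL-Computational_Algebra.Fundamental_Theorem_Algebra"
begin

definition spectral_norm :: "complex^'n^'n \<Rightarrow> real" where
  "spectral_norm A = onorm (\<lambda>u. A *v u)"

(* Density of N_C(0, v): real and imaginary parts are independent N(0, v/2), so that the
   total variance E|X|^2 is v.  The second argument of normal_density is the standard deviation. *)
definition complex_normal_density :: "real \<Rightarrow> complex \<Rightarrow> real" where
  "complex_normal_density v z =
     normal_density 0 (sqrt (v / 2)) (Re z) * normal_density 0 (sqrt (v / 2)) (Im z)"

definition complex_ginibre :: "'a measure \<Rightarrow> ('a \<Rightarrow> complex^'n^'n) \<Rightarrow> bool" where
  "complex_ginibre M G \<longleftrightarrow>
     prob_space.indep_vars M (\<lambda>_. borel) (\<lambda>(i, j) x. G x $ i $ j) UNIV \<and>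
     (\<forall>i j. distributed M lborel (\<lambda>x. G x $ i $ j)
        (\<lambda>z. ennreal (complex_normal_density (1 / real CARD('n)) z)))"

(* Counterpart of indep_var for random variables with values in different types. *)
definition indep_random_variables ::
    "'a measure \<Rightarrow> 'b measure \<Rightarrow> ('a \<Rightarrow> 'b) \<Rightarrow> 'c measure \<Rightarrow> ('a \<Rightarrow> 'c) \<Rightarrow> bool" where
  "indep_random_variables M S X T Y \<longleftrightarrow>
     X \<in> measurable M S \<and> Y \<in> measurable M T \<and>
     prob_space.indep_set M
       (sets (vimage_algebra (space M) X S)) (sets (vimage_algebra (space M) Y T))"

definition grid_box :: "complex \<Rightarrow> real \<Rightarrow> nat \<Rightarrow> nat \<Rightarrow> complex set" where
  "grid_box z0 \<omega> j k =
     cbox (z0 + of_real \<omega> * Complex (real j) (real k))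
          (z0 + of_real \<omega> * Complex (real j + 1) (real k + 1))"

definition grid_boxes :: "complex \<Rightarrow> real \<Rightarrow> nat \<Rightarrow> nat \<Rightarrow> complex set set" where
  "grid_boxes z0 \<omega> s1 s2 = {grid_box z0 \<omega> j k | j k. j < s1 \<and> k < s2}"

definition grid :: "complex \<Rightarrow> real \<Rightarrow> nat \<Rightarrow> nat \<Rightarrow> complex set" where
  "grid z0 \<omega> s1 s2 = (\<Union>b\<in>grid_boxes z0 \<omega> s1 s2. frontier b)"

definition pencil_pseudospectrum ::
    "real \<Rightarrow> complex^'n^'n \<Rightarrow> complex^'n^'n \<Rightarrow> complex set" where
  "pencil_pseudospectrum \<epsilon> A B =
     {z. \<exists>u \<Delta>A \<Delta>B. u \<noteq> 0 \<and> spectral_norm \<Delta>A \<le> \<epsilon> \<and> spectral_norm \<Delta>B \<le> \<epsilon> \<and>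
        (A + \<Delta>A) *v u = z *s ((B + \<Delta>B) *v u)}"

(* The polynomial det (A - z B) in the indeterminate z. *)
definition pencil_poly :: "complex^'n^'n \<Rightarrow> complex^'n^'n \<Rightarrow> complex poly" where
  "pencil_poly A B = det (\<chi> i j. [:A $ i $ j, - B $ i $ j:])"

(* The n eigenvalues of a regular pencil, with algebraic multiplicity; None is the eigenvalue
   at infinity, whose multiplicity is the degree deficit of det (A - z B).
   Meaningless for a singular pencil, i.e. if pencil_poly A B = 0. *)
definition pencil_eigenvalues ::
    "complex^'n^'n \<Rightarrow> complex^'n^'n \<Rightarrow> complex option multiset" where
  "pencil_eigenvalues A B =
     image_mset Some (proots (pencil_poly A B)) +
     replicate_mset (CARD('n) - degree (pencil_poly A B)) None"

(* Every complex number is an eigenvalue of a singular pencil, so such a pencil is not shattered.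
   Boxes are closed; since finite eigenvalues lie in the pseudospectrum (for nonnegative \<epsilon>), the
   first condition keeps them off the box boundaries.  An infinite eigenvalue lies in no box. *)
definition shattered ::
    "real \<Rightarrow> complex^'n^'n \<Rightarrow> complex^'n^'n \<Rightarrow> complex \<Rightarrow> real \<Rightarrow> nat \<Rightarrow> nat \<Rightarrow> bool" where
  "shattered \<epsilon> A B z0 \<omega> s1 s2 \<longleftrightarrow>
     pencil_pseudospectrum \<epsilon> A B \<inter> grid z0 \<omega> s1 s2 = {} \<and>
     pencil_poly A B \<noteq> 0 \<and>
     (\<forall>l\<in># pencil_eigenvalues A B. \<exists>!b. b \<in> grid_boxes z0 \<omega> s1 s2 \<and> l \<in> Some ` b) \<and>
     (\<forall>b\<in>grid_boxes z0 \<omega> s1 s2. size {#l \<in># pencil_eigenvalues A B. l \<in> Some ` b#} \<le> 1)"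

end

theory Submission
  imports Defs
begin

text \<open>
  The law of a Ginibre matrix is the isotropic Gaussian measure on the Euclidean space of matrices.
  Exchanging the component of a Gaussian vector along an isometrically embedded subspace with an
  independent Gaussian vector is an isometry, so such components may be resampled independently
  while everything else is kept fixed. This yields the norm bound and the estimate
  \<open>e n (n + 1) s\<^sup>2 / \<gamma>\<^sup>2\<close> for the probability that the least singular value of \<open>A + \<gamma> G\<close> is at most \<open>s\<close>
  (resample along a random left direction \<open>x\<close> and use that \<open>\<bar>M\<inverse> x\<bar>\<close> is comparable to the norm of
  \<open>M\<inverse>\<close> with the right probability). With \<open>G2\<close> fixed and good, put \<open>B = n\<^sup>\<alpha> (B + \<gamma> G2)\<close>:

  \<^item> two eigenvalues in one box of the grid force two columns of the pencil at a nearby lattice point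
    to be almost dependent modulo the others, which is an event of fourth order in \<open>\<omega>\<close>, so that a union
    bound over the lattice suffices;
  \<^item> a large residue of the resolvent at some eigenvalue makes the pencil nearly singular on a disc of
    proportional radius, so Fatou's lemma and the singular value estimate bound all residues;
  \<^item> the randomly shifted grid stays away from the eigenvalues, and the partial fraction expansion of the
    resolvent then bounds it on the grid, which keeps the pseudospectrum off the grid.
\<close>

section \<open>Isotropic Gaussian measures\<close>

text \<open>The scaling by \<open>n powr \<alpha>\<close> confines the eigenvalues: the scaled
  second matrix has least singular value at least 6/10 with the required probability, and 1 +
  (26/10)/2 = 23/10 bounds the norm of the first, so every eigenvalue has modulus at most 23/6 < 4
  and is caught by the grid for each value of the shift. The order of conditioning matters: the
  lattice is deterministic, the second matrix is frozen before the first is sampled, and the shift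
  comes last, when at most n known points are to be avoided. Fourth order suffices because the
  lattice has about \<omega>^(-2) points, so that \<omega>^2 remains to beat powers of n and
  1/\<gamma>. Residues sit at random points, out of reach of a union bound; instead the area on
  which the pencil is nearly singular is averaged over the disc of radius 4. Events that quantify
  over uncountably many vectors and points get their measurability from projections of closed sets
  along compact ones. Nonnegativity of the two bracketed factors forces n >= 83 and \<alpha> > 1,
  and the numerical estimates draw on both.\<close>

lemma emeasure_lborel_plus:
  fixes A :: "'a::euclidean_space set"
  assumes "A \<in> sets borel"
  shows "(\<integral>\<^sup>+x. indicator A (x + t) \<partial>lborel) = emeasure lborel A"
proof -
  have "(\<integral>\<^sup>+x. indicator A (x + t) \<partial>lborel) = (\<integral>\<^sup>+x. indicator A x \<partial>distr lborel borel (\<lambda>x. x + t))"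
    using assms by (subst nn_integral_distr) auto
  also have "distr lborel borel (\<lambda>x. x + t) = lborel"
    using lborel_affine[of 1 t] by (simp add: density_1 add.commute)
  finally show ?thesis using assms by simp
qed

text \<open>The image measure is translation invariant because \<open>f\<close> is onto, and it
  agrees with Lebesgue measure on centred balls. Sigma-finite translation invariant measures are
  proportional to Lebesgue measure, and the unit ball fixes the factor.\<close>

lemma lborel_distr_isometry:
  fixes f :: "'a::euclidean_space \<Rightarrow> 'a"
  assumes lin: "linear f" and nrm: "\<And>x. norm (f x) = norm x"
  shows "distr lborel borel f = lborel"
proof -
  have meas[measurable]: "f \<in> borel_measurable borel"
    using lin by (simp add: borel_measurable_continuous_onI linear_continuous_on linear_linear)
  have "inj f"
    using lin nrm by (metis linear_injective_0 norm_eq_zero)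
  then have "surj f" using lin linear_injective_imp_surjective by blast
  define \<mu> where "\<mu> = distr lborel borel f"
  have [simp, measurable_cong]: "sets \<mu> = sets borel" and [simp]: "space \<mu> = UNIV" by (auto simp: \<mu>_def)
  have ball: "f -` ball 0 r = ball 0 r" for r by (auto simp: nrm)
  have \<mu>_ball: "emeasure \<mu> (ball 0 r) = emeasure lborel (ball 0 r :: 'a set)" for r
    unfolding \<mu>_def by (subst emeasure_distr) (auto simp: ball)
  have sf: "sigma_finite_measure \<mu>"
  proof
    show "\<exists>A. countable A \<and> A \<subseteq> sets \<mu> \<and> \<Union> A = space \<mu> \<and> (\<forall>a\<in>A. emeasure \<mu> a \<noteq> \<infinity>)"
    proof (intro exI conjI)
      show "countable (range (\<lambda>n::nat. ball (0::'a) (real n)))" by simp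
      show "range (\<lambda>n. ball 0 (real n)) \<subseteq> sets \<mu>" by auto
      show "\<Union> (range (\<lambda>n. ball (0::'a) (real n))) = space \<mu>"
        by (auto simp: dist_norm) (meson reals_Archimedean2)
      show "\<forall>a\<in>range (\<lambda>n. ball 0 (real n)). emeasure \<mu> a \<noteq> \<infinity>"
        using emeasure_lborel_ball_finite[where 'a='a] by (auto simp: \<mu>_ball less_top)
    qed
  qed
  interpret P: pair_sigma_finite \<mu> "lborel :: 'a measure"
    by (simp add: pair_sigma_finite_def sf sigma_finite_lborel)
  have tr: "(\<integral>\<^sup>+x. indicator A (x + t) \<partial>\<mu>) = emeasure \<mu> A" if A[measurable]: "A \<in> sets borel" for A t
  proof -
    obtain s where s: "t = f s" using \<open>surj f\<close> by (metis surjD)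
    have "(\<integral>\<^sup>+x. indicator A (x + t) \<partial>\<mu>) = (\<integral>\<^sup>+x. indicator A (f x + t) \<partial>lborel)"
      unfolding \<mu>_def by (subst nn_integral_distr) auto
    also have "\<dots> = (\<integral>\<^sup>+x. indicator (f -` A) (x + s) \<partial>lborel)"
      by (intro nn_integral_cong) (auto simp: s linear_add[OF lin] indicator_def)
    also have "\<dots> = emeasure lborel (f -` A)"
      using measurable_sets[OF meas that] by (intro emeasure_lborel_plus) simp
    also have "\<dots> = emeasure \<mu> A" unfolding \<mu>_def by (subst emeasure_distr) auto
    finally show ?thesis .
  qed
  have im_eq: "uminus ` A = {z. - z \<in> A}" for A :: "'a set"
    by (auto simp: image_iff) (metis minus_minus)
  \<comment> \<open>The uniqueness argument for Haar measure: the integral of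
    \<open>indicator A x * indicator B (y + x)\<close> is computed in both orders, with the
    invariance of \<open>\<mu>\<close> moving the shift from \<open>B\<close> to \<open>A\<close>.
    The reflection of \<open>A\<close> that this produces is removed by \<open>neg\<close>.\<close>
  have key: "emeasure \<mu> A * emeasure lborel B = emeasure \<mu> B * emeasure lborel (uminus ` A)"
    if [measurable]: "A \<in> sets borel" "B \<in> sets borel" for A B :: "'a set"
  proof -
    have "emeasure \<mu> A * emeasure lborel B = (\<integral>\<^sup>+x. indicator A x * emeasure lborel B \<partial>\<mu>)"
      by (simp add: nn_integral_multc)
    also have "\<dots> = (\<integral>\<^sup>+x. \<integral>\<^sup>+y. indicator A x * indicator B (y + x) \<partial>lborel \<partial>\<mu>)"
      by (intro nn_integral_cong) (simp add: nn_integral_cmult emeasure_lborel_plus)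
    also have "\<dots> = (\<integral>\<^sup>+y. \<integral>\<^sup>+x. indicator A x * indicator B (y + x) \<partial>\<mu> \<partial>lborel)"
      by (intro P.Fubini'[symmetric]) (simp add: \<mu>_def)
    also have "\<dots> = (\<integral>\<^sup>+y. \<integral>\<^sup>+x. indicator ({z. z - y \<in> A} \<inter> B) (x + y) \<partial>\<mu> \<partial>lborel)"
      by (intro nn_integral_cong) (auto simp: indicator_def add.commute)
    also have "\<dots> = (\<integral>\<^sup>+y. \<integral>\<^sup>+x. indicator A (x - y) * indicator B x \<partial>\<mu> \<partial>lborel)"
    proof (rule nn_integral_cong)
      fix y
      have "(\<integral>\<^sup>+x. indicator ({z. z - y \<in> A} \<inter> B) (x + y) \<partial>\<mu>) = emeasure \<mu> ({z. z - y \<in> A} \<inter> B)"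
        by (intro tr) measurable
      also have "\<dots> = (\<integral>\<^sup>+x. indicator ({z. z - y \<in> A} \<inter> B) x \<partial>\<mu>)"
        by (intro nn_integral_indicator[symmetric]) (simp add: \<mu>_def)
      also have "\<dots> = (\<integral>\<^sup>+x. indicator A (x - y) * indicator B x \<partial>\<mu>)"
        by (intro nn_integral_cong) (auto simp: indicator_def)
      finally show "(\<integral>\<^sup>+x. indicator ({z. z - y \<in> A} \<inter> B) (x + y) \<partial>\<mu>)
        = (\<integral>\<^sup>+x. indicator A (x - y) * indicator B x \<partial>\<mu>)" .
    qed
    also have "\<dots> = (\<integral>\<^sup>+x. \<integral>\<^sup>+y. indicator A (x - y) * indicator B x \<partial>lborel \<partial>\<mu>)"
      by (intro P.Fubini') (simp add: \<mu>_def)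
    also have "\<dots> = (\<integral>\<^sup>+x. indicator B x * emeasure lborel (uminus ` A) \<partial>\<mu>)"
    proof (rule nn_integral_cong)
      fix x
      have im: "uminus ` A \<in> sets borel"
      unfolding im_eq by measurable
      have "(\<integral>\<^sup>+y. indicator A (x - y) * indicator B x \<partial>lborel)
          = (\<integral>\<^sup>+y. indicator A (x - y) \<partial>lborel) * indicator B x"
        by (intro nn_integral_multc) simp
      also have "(\<integral>\<^sup>+y. indicator A (x - y) \<partial>lborel) = (\<integral>\<^sup>+y. indicator (uminus ` A) (y + (- x)) \<partial>lborel)"
        by (intro nn_integral_cong) (simp add: indicator_def im_eq)
      also have "\<dots> = emeasure lborel (uminus ` A)" by (intro emeasure_lborel_plus im)
      finally show "(\<integral>\<^sup>+y. indicator A (x - y) * indicator B x \<partial>lborel)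
        = indicator B x * emeasure lborel (uminus ` A)" by (simp add: mult.commute)
    qed
    also have "\<dots> = emeasure \<mu> B * emeasure lborel (uminus ` A)" by (simp add: nn_integral_multc)
    finally show ?thesis .
  qed
  have neg: "emeasure lborel (uminus ` A) = emeasure lborel A" if [measurable]: "A \<in> sets borel" for A :: "'a set"
  proof -
    have "distr lborel borel (uminus :: 'a \<Rightarrow> 'a) = lborel"
      using lborel_affine[of "-1" "0::'a"] by (simp add: density_1)
    then have "emeasure lborel A = emeasure (distr lborel borel (uminus :: 'a \<Rightarrow> 'a)) A" by simp
    also have "\<dots> = emeasure lborel (uminus ` A)"
      by (subst emeasure_distr) (auto simp: im_eq vimage_def)
    finally show ?thesis ..
  qed
  have fin: "emeasure lborel (ball (0::'a) 1) \<noteq> 0" "emeasure lborel (ball (0::'a) 1) \<noteq> \<infinity>"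
    using emeasure_bounded_finite[of "ball (0::'a) 1"]
    by (auto simp: emeasure_lborel_ball_finite) (metis emeasure_ball ennreal_eq_0_iff less_eq_real_def
        mult_le_0_iff not_less one_power2 power_one unit_ball_vol_pos mult.right_neutral zero_less_one of_nat_0_le_iff)
  have "emeasure \<mu> A = emeasure lborel A" if A: "A \<in> sets borel" for A
  proof -
    have "emeasure lborel (ball (0::'a) 1) * emeasure \<mu> A = emeasure lborel (ball (0::'a) 1) * emeasure lborel A"
      using key[OF A, of "ball 0 1"] by (simp add: neg[OF A] \<mu>_ball mult.commute)
    then show ?thesis using fin by (auto simp: ennreal_mult_cancel_left)
  qed
  then show ?thesis by (intro measure_eqI) (auto simp: \<mu>_def)
qed

text \<open>A real coordinate has variance 1/(2a), so a complex coordinate has E|z|^2 = 1/a and an n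
  by n Ginibre matrix corresponds to a = n. The general type lets vectors, matrices and pairs be
  treated alike.\<close>

definition gauss :: "real \<Rightarrow> 'a::euclidean_space measure" where
  "gauss a = density lborel (\<lambda>x. ennreal (sqrt (a / pi) ^ DIM('a) * exp (- a * (norm x)\<^sup>2)))"

lemma sets_gauss [simp, measurable_cong]: "sets (gauss a) = sets borel"
  and space_gauss [simp]: "space (gauss a) = UNIV"
  by (simp_all add: gauss_def)

lemma prod_gauss_density:
  fixes x :: "'a::euclidean_space"
  shows "sqrt (a / pi) ^ DIM('a) * exp (- a * (norm x)\<^sup>2)
    = (\<Prod>b\<in>Basis. sqrt (a / pi) * exp (- a * (x \<bullet> b)\<^sup>2))"
proof -
  have "(norm x)\<^sup>2 = (\<Sum>b\<in>Basis. (x \<bullet> b)\<^sup>2)"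
    by (simp add: norm_eq_sqrt_inner euclidean_inner[of x x] power2_eq_square real_sqrt_mult_self
        sum_nonneg)
  then show ?thesis
    by (simp add: prod.distrib exp_sum[symmetric] sum_distrib_left)
qed

lemma normal_density_gauss:
  assumes "a > 0"
  shows "normal_density 0 (sqrt (1 / (2 * a))) x = sqrt (a / pi) * exp (- a * x\<^sup>2)"
  using assms by (simp add: normal_density_def real_sqrt_divide field_simps)

lemma prob_space_gauss:
  assumes "a > 0"
  shows "prob_space (gauss a :: 'a::euclidean_space measure)"
proof
  have 1: "(\<integral>\<^sup>+x. ennreal (sqrt (a / pi) * exp (- a * x\<^sup>2)) \<partial>lborel) = 1"
    using prob_space.emeasure_space_1[OF prob_space_normal_density[of "sqrt (1 / (2 * a))" 0]] assms
    by (simp add: emeasure_density normal_density_gauss[OF assms])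
  have "emeasure (gauss a :: 'a measure) (space (gauss a)) =
    (\<integral>\<^sup>+x. (\<Prod>b\<in>(Basis::'a set). ennreal (sqrt (a / pi) * exp (- a * (x \<bullet> b)\<^sup>2))) \<partial>lborel)"
    unfolding gauss_def prod_gauss_density using assms by (simp add: emeasure_density prod_ennreal)
  also have "\<dots> = 1"
    using 1 by (subst nn_integral_lborel_prod) simp_all
  finally show "emeasure (gauss a :: 'a measure) (space (gauss a)) = 1" .
qed

lemma nn_integral_gauss_exp:
  assumes "a > 0" "a + k > 0"
  shows "(\<integral>\<^sup>+x. ennreal (exp (- k * (norm x)\<^sup>2)) \<partial>(gauss a :: 'a::euclidean_space measure))
    = ennreal (sqrt (a / (a + k)) ^ DIM('a))"
proof -
  have "(\<integral>\<^sup>+x. ennreal (exp (- k * (norm x)\<^sup>2)) \<partial>(gauss a :: 'a measure))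
    = (\<integral>\<^sup>+x. ennreal (sqrt (a / pi) ^ DIM('a) * exp (- a * (norm x)\<^sup>2)) * ennreal (exp (- k * (norm x)\<^sup>2)) \<partial>(lborel :: 'a measure))"
    unfolding gauss_def by (subst nn_integral_density) auto
  also have "\<dots> = (\<integral>\<^sup>+x. ennreal (sqrt (a / (a + k)) ^ DIM('a)) *
      ennreal (sqrt ((a + k) / pi) ^ DIM('a) * exp (- (a + k) * (norm x)\<^sup>2)) \<partial>(lborel :: 'a measure))"
  proof (intro nn_integral_cong)
    fix x :: 'a
    have "sqrt (a / pi) ^ DIM('a) = sqrt (a / (a + k)) ^ DIM('a) * sqrt ((a + k) / pi) ^ DIM('a)"
      using assms by (simp add: power_mult_distrib[symmetric] real_sqrt_mult[symmetric])
    then show "ennreal (sqrt (a / pi) ^ DIM('a) * exp (- a * (norm x)\<^sup>2)) * ennreal (exp (- k * (norm x)\<^sup>2))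
      = ennreal (sqrt (a / (a + k)) ^ DIM('a)) *
        ennreal (sqrt ((a + k) / pi) ^ DIM('a) * exp (- (a + k) * (norm x)\<^sup>2))"
      using assms by (simp add: ennreal_mult[symmetric] exp_add[symmetric] algebra_simps)
  qed
  also have "\<dots> = ennreal (sqrt (a / (a + k)) ^ DIM('a)) * emeasure (gauss (a + k) :: 'a measure) UNIV"
    by (subst nn_integral_cmult) (auto simp: gauss_def emeasure_density)
  also have "emeasure (gauss (a + k) :: 'a measure) UNIV = 1"
    using prob_space.emeasure_space_1[OF prob_space_gauss[OF assms(2)]] by simp
  finally show ?thesis by simp
qed

text \<open>Squared norms add on a product, so the product density is again isotropic; an isometry
  may then mix the two factors.\<close>

lemma gauss_pair:
  assumes "a > 0"
  shows "(gauss a :: 'a::euclidean_space measure) \<Otimes>\<^sub>M (gauss a :: 'b::euclidean_space measure) = gauss a"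
proof -
  have [measurable]: "(\<lambda>x :: 'a \<times> 'b. norm x) \<in> borel_measurable (borel \<Otimes>\<^sub>M borel)"
    unfolding borel_prod by simp
  have "sigma_finite_measure (gauss a :: 'b measure)"
    using prob_space_gauss[OF assms] prob_space_imp_sigma_finite by blast
  then have "(gauss a :: 'a measure) \<Otimes>\<^sub>M (gauss a :: 'b measure) =
    density (lborel \<Otimes>\<^sub>M lborel) (\<lambda>(x, y). ennreal (sqrt (a / pi) ^ DIM('a) * exp (- a * (norm x)\<^sup>2)) *
      ennreal (sqrt (a / pi) ^ DIM('b) * exp (- a * (norm y)\<^sup>2)))"
    unfolding gauss_def
    by (intro pair_measure_density) (auto intro: sigma_finite_lborel)
  also have "\<dots> = gauss a"
    unfolding gauss_def lborel_prod
    using assms by (intro density_cong)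
      (auto simp: ennreal_mult[symmetric] norm_Pair power_add exp_add[symmetric] algebra_simps
        simp flip: borel_prod)
  finally show ?thesis .
qed

lemma gauss_isometry:
  fixes f :: "'a::euclidean_space \<Rightarrow> 'a"
  assumes lin: "linear f" and nrm: "\<And>x. norm (f x) = norm x"
  shows "distr (gauss a) borel f = gauss a"
proof -
  have meas[measurable]: "f \<in> borel_measurable borel"
    using lin by (simp add: borel_measurable_continuous_onI linear_continuous_on linear_linear)
  let ?d = "\<lambda>x::'a. ennreal (sqrt (a / pi) ^ DIM('a) * exp (- a * (norm x)\<^sup>2))"
  have "gauss a = density (distr lborel borel f) ?d"
    by (simp add: gauss_def lborel_distr_isometry[OF lin nrm])
  also have "\<dots> = distr (density lborel (\<lambda>x. ?d (f x))) borel f"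
    by (intro density_distr) auto
  also have "\<dots> = distr (gauss a) borel f" by (simp add: gauss_def nrm)
  finally show ?thesis ..
qed

text \<open>By \<open>adj\<close> and \<open>inv\<close>, \<open>J\<close> is an isometric embedding
  with adjoint \<open>J'\<close>, and \<open>J (J' v)\<close> is the orthogonal projection of
  \<open>v\<close> onto the range of \<open>J\<close>.\<close>

locale gauss_split =
  fixes J :: "'e::euclidean_space \<Rightarrow> 'v::euclidean_space" and J' :: "'v \<Rightarrow> 'e"
  assumes lin_J: "linear J" and lin_J': "linear J'"
    and adj: "\<And>e v. J e \<bullet> v = e \<bullet> J' v" and inv: "\<And>e. J' (J e) = e"
begin

lemma meas_J [measurable]: "J \<in> borel_measurable borel" and meas_J' [measurable]: "J' \<in> borel_measurable borel"
  using lin_J lin_J' by (simp_all add: borel_measurable_continuous_onI linear_continuous_on linear_linear)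

text \<open>The map \<open>(v, e) \<mapsto> (v - J J' v + J e, J' v)\<close> exchanges the component of \<open>v\<close> in the
  range of \<open>J\<close> with \<open>e\<close>; it is an isometry and hence preserves the Gaussian measure.\<close>
lemma distr_swap:
  assumes "a > 0"
  shows "distr (gauss a \<Otimes>\<^sub>M gauss a) borel (\<lambda>(v, e). (v - J (J' v) + J e, J' v)) = gauss a"
proof -
  have lin: "linear (\<lambda>(v, e). (v - J (J' v) + J e, J' v))"
    using lin_J lin_J' by (auto intro!: linearI simp: linear_add linear_cmul algebra_simps)
  have 1: "(v - J (J' v)) \<bullet> J e = 0" for v e
    by (simp add: adj inner_commute[of _ "J e"] linear_diff[OF lin_J'] inv inner_diff_right)
  have sq: "(norm (v - J (J' v) + J e))\<^sup>2 = (norm (v - J (J' v)))\<^sup>2 + (norm e)\<^sup>2" for v e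
    using 1[of v e] by (simp add: power2_norm_eq_inner algebra_simps inner_commute adj inv)
  have nrm: "norm (case p of (v, e) \<Rightarrow> (v - J (J' v) + J e, J' v)) = norm p" for p
    using sq[of "fst p" "snd p"] sq[of "fst p" "J' (fst p)"] by (cases p) (simp add: norm_Pair)
  show ?thesis unfolding gauss_pair[OF assms] by (rule gauss_isometry[OF lin nrm])
qed

lemma nn_integral_swap:
  assumes "a > 0" and [measurable]: "F \<in> borel_measurable (borel \<Otimes>\<^sub>M borel)"
  shows "(\<integral>\<^sup>+v. \<integral>\<^sup>+e. F (v, e) \<partial>gauss a \<partial>gauss a)
    = (\<integral>\<^sup>+v. \<integral>\<^sup>+e. F (v - J (J' v) + J e, J' v) \<partial>gauss a \<partial>gauss a)"
proof -
  interpret E: prob_space "gauss a :: 'e measure" by (rule prob_space_gauss[OF assms(1)])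
  have "(\<integral>\<^sup>+v. \<integral>\<^sup>+e. F (v, e) \<partial>gauss a \<partial>gauss a) = (\<integral>\<^sup>+p. F p \<partial>(gauss a :: ('v \<times> 'e) measure))"
    unfolding gauss_pair[OF assms(1), symmetric] by (rule E.nn_integral_fst) auto
  also have "\<dots> = (\<integral>\<^sup>+p. F (case p of (v, e) \<Rightarrow> (v - J (J' v) + J e, J' v)) \<partial>(gauss a \<Otimes>\<^sub>M gauss a))"
    by (subst distr_swap[OF assms(1), symmetric], subst nn_integral_distr) (auto simp: borel_prod[symmetric])
  also have "\<dots> = (\<integral>\<^sup>+v. \<integral>\<^sup>+e. F (v - J (J' v) + J e, J' v) \<partial>gauss a \<partial>gauss a)"
    by (subst E.nn_integral_fst[symmetric]) (auto simp: split_def)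
  finally show ?thesis .
qed

text \<open>\<open>J' v\<close> is what the swap leaves in the second component, and the swap
  preserves the law of the pair.\<close>

lemma distr_J':
  assumes "a > 0"
  shows "distr (gauss a) borel J' = gauss a"
proof (rule measure_eqI)
  fix A assume "A \<in> sets (distr (gauss a) borel J')"
  then have [measurable]: "A \<in> sets borel" by simp
  interpret V: prob_space "gauss a :: 'v measure" by (rule prob_space_gauss[OF assms(1)])
  interpret E: prob_space "gauss a :: 'e measure" by (rule prob_space_gauss[OF assms(1)])
  have "emeasure (distr (gauss a) borel J') A = (\<integral>\<^sup>+v. indicator A (J' v) \<partial>gauss a)"
    by (subst nn_integral_distr[symmetric, of J' _ borel]) auto
  also have "\<dots> = (\<integral>\<^sup>+v. \<integral>\<^sup>+e. indicator A (snd (v - J (J' v) + J e, J' v)) \<partial>gauss a \<partial>gauss a)"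
    using E.emeasure_space_1 by (intro nn_integral_cong) simp
  also have "\<dots> = (\<integral>\<^sup>+v. \<integral>\<^sup>+e. indicator A (snd (v :: 'v, e)) \<partial>gauss a \<partial>gauss a)"
    by (rule nn_integral_swap[OF assms, symmetric]) auto
  also have "\<dots> = emeasure (gauss a) A"
    using V.emeasure_space_1 by simp
  finally show "emeasure (distr (gauss a) borel J') A = emeasure (gauss a) A" .
qed simp

lemma nn_integral_split:
  assumes "a > 0" and [measurable]: "F \<in> borel_measurable borel"
  shows "(\<integral>\<^sup>+v. F v \<partial>gauss a) = (\<integral>\<^sup>+v. \<integral>\<^sup>+e. F (v - J (J' v) + J e) \<partial>gauss a \<partial>gauss a)"
proof -
  interpret E: prob_space "gauss a :: 'e measure" by (rule prob_space_gauss[OF assms(1)])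
  have "(\<integral>\<^sup>+v. F v \<partial>gauss a) = (\<integral>\<^sup>+v. \<integral>\<^sup>+e. F (fst (v, e :: 'e)) \<partial>gauss a \<partial>gauss a)"
    using E.emeasure_space_1 by simp
  also have "\<dots> = (\<integral>\<^sup>+v. \<integral>\<^sup>+e. F (fst (v - J (J' v) + J e, J' v)) \<partial>gauss a \<partial>gauss a)"
    by (rule nn_integral_swap[OF assms(1)]) auto
  finally show ?thesis by simp
qed

end

section \<open>Complex vectors and Gaussian linear forms\<close>

text \<open>The Hermitian inner product, conjugate linear in the first argument. Its real part is
  the inner product of the underlying real space, which links it to the adjoints in
  \<open>gauss_split\<close>.\<close>

definition cdot :: "complex^'n \<Rightarrow> complex^'n \<Rightarrow> complex" where
  "cdot x y = (\<Sum>i\<in>UNIV. cnj (x $ i) * y $ i)"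

lemma Re_cdot: "Re (cdot x y) = x \<bullet> y"
  by (simp add: cdot_def inner_vec_def inner_complex_def)

lemma cdot_self: "cdot x x = of_real ((norm x)\<^sup>2)"
proof -
  have "Im (cdot x x) = 0" by (simp add: cdot_def)
  then show ?thesis by (simp add: complex_eq_iff Re_cdot power2_norm_eq_inner)
qed

lemma cnj_cdot: "cnj (cdot x y) = cdot y x"
  by (simp add: cdot_def mult.commute)

lemma cdot_add_right: "cdot x (y + z) = cdot x y + cdot x z"
  and cdot_diff_right: "cdot x (y - z) = cdot x y - cdot x z"
  and cdot_smult_right: "cdot x (c *s y) = c * cdot x y"
  and cdot_scaleR_right: "cdot x (r *\<^sub>R y) = of_real r * cdot x y"
  and cdot_smult_left: "cdot (c *s x) y = cnj c * cdot x y"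
  and cdot_scaleR_left: "cdot (r *\<^sub>R x) y = of_real r * cdot x y"
  and cdot_zero_right [simp]: "cdot x 0 = 0"
  by (simp_all add: cdot_def algebra_simps sum.distrib sum_subtractf sum_distrib_left
      scaleR_conv_of_real[where 'a = complex] mult_ac)

lemma cdot_sum_right: "cdot x (\<Sum>i\<in>I. f i) = (\<Sum>i\<in>I. cdot x (f i))"
  by (induction I rule: infinite_finite_induct) (auto simp: cdot_add_right)

lemma norm_smult_cvec: "norm (c *s x) = cmod c * norm (x :: complex^'n)"
proof -
  have "(norm (c *s x))\<^sup>2 = (cmod c * norm x)\<^sup>2"
  proof -
    have "complex_of_real ((norm (c *s x))\<^sup>2) = of_real ((cmod c * norm x)\<^sup>2)"
      unfolding cdot_self[symmetric] cdot_smult_right cdot_smult_left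
      by (simp add: cdot_self power_mult_distrib mult.assoc[symmetric] flip: complex_norm_square)
    then show ?thesis by (simp only: of_real_eq_iff)
  qed
  then show ?thesis by (simp add: power2_eq_iff_nonneg)
qed

lemma cmod_cdot_le: "cmod (cdot x y) \<le> norm x * norm y"
proof (cases "cdot x y = 0")
  case False
  define c where "c = cdot x y / cmod (cdot x y)"
  have "cmod c = 1" using False by (simp add: c_def norm_divide)
  have "cmod (cdot x y) = Re (cdot (c *s x) y)"
  proof -
    have "cnj c * cdot x y = cdot x y * cnj (cdot x y) / cmod (cdot x y)" by (simp add: c_def)
    also have "\<dots> = cmod (cdot x y)"
      unfolding complex_norm_square[symmetric] using False by (simp add: power2_eq_square)
    finally have "cnj c * cdot x y = cmod (cdot x y)" .
    then show ?thesis by (simp add: cdot_smult_left)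
  qed
  also have "\<dots> \<le> norm (c *s x) * norm y" by (simp add: Re_cdot norm_cauchy_schwarz)
  finally show ?thesis by (simp add: norm_smult_cvec \<open>cmod c = 1\<close>)
qed simp

lemma continuous_on_cdot [continuous_intros]:
  fixes f g :: "'a::topological_space \<Rightarrow> complex^'n"
  assumes "continuous_on S f" "continuous_on S g"
  shows "continuous_on S (\<lambda>x. cdot (f x) (g x))"
  unfolding cdot_def using assms by (intro continuous_intros) auto

definition ctranspose :: "complex^'n^'n \<Rightarrow> complex^'n^'n" where
  "ctranspose A = (\<chi> i j. cnj (A $ j $ i))"

lemma cdot_mult_right: "cdot x (A *v y) = cdot (ctranspose A *v x) y"
  unfolding cdot_def ctranspose_def matrix_vector_mult_def
  by (simp add: sum_distrib_left sum_distrib_right mult_ac) (rule sum.swap)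

lemma linear_mult_matrix: "linear (\<lambda>A :: complex^'n^'n. A *v x)"
  by (intro linearI) (simp_all add: matrix_vector_mult_def vec_eq_iff algebra_simps sum.distrib
      scaleR_sum_right)

lemma linear_mult_vec: "linear (\<lambda>x. (A :: complex^'n^'n) *v x)"
  by (intro linearI) (simp_all add: matrix_vector_mult_def vec_eq_iff algebra_simps sum.distrib
      scaleR_sum_right)

lemma gauss_split_direction:
  fixes w :: "complex^'n"
  assumes "norm w = 1"
  shows "gauss_split (\<lambda>z. z *s w) (\<lambda>v. cdot w v)"
proof (rule gauss_split.intro)
  show "linear (\<lambda>z. z *s w)" by (intro linearI) (auto simp: vec_eq_iff algebra_simps)
  show "linear (cdot w)" by (intro linearI) (auto simp: cdot_add_right cdot_scaleR_right scaleR_conv_of_real[where 'a = complex])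
  show "(e *s w) \<bullet> v = e \<bullet> cdot w v" for e v
    by (simp add: Re_cdot[symmetric] cdot_smult_left inner_complex_def)
  show "cdot w (e *s w) = e" for e by (simp add: cdot_smult_right cdot_self assms)
qed

text \<open>\<open>J e\<close> is the rank-one matrix that sends the unit vector \<open>x\<close> to
  \<open>e\<close> and kills its orthogonal complement. Consequently g x is itself a Gaussian
  vector.\<close>

lemma gauss_split_apply:
  fixes x :: "complex^'n"
  assumes "norm x = 1"
  shows "gauss_split (\<lambda>e. (\<chi> i j. e $ i * cnj (x $ j)) :: complex^'n^'n) (\<lambda>g. g *v x)"
proof (rule gauss_split.intro)
  show "linear (\<lambda>e. (\<chi> i j. e $ i * cnj (x $ j)) :: complex^'n^'n)"
    by (intro linearI) (auto simp: vec_eq_iff algebra_simps)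
  show "linear (\<lambda>g :: complex^'n^'n. g *v x)" by (rule linear_mult_matrix)
  show "((\<chi> i j. e $ i * cnj (x $ j)) :: complex^'n^'n) \<bullet> g = e \<bullet> (g *v x)" for e g
  proof -
    have "(c * cnj y) \<bullet> z = c \<bullet> (z * y)" for c y z :: complex
      by (simp add: inner_complex_def algebra_simps)
    then show ?thesis by (simp add: inner_vec_def matrix_vector_mult_def inner_sum_right)
  qed
  show "((\<chi> i j. e $ i * cnj (x $ j)) :: complex^'n^'n) *v x = e" for e
  proof -
    have "(\<Sum>j\<in>UNIV. cnj (x $ j) * x $ j) = 1" using cdot_self[of x] assms by (simp add: cdot_def)
    then show ?thesis
      by (simp add: vec_eq_iff matrix_vector_mult_def mult.assoc flip: sum_distrib_left)
  qed
qed

text \<open>The mirror image acting from the left: \<open>J'\<close> collects the components of all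
  columns along \<open>x\<close>, and \<open>J h\<close> has all its columns along \<open>x\<close>.
  Resampling therefore changes a product g u only in the direction \<open>x\<close>.\<close>

lemma gauss_split_adjoint_apply:
  fixes x :: "complex^'n"
  assumes "norm x = 1"
  shows "gauss_split (\<lambda>h. (\<chi> i j. x $ i * h $ j) :: complex^'n^'n) (\<lambda>g. \<chi> j. \<Sum>i\<in>UNIV. cnj (x $ i) * g $ i $ j)"
proof (rule gauss_split.intro)
  show "linear (\<lambda>h. (\<chi> i j. x $ i * h $ j) :: complex^'n^'n)"
    by (intro linearI) (auto simp: vec_eq_iff algebra_simps)
  show "linear (\<lambda>g :: complex^'n^'n. \<chi> j. \<Sum>i\<in>UNIV. cnj (x $ i) * g $ i $ j)"
    by (intro linearI) (auto simp: vec_eq_iff algebra_simps sum.distrib scaleR_sum_right)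
  show "((\<chi> i j. x $ i * e $ j) :: complex^'n^'n) \<bullet> g = e \<bullet> (\<chi> j. \<Sum>i\<in>UNIV. cnj (x $ i) * g $ i $ j)" for e g
  proof -
    have "(c * y) \<bullet> z = y \<bullet> (cnj c * z)" for c y z :: complex
      by (simp add: inner_complex_def algebra_simps)
    then show ?thesis by (simp add: inner_vec_def inner_sum_right) (rule sum.swap)
  qed
  show "(\<chi> j. \<Sum>i\<in>UNIV. cnj (x $ i) * ((\<chi> i j. x $ i * e $ j) :: complex^'n^'n) $ i $ j) = e" for e
  proof -
    have "(\<Sum>j\<in>UNIV. cnj (x $ j) * x $ j) = 1" using cdot_self[of x] assms by (simp add: cdot_def)
    then show ?thesis
      by (simp add: vec_eq_iff flip: mult.assoc sum_distrib_right)
  qed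
qed

lemma gauss_split_column:
  "gauss_split (\<lambda>e. (\<chi> a b. if b = i then e $ a else 0) :: complex^'n^'n) (column i)"
proof (rule gauss_split.intro)
  show "linear (\<lambda>e. (\<chi> a b. if b = i then e $ a else 0) :: complex^'n^'n)"
    by (intro linearI) (auto simp: vec_eq_iff)
  show "linear (column i :: complex^'n^'n \<Rightarrow> _)" by (intro linearI) (auto simp: vec_eq_iff column_def)
  show "((\<chi> a b. if b = i then e $ a else 0) :: complex^'n^'n) \<bullet> g = e \<bullet> column i g" for e g
    by (simp add: inner_vec_def column_def if_distrib[of "\<lambda>z. z \<bullet> _"] cong: if_cong)
  show "column i ((\<chi> a b. if b = i then e $ a else 0) :: complex^'n^'n) = e" for e
    by (simp add: vec_eq_iff column_def)
qed

section \<open>Small-ball, tail and cap probabilities of complex Gaussian vectors\<close>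

lemma emeasure_gauss_disc:
  assumes "0 < a" "0 \<le> t" "0 < \<gamma>"
  shows "emeasure (gauss a) {z. cmod (c + of_real \<gamma> * z) \<le> t} \<le> ennreal (a * t\<^sup>2 / \<gamma>\<^sup>2)"
proof -
  have eq: "{z. cmod (c + of_real \<gamma> * z) \<le> t} = cball (- c / of_real \<gamma>) (t / \<gamma>)"
  proof -
    have "cmod (c + of_real \<gamma> * z) = \<gamma> * dist (- c / of_real \<gamma>) z" for z
    proof -
      have "c + of_real \<gamma> * z = - of_real \<gamma> * (- c / of_real \<gamma> - z)" using assms by (simp add: field_simps)
      then show ?thesis using assms by (simp add: dist_norm norm_mult del: minus_add_distrib)
    qed
    then show ?thesis using assms by (auto simp: field_simps)
  qed
  have "emeasure (gauss a) (cball (- c / of_real \<gamma>) (t / \<gamma>))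
    \<le> (\<integral>\<^sup>+z. ennreal (a / pi) * indicator (cball (- c / of_real \<gamma>) (t / \<gamma>)) z \<partial>lborel)"
    unfolding gauss_def using assms
    by (subst emeasure_density) (auto intro!: nn_integral_mono mult_right_mono ennreal_leI
        simp: power2_eq_square mult_left_le divide_simps)
  also have "\<dots> = ennreal (a / pi) * ennreal (pi * (t / \<gamma>)\<^sup>2)"
    using assms by (subst nn_integral_cmult_indicator) (auto simp: emeasure_cball unit_ball_vol_2)
  also have "\<dots> = ennreal (a * t\<^sup>2 / \<gamma>\<^sup>2)"
    using assms by (subst ennreal_mult[symmetric]) (auto simp: power_divide)
  finally show ?thesis by (simp add: eq)
qed

text \<open>Projection to the direction of \<open>q\<close> leaves one complex Gaussian, whose
  density is at most a/pi, in a disc of radius t / (\<gamma> |q|).\<close>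

lemma emeasure_gauss_form:
  fixes q :: "complex^'n"
  assumes "0 < a" "0 \<le> t" "0 < \<gamma>" "q \<noteq> 0"
  shows "emeasure (gauss a) {f. cmod (c + of_real \<gamma> * cdot q f) \<le> t} \<le> ennreal (a * t\<^sup>2 / (\<gamma> * norm q)\<^sup>2)"
proof -
  define w where "w = (1 / norm q) *\<^sub>R q"
  have w: "norm w = 1" using assms by (simp add: w_def)
  interpret gauss_split "\<lambda>z. z *s w" "\<lambda>v. cdot w v" by (rule gauss_split_direction[OF w])
  have "q = norm q *\<^sub>R w" using assms by (simp add: w_def)
  then have q: "cdot q f = of_real (norm q) * cdot w f" for f by (metis cdot_scaleR_left)
  have "emeasure (gauss a) {f. cmod (c + of_real \<gamma> * cdot q f) \<le> t}
    = emeasure (distr (gauss a) borel (cdot w)) {z. cmod (c + of_real (\<gamma> * norm q) * z) \<le> t}"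
    by (subst emeasure_distr) (auto simp: q vimage_def mult_ac)
  also have "\<dots> \<le> ennreal (a * t\<^sup>2 / (\<gamma> * norm q)\<^sup>2)"
    unfolding distr_J'[OF assms(1)] using assms by (intro emeasure_gauss_disc) auto
  finally show ?thesis .
qed

lemma emeasure_annulus:
  assumes "0 \<le> v" "v \<le> y"
  shows "emeasure lborel {z :: complex. v < (cmod z)\<^sup>2 \<and> (cmod z)\<^sup>2 \<le> y} = ennreal (pi * (y - v))"
proof -
  have *: "cmod z \<le> sqrt u \<longleftrightarrow> (cmod z)\<^sup>2 \<le> u" for z u
    by (metis norm_ge_zero real_sqrt_le_iff real_sqrt_abs abs_of_nonneg)
  have "{z :: complex. v < (cmod z)\<^sup>2 \<and> (cmod z)\<^sup>2 \<le> y} = cball 0 (sqrt y) - cball 0 (sqrt v)"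
    using assms by (auto simp: *)
  moreover have "emeasure lborel (cball 0 (sqrt y) - cball (0::complex) (sqrt v)) = ennreal (pi * y) - ennreal (pi * v)"
    using assms subset_cball[OF real_sqrt_le_mono[OF assms(2)]]
    by (subst emeasure_Diff) (simp_all add: emeasure_cball unit_ball_vol_2)
  ultimately show ?thesis using assms by (simp add: ennreal_minus algebra_simps)
qed

text \<open>The squared modulus is exponentially distributed. Writing exp(-|z|^2) as the integral of
  exp(-y) over y >= |z|^2 and exchanging the integrals replaces polar coordinates by areas of
  annuli.\<close>

lemma emeasure_gauss_tail:
  assumes "0 \<le> v"
  shows "emeasure (gauss 1) {z :: complex. v < (cmod z)\<^sup>2} = ennreal (exp (- v))"
proof -
  have top: "((\<lambda>y. (y - v + 1) * exp (- y)) \<longlongrightarrow> 0) at_top" for v :: real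
    by real_asymp
  have 1: "(\<integral>\<^sup>+y. ennreal (exp (- y)) * indicator {s..} y \<partial>lborel) = ennreal (exp (- s))" for s :: real
  proof -
    have "((\<lambda>y::real. - exp (- y)) \<longlongrightarrow> 0) at_top" by real_asymp
    then show ?thesis
      by (subst nn_integral_FTC_atLeast[where F = "\<lambda>y. - exp (- y)" and T = 0])
         (auto intro!: derivative_eq_intros)
  qed
  define S where "S = {p :: complex \<times> real. (cmod (fst p))\<^sup>2 \<le> snd p}"
  have S: "(z, y) \<in> S \<longleftrightarrow> (cmod z)\<^sup>2 \<le> y" for z y by (simp add: S_def)
  have m[measurable]: "S \<in> sets (borel \<Otimes>\<^sub>M borel)"
    unfolding borel_prod S_def by (intro borel_closed closed_Collect_le continuous_intros)
  have "emeasure (gauss 1) {z :: complex. v < (cmod z)\<^sup>2}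
    = (\<integral>\<^sup>+z. ennreal (1 / pi) * (ennreal (exp (- (cmod z)\<^sup>2)) * indicator {z. v < (cmod z)\<^sup>2} z) \<partial>lborel)"
    unfolding gauss_def
    by (subst emeasure_density) (auto intro!: nn_integral_cong simp: indicator_def simp flip: ennreal_mult')
  also have "\<dots> = ennreal (1 / pi) * (\<integral>\<^sup>+z. ennreal (exp (- (cmod z)\<^sup>2)) * indicator {z. v < (cmod z)\<^sup>2} z \<partial>lborel)"
    by (intro nn_integral_cmult) measurable
  also have "(\<integral>\<^sup>+z. ennreal (exp (- (cmod z)\<^sup>2)) * indicator {z. v < (cmod z)\<^sup>2} z \<partial>lborel)
    = (\<integral>\<^sup>+z. \<integral>\<^sup>+y. ennreal (exp (- y)) * indicator S (z, y) * indicator {z. v < (cmod z)\<^sup>2} z \<partial>lborel \<partial>lborel)"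
  proof (rule nn_integral_cong)
    fix z :: complex
    have "ennreal (exp (- (cmod z)\<^sup>2)) = (\<integral>\<^sup>+y. ennreal (exp (- y)) * indicator S (z, y) \<partial>lborel)"
      by (subst 1[of "(cmod z)\<^sup>2", symmetric], intro nn_integral_cong) (auto simp: indicator_def S)
    then show "ennreal (exp (- (cmod z)\<^sup>2)) * indicator {z. v < (cmod z)\<^sup>2} z =
      (\<integral>\<^sup>+y. ennreal (exp (- y)) * indicator S (z, y) * indicator {z. v < (cmod z)\<^sup>2} z \<partial>lborel)"
      by (simp add: nn_integral_multc)
  qed
  also have "\<dots> = (\<integral>\<^sup>+y. \<integral>\<^sup>+z. ennreal (exp (- y)) * indicator S (z, y) * indicator {z. v < (cmod z)\<^sup>2} z \<partial>lborel \<partial>lborel)"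
    by (intro lborel_pair.Fubini'[symmetric]) simp
  also have "\<dots> = (\<integral>\<^sup>+y. ennreal (pi * ((y - v) * exp (- y))) * indicator {v..} y \<partial>lborel)"
  proof (rule nn_integral_cong)
    fix y :: real
    have "(\<integral>\<^sup>+z. ennreal (exp (- y)) * indicator S (z, y) * indicator {z. v < (cmod z)\<^sup>2} z \<partial>lborel)
      = (\<integral>\<^sup>+z. ennreal (exp (- y)) * indicator {z. v < (cmod z)\<^sup>2 \<and> (cmod z)\<^sup>2 \<le> y} z \<partial>lborel)"
      by (intro nn_integral_cong) (auto simp: indicator_def S)
    also have "\<dots> = ennreal (exp (- y)) * emeasure lborel {z :: complex. v < (cmod z)\<^sup>2 \<and> (cmod z)\<^sup>2 \<le> y}"
      by (intro nn_integral_cmult_indicator) measurable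
    also have "\<dots> = ennreal (pi * ((y - v) * exp (- y))) * indicator {v..} y"
    proof (cases "v \<le> y")
      case True
      then show ?thesis using assms
        by (simp add: emeasure_annulus flip: ennreal_mult')
    next
      case False
      then have "{z :: complex. v < (cmod z)\<^sup>2 \<and> (cmod z)\<^sup>2 \<le> y} = {}" by auto
      then show ?thesis using False by (simp only: emeasure_empty) simp
    qed
    finally show "(\<integral>\<^sup>+z. ennreal (exp (- y)) * indicator S (z, y) * indicator {z. v < (cmod z)\<^sup>2} z \<partial>lborel)
      = ennreal (pi * ((y - v) * exp (- y))) * indicator {v..} y" .
  qed
  also have "\<dots> = ennreal (pi * exp (- v))"
  proof -
    have "((\<lambda>y. - pi * ((y - v + 1) * exp (- y))) \<longlongrightarrow> - pi * 0) at_top"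
      by (rule tendsto_mult[OF tendsto_const top])
    then show ?thesis
      by (subst nn_integral_FTC_atLeast[where F = "\<lambda>y. - pi * ((y - v + 1) * exp (- y))" and T = 0])
         (auto intro!: derivative_eq_intros simp: algebra_simps)
  qed
  finally show ?thesis by (simp flip: ennreal_mult')
qed

text \<open>Let e be the coordinate of x along \<open>q\<close> and v' the rest. With k = b/(1-b)
  the event reads k |v'|^2 < |e|^2, and replacing v' by a full Gaussian vector v only shrinks it.
  Given v the smaller event has probability exp(-k |v|^2), and averaging yields (1+k)^(-n) =
  (1-b)^n.\<close>

lemma emeasure_gauss_cap:
  fixes q :: "complex^'n"
  assumes q: "norm q = 1" and b: "0 \<le> b" "b < 1"
  shows "ennreal ((1 - b) ^ CARD('n)) \<le> emeasure (gauss 1) {x. b * (norm x)\<^sup>2 < (cmod (cdot q x))\<^sup>2}"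
proof -
  interpret gauss_split "\<lambda>z. z *s q" "\<lambda>v. cdot q v" by (rule gauss_split_direction[OF q])
  define k where "k = b / (1 - b)"
  have k: "0 \<le> k" "1 + k = 1 / (1 - b)" using b by (auto simp: k_def field_simps)
  let ?S = "{x. b * (norm x)\<^sup>2 < (cmod (cdot q x))\<^sup>2}"
  have [measurable]: "?S \<in> sets borel" by measurable
  have "sqrt (1 / (1 + k)) ^ DIM(complex^'n) = (1 - b) ^ CARD('n)"
    using b by (simp add: k power_mult mult.commute[of _ 2])
  then have "ennreal ((1 - b) ^ CARD('n)) = (\<integral>\<^sup>+v. ennreal (exp (- k * (norm v)\<^sup>2)) \<partial>(gauss 1 :: (complex^'n) measure))"
    using k b by (subst nn_integral_gauss_exp) auto
  also have "\<dots> = (\<integral>\<^sup>+v. \<integral>\<^sup>+e. indicator {z. k * (norm v)\<^sup>2 < (cmod z)\<^sup>2} e \<partial>gauss 1 \<partial>(gauss 1 :: (complex^'n) measure))"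
    using k by (intro nn_integral_cong) (simp add: emeasure_gauss_tail)
  also have "\<dots> \<le> (\<integral>\<^sup>+v. \<integral>\<^sup>+e. indicator ?S (v - cdot q v *s q + e *s q) \<partial>gauss 1 \<partial>gauss 1)"
  proof (intro nn_integral_mono)
    fix v :: "complex^'n" and e :: complex
    let ?x = "v - cdot q v *s q + e *s q"
    have "cdot q ?x = e" using q by (simp add: cdot_add_right cdot_diff_right cdot_smult_right cdot_self)
    moreover have "(norm ?x)\<^sup>2 \<le> (norm v)\<^sup>2 + (cmod e)\<^sup>2"
    proof -
      have n: "(norm (v - cdot q v *s q + z *s q))\<^sup>2 = (norm (v - cdot q v *s q))\<^sup>2 + (cmod z)\<^sup>2" for z
      proof -
        have "(v - cdot q v *s q) \<bullet> (z *s q) = 0"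
          using q unfolding inner_commute[of _ "z *s q"] adj
          by (simp add: cdot_diff_right cdot_smult_right cdot_self)
        then have "(norm (v - cdot q v *s q + z *s q))\<^sup>2 = (norm (v - cdot q v *s q))\<^sup>2 + (norm (z *s q))\<^sup>2"
          by (intro norm_add_Pythagorean) (simp add: orthogonal_def)
        then show ?thesis using q by (simp add: norm_smult_cvec)
      qed
      show ?thesis using n[of e] n[of "cdot q v"] by simp
    qed
    moreover have "k * (norm v)\<^sup>2 < (cmod e)\<^sup>2 \<Longrightarrow> b * ((norm v)\<^sup>2 + (cmod e)\<^sup>2) < (cmod e)\<^sup>2"
      using b by (simp add: k_def field_simps)
    ultimately show "indicator {z. k * (norm v)\<^sup>2 < (cmod z)\<^sup>2} e \<le> (indicator ?S ?x :: ennreal)"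
      using b by (auto simp: indicator_def) (meson b(1) less_le_trans mult_left_mono not_less)
  qed
  also have "\<dots> = (\<integral>\<^sup>+x. indicator ?S x \<partial>gauss 1)" by (rule nn_integral_split[symmetric]) auto
  finally show ?thesis by simp
qed

section \<open>The norm of a Ginibre matrix\<close>

lemma mult_vec_scaleR: "(A :: complex^'n^'n) *v (r *\<^sub>R x) = r *\<^sub>R (A *v x)"
  by (rule linear_cmul[OF linear_mult_vec])

lemma continuous_on_mult_vec [continuous_intros]:
  fixes f :: "'a::topological_space \<Rightarrow> complex^'n^'n"
  assumes "continuous_on S f" "continuous_on S g"
  shows "continuous_on S (\<lambda>x. f x *v g x)"
  unfolding matrix_vector_mult_def using assms by (intro continuous_intros continuous_on_vec_lambda) auto

text \<open>Take h as the direction of g p and \<open>q\<close> as the normalised image of h under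
  the adjoint. Then |g x| is at least |<h, g x>|, which is |<q, x>| times the norm of that image,
  and this norm is at least |g p|. The vector \<open>q\<close> does the work of a leading right
  singular vector although \<open>p\<close> need not be extremal.\<close>

lemma expanding_direction:
  fixes g :: "complex^'n^'n"
  assumes "norm p = 1" "s \<le> norm (g *v p)" "0 < s"
  shows "\<exists>q. norm q = 1 \<and> (\<forall>x. s * cmod (cdot q x) \<le> norm (g *v x))"
proof -
  define h where "h = (1 / norm (g *v p)) *\<^sub>R (g *v p)"
  have pos: "norm (g *v p) > 0" using assms by linarith
  then have h: "norm h = 1" by (simp add: h_def)
  define q0 where "q0 = ctranspose g *v h"
  have q0: "cdot q0 x = cdot h (g *v x)" for x by (simp add: q0_def cdot_mult_right)
  have "cdot h (g *v p) = norm (g *v p)"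
    using pos by (simp add: h_def cdot_scaleR_left cdot_self power2_eq_square)
  then have "norm (g *v p) \<le> norm q0" using cmod_cdot_le[of q0 p] assms by (simp add: q0)
  then have s: "s \<le> norm q0" using assms by linarith
  define q where "q = (1 / norm q0) *\<^sub>R q0"
  have nz: "q0 \<noteq> 0" using s assms by auto
  have "norm q = 1" using nz by (simp add: q_def)
  moreover have "s * cmod (cdot q x) \<le> norm (g *v x)" for x
  proof -
    have "s * cmod (cdot q x) \<le> norm q0 * cmod (cdot q x)" using s by (intro mult_right_mono) auto
    also have "\<dots> = cmod (cdot q0 x)" using nz by (simp add: q_def cdot_scaleR_left norm_mult norm_divide)
    also have "\<dots> \<le> norm (g *v x)" using cmod_cdot_le[of h "g *v x"] h by (simp add: q0)
    finally show ?thesis .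
  qed
  ultimately show ?thesis by blast
qed

lemma nn_integral_gauss_apply:
  fixes x :: "complex^'n"
  assumes N: "0 < N" and c: "0 \<le> c" "c < 1"
  shows "(\<integral>\<^sup>+g. ennreal (exp (c * N * ((norm ((g :: complex^'n^'n) *v x))\<^sup>2 / (norm x)\<^sup>2))) \<partial>gauss N) \<le> ennreal (1 / (1 - c) ^ CARD('n))"
proof (cases "x = 0")
  \<comment> \<open>Division by zero makes the exponent 0 here, so the integrand is 1.\<close>
  case True
  interpret prob_space "gauss N :: (complex^'n^'n) measure" by (rule prob_space_gauss[OF N])
  have "1 \<le> 1 / (1 - c) ^ CARD('n)" using c by (simp add: power_le_one)
  then show ?thesis using True emeasure_space_1 by simp
next
  case False
  define w where "w = (1 / norm x) *\<^sub>R x"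
  have w: "norm w = 1" using False by (simp add: w_def)
  interpret gauss_split "\<lambda>e. (\<chi> i j. e $ i * cnj (w $ j)) :: complex^'n^'n" "\<lambda>g. g *v w"
    by (rule gauss_split_apply[OF w])
  have "(\<integral>\<^sup>+g. ennreal (exp (c * N * ((norm ((g :: complex^'n^'n) *v x))\<^sup>2 / (norm x)\<^sup>2))) \<partial>gauss N)
    = (\<integral>\<^sup>+g. ennreal (exp (c * N * (norm (g *v w))\<^sup>2)) \<partial>(gauss N :: (complex^'n^'n) measure))"
    using False by (simp add: w_def mult_vec_scaleR power_divide)
  also have "\<dots> = (\<integral>\<^sup>+e. ennreal (exp (- (- (c * N)) * (norm e)\<^sup>2)) \<partial>distr (gauss N) borel (\<lambda>g :: complex^'n^'n. g *v w))"
    by (subst nn_integral_distr) auto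
  also have "\<dots> = ennreal (sqrt (N / (N + - (c * N))) ^ DIM(complex^'n))"
    unfolding distr_J'[OF N] using N c by (intro nn_integral_gauss_exp) auto
  also have "N / (N + - (c * N)) = 1 / (1 - c)" using N c by (simp add: field_simps)
  also have "sqrt (1 / (1 - c)) ^ DIM(complex^'n) = 1 / (1 - c) ^ CARD('n)"
    using c by (simp add: power_mult mult.commute[of _ 2] power_divide real_sqrt_divide)
  finally show ?thesis by simp
qed

lemma open_large_norm: "open {g :: complex^'n^'n. \<exists>p. norm p = 1 \<and> s < norm (g *v p)}"
proof -
  have "{g :: complex^'n^'n. \<exists>p. norm p = 1 \<and> s < norm (g *v p)} = (\<Union>p\<in>{p. norm p = 1}. {g. s < norm (g *v p)})" by auto
  moreover have "open {g :: complex^'n^'n. s < norm (g *v p)}" for p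
    by (intro open_Collect_less continuous_intros)
  ultimately show ?thesis by auto
qed

text \<open>An averaging argument instead of a net on the sphere. If g has norm above s, a random
  Gaussian x satisfies |g x|^2 >= b s^2 |x|^2 with probability at least (1-b)^n, which bounds the
  x-average of the exponential from below. For each x its g-average is at most (1-c)^(-n); Fubini
  compares the two.\<close>

lemma emeasure_gauss_large_norm:
  assumes b: "0 \<le> b" "b < 1" and c: "0 \<le> c" "c < 1" and s: "0 < s"
  shows "emeasure (gauss (real CARD('n))) {g :: complex^'n^'n. \<exists>p. norm p = 1 \<and> s < norm (g *v p)}
    \<le> ennreal ((exp (- c * b * s\<^sup>2) / ((1 - b) * (1 - c))) ^ CARD('n))"
proof -
  define N where "N = real CARD('n)"
  have N: "0 < N" by (simp add: N_def)
  define S where "S = {g :: complex^'n^'n. \<exists>p. norm p = 1 \<and> s < norm (g *v p)}"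
  have "open S" unfolding S_def by (rule open_large_norm)
  then have [measurable]: "S \<in> sets borel" by simp
  let ?F = "\<lambda>(g :: complex^'n^'n) x :: complex^'n. ennreal (exp (c * N * ((norm (g *v x))\<^sup>2 / (norm x)\<^sup>2)))"
  interpret P: pair_prob_space "gauss N :: (complex^'n^'n) measure" "gauss 1 :: (complex^'n) measure"
    by (simp add: pair_prob_space_def pair_sigma_finite_def prob_space_gauss N
        prob_space_imp_sigma_finite)
  have m1: "(\<lambda>p. fst p *v snd p) \<in> borel_measurable (borel :: ((complex^'n^'n) \<times> (complex^'n)) measure)"
    by (intro borel_measurable_continuous_onI continuous_intros)
  have m[measurable]: "(\<lambda>p. fst p *v snd p) \<in> borel_measurable ((borel :: (complex^'n^'n) measure) \<Otimes>\<^sub>M (borel :: (complex^'n) measure))"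
    using m1 by (simp add: borel_prod)
  have mF: "(\<lambda>p. ?F (fst p) (snd p)) \<in> borel_measurable (gauss N \<Otimes>\<^sub>M gauss 1)"
    by measurable
  let ?K = "exp (c * b * s\<^sup>2) ^ CARD('n) * (1 - b) ^ CARD('n)"
  have "ennreal ?K * emeasure (gauss N) S = (\<integral>\<^sup>+g. ennreal ?K * indicator S g \<partial>gauss N)"
    by (subst nn_integral_cmult_indicator) auto
  also have "\<dots> \<le> (\<integral>\<^sup>+g. \<integral>\<^sup>+x. ?F g x \<partial>gauss 1 \<partial>gauss N)"
  proof (rule nn_integral_mono)
    fix g :: "complex^'n^'n"
    show "ennreal ?K * indicator S g \<le> (\<integral>\<^sup>+x. ?F g x \<partial>gauss 1)"
    proof (cases "g \<in> S")
      case True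
      then obtain p where "norm p = 1" "s \<le> norm (g *v p)" by (auto simp: S_def)
      from expanding_direction[OF this s] obtain q where q: "norm q = 1"
        "\<And>x. s * cmod (cdot q x) \<le> norm (g *v x)" by blast
      let ?C = "{x. b * (norm x)\<^sup>2 < (cmod (cdot q x))\<^sup>2}"
      have [measurable]: "?C \<in> sets borel"
        by (intro borel_open open_Collect_less continuous_intros)
      have "ennreal ?K \<le> ennreal (exp (c * b * s\<^sup>2) ^ CARD('n)) * emeasure (gauss 1) ?C"
        using emeasure_gauss_cap[OF q(1) b] b by (subst ennreal_mult) (auto intro!: mult_left_mono)
      also have "\<dots> = (\<integral>\<^sup>+x. ennreal (exp (c * b * s\<^sup>2) ^ CARD('n)) * indicator ?C x \<partial>gauss 1)"
        by (subst nn_integral_cmult_indicator) auto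
      also have "\<dots> \<le> (\<integral>\<^sup>+x. ?F g x \<partial>gauss 1)"
      proof (rule nn_integral_mono)
        fix x :: "complex^'n"
        show "ennreal (exp (c * b * s\<^sup>2) ^ CARD('n)) * indicator ?C x \<le> ?F g x"
        proof (cases "x \<in> ?C")
          case x: True
          then have "x \<noteq> 0" by auto
          have "s\<^sup>2 * (b * (norm x)\<^sup>2) \<le> s\<^sup>2 * (cmod (cdot q x))\<^sup>2" using x by (intro mult_left_mono) auto
          also have "\<dots> \<le> (norm (g *v x))\<^sup>2"
            unfolding power_mult_distrib[symmetric] using q s by (intro power_mono) auto
          finally have "b * s\<^sup>2 \<le> (norm (g *v x))\<^sup>2 / (norm x)\<^sup>2"
            using \<open>x \<noteq> 0\<close> by (simp add: field_simps)
          then have "(c * N) * (b * s\<^sup>2) \<le> c * N * ((norm (g *v x))\<^sup>2 / (norm x)\<^sup>2)"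
            using c N by (intro mult_left_mono) auto
          then show ?thesis using x
            by (simp add: N_def exp_of_nat_mult[symmetric] mult_ac)
        qed simp
      qed
      finally show ?thesis using True by simp
    qed simp
  qed
  also have "\<dots> = (\<integral>\<^sup>+x. \<integral>\<^sup>+g. ?F g x \<partial>gauss N \<partial>gauss 1)"
    using P.Fubini'[of ?F] mF by (simp add: split_def)
  also have "\<dots> \<le> (\<integral>\<^sup>+x. ennreal (1 / (1 - c) ^ CARD('n)) \<partial>(gauss 1 :: (complex^'n) measure))"
    by (intro nn_integral_mono nn_integral_gauss_apply N c)
  also have "\<dots> = ennreal (1 / (1 - c) ^ CARD('n))"
    using P.M2.emeasure_space_1 by simp
  finally have *: "ennreal ?K * emeasure (gauss N) S \<le> ennreal (1 / (1 - c) ^ CARD('n))" .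
  have K: "?K > 0" using b by simp
  have "emeasure (gauss N) S = ennreal (1 / ?K) * (ennreal ?K * emeasure (gauss N) S)"
  proof -
    have "ennreal (1 / ?K) * ennreal ?K = 1"
      using K b by (subst ennreal_mult'[symmetric]) auto
    then show ?thesis by (simp only: mult.assoc[symmetric] mult_1)
  qed
  also have "\<dots> \<le> ennreal (1 / ?K) * ennreal (1 / (1 - c) ^ CARD('n))"
    by (intro mult_left_mono *) auto
  also have "\<dots> = ennreal ((exp (- c * b * s\<^sup>2) / ((1 - b) * (1 - c))) ^ CARD('n))"
    using b c by (simp add: power_divide power_mult_distrib exp_minus inverse_eq_divide mult_ac flip: ennreal_mult')
  finally show ?thesis by (simp add: S_def N_def)
qed

text \<open>The values b = c = 4/5 are close to optimal for s = 26/10, and this s is chosen so that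
  1 + s/2 = 23/10.\<close>

lemma emeasure_gauss_norm:
  "emeasure (gauss (real CARD('n))) {g :: complex^'n^'n. \<exists>p. norm p = 1 \<and> 26 / 10 < norm (g *v p)}
    \<le> ennreal (exp (- real CARD('n)))"
proof -
  \<comment> \<open>3.326 lies slightly above the logarithm of 25, and 3.326 - 4.3264 is still below
    -1.\<close>
  have *: "(25 :: real) \<le> exp (3326 / 1000)"
  proof -
    have "(25 :: real) \<le> (1 + 3326 / 1000 / real 64) ^ 64" by (simp add: power_divide)
    also have "\<dots> \<le> exp (3326 / 1000)" by (rule exp_ge_one_plus_x_over_n_power_n) auto
    finally show ?thesis .
  qed
  have "exp (- (4 / 5) * (4 / 5) * (26 / 10)\<^sup>2) / ((1 - 4 / 5) * (1 - 4 / 5)) = 25 * exp (- 43264 / 10000 :: real)"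
    by (simp add: power2_eq_square)
  also have "\<dots> \<le> exp (3326 / 1000) * exp (- 43264 / 10000)" using * by (intro mult_right_mono) auto
  also have "\<dots> \<le> exp (- 1)" unfolding exp_add[symmetric] by simp
  finally have "(exp (- (4 / 5) * (4 / 5) * (26 / 10)\<^sup>2) / ((1 - 4 / 5) * (1 - 4 / 5))) ^ CARD('n) \<le> exp (- 1 :: real) ^ CARD('n)"
    by (intro power_mono) auto
  also have "\<dots> = exp (- real CARD('n))" by (simp flip: exp_of_nat_mult)
  finally show ?thesis
    by (intro order_trans[OF emeasure_gauss_large_norm[of "4 / 5" "4 / 5" "26 / 10"]] ennreal_leI) auto
qed

section \<open>The least singular value of a shifted Ginibre matrix\<close>

text \<open>The source of the measurability proofs below: a sequence of witnesses in
  \<open>K\<close> has a convergent subsequence, so a quantifier over a compact set preserves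
  closedness.\<close>

lemma closed_ex_compact:
  fixes C :: "('a::metric_space \<times> 'b::metric_space) set"
  assumes "closed C" "compact K"
  shows "closed {x. \<exists>k\<in>K. (x, k) \<in> C}"
  unfolding closed_sequential_limits
proof (intro allI impI)
  fix x l assume *: "(\<forall>n. x n \<in> {x. \<exists>k\<in>K. (x, k) \<in> C}) \<and> x \<longlonglongrightarrow> l"
  then obtain k where k: "\<And>n. k n \<in> K" "\<And>n. (x n, k n) \<in> C" by simp metis
  from assms(2) k(1) obtain m r where m: "m \<in> K" "strict_mono r" "(k \<circ> r) \<longlonglongrightarrow> m"
    unfolding compact_def by blast
  have "(x \<circ> r) \<longlonglongrightarrow> l" using * m(2) by (simp add: LIMSEQ_subseq_LIMSEQ)
  then have "(\<lambda>n. ((x \<circ> r) n, (k \<circ> r) n)) \<longlonglongrightarrow> (l, m)" using m(3) by (intro tendsto_Pair)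
  then have "(l, m) \<in> C" using k(2) closed_sequentially[OF assms(1), of "\<lambda>n. (x (r n), k (r n))"] by (simp add: comp_def)
  then show "l \<in> {x. \<exists>k\<in>K. (x, k) \<in> C}" using m(1) by auto
qed

lemma borel_Un_countable_closed:
  fixes C :: "nat \<Rightarrow> 'a::topological_space set"
  assumes "S = (\<Union>m. C m)" "\<And>m. closed (C m)"
  shows "S \<in> sets borel"
  using assms by auto

lemma ex_kernel_vec:
  fixes A :: "complex^'n^'n"
  assumes "\<not> invertible A"
  shows "\<exists>u. norm u = 1 \<and> A *v u = 0"
proof -
  obtain u where u: "A *v u = 0" "u \<noteq> 0"
    using assms matrix_left_invertible_ker[of A] invertible_left_inverse[of A] by auto
  then have "norm ((1 / norm u) *\<^sub>R u) = 1" "A *v ((1 / norm u) *\<^sub>R u) = 0"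
    by (simp_all add: mult_vec_scaleR)
  then show ?thesis by blast
qed

text \<open>Turns the bilinear sum of u_i v_i into a Hermitian product, to which the Gaussian
  estimates apply.\<close>

definition vcnj :: "complex^'n \<Rightarrow> complex^'n" where
  "vcnj u = (\<chi> i. cnj (u $ i))"

lemma cdot_vcnj: "cdot (vcnj u) v = (\<Sum>i\<in>UNIV. u $ i * v $ i)"
  by (simp add: cdot_def vcnj_def)

lemma norm_vcnj [simp]: "norm (vcnj u) = norm u"
  by (simp add: norm_vec_def vcnj_def)

lemma vcnj_eq_0_iff [simp]: "vcnj u = 0 \<longleftrightarrow> u = 0"
  by (metis norm_eq_zero norm_vcnj)

lemma ex_left_kernel_vec:
  fixes A :: "complex^'n^'n"
  assumes "\<not> invertible A"
  shows "\<exists>q. norm q = 1 \<and> (\<forall>u. cdot q (A *v u) = 0)"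
proof -
  have "\<not> invertible (transpose A)" using assms by (simp add: invertible_det_nz)
  then obtain r where r: "norm r = 1" "transpose A *v r = 0" using ex_kernel_vec by blast
  have "cdot (vcnj r) (A *v u) = 0" for u
  proof -
    have "cdot (vcnj r) (A *v u) = (\<Sum>j\<in>UNIV. (transpose A *v r) $ j * u $ j)"
      unfolding cdot_vcnj matrix_vector_mult_def transpose_def
      by (simp add: sum_distrib_left sum_distrib_right mult_ac) (rule sum.swap)
    then show ?thesis using r by simp
  qed
  then show ?thesis using r by (intro exI[of _ "vcnj r"]) simp
qed

text \<open>For \<open>x\<close> a unit vector and \<open>M\<close> invertible, \<open>M\<close> belongs to this set iff \<open>1 / \<bar>M\<inverse> x\<bar> \<le> t\<close>.\<close>
definition short_preimage :: "real \<Rightarrow> complex^'n \<Rightarrow> (complex^'n^'n) set" where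
  "short_preimage t x = {M. \<forall>u \<tau>. norm u = 1 \<and> M *v u = \<tau> *s x \<longrightarrow> norm (M *v u) \<le> t}"

lemma short_preimageD:
  "M \<in> short_preimage t x \<Longrightarrow> norm u = 1 \<Longrightarrow> M *v u = \<tau> *s x \<Longrightarrow> norm (M *v u) \<le> t"
  unfolding short_preimage_def by blast

text \<open>The complement is a countable union of projections of closed sets: the index m replaces
  the strict inequality by a margin 1/(m+1) and confines the scalar \<tau> to a compact
  disc.\<close>

lemma borel_short_preimage:
  "{p :: (complex^'n^'n) \<times> (complex^'n). A + \<gamma> *\<^sub>R fst p \<in> short_preimage t (snd p)} \<in> sets borel"
proof -
  let ?C = "\<lambda>m::nat. {q :: ((complex^'n^'n) \<times> (complex^'n)) \<times> ((complex^'n) \<times> complex).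
    (A + \<gamma> *\<^sub>R fst (fst q)) *v fst (snd q) = snd (snd q) *s snd (fst q) \<and>
    t + 1 / Suc m \<le> norm ((A + \<gamma> *\<^sub>R fst (fst q)) *v fst (snd q))}"
  let ?K = "\<lambda>m::nat. sphere (0::complex^'n) 1 \<times> cball (0::complex) m"
  have sm: "continuous_on UNIV (\<lambda>q :: ((complex^'n^'n) \<times> (complex^'n)) \<times> ((complex^'n) \<times> complex).
    snd (snd q) *s snd (fst q))"
    unfolding vector_scalar_mult_def by (intro continuous_intros continuous_on_vec_lambda)
  have "closed (?C m)" for m
    by (intro closed_Collect_conj closed_Collect_eq closed_Collect_le continuous_intros sm)
  moreover have "compact (?K m)" for m by (intro compact_Times compact_sphere compact_cball)
  ultimately have cl: "closed {p. \<exists>k\<in>?K m. (p, k) \<in> ?C m}" for m by (rule closed_ex_compact)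
  have "- {p :: (complex^'n^'n) \<times> (complex^'n). A + \<gamma> *\<^sub>R fst p \<in> short_preimage t (snd p)}
    = (\<Union>m. {p. \<exists>k\<in>?K m. (p, k) \<in> ?C m})" (is "- ?S = ?T")
  proof (intro set_eqI iffI)
    fix p assume "p \<in> - ?S"
    then obtain u \<tau> where u: "norm u = 1" "(A + \<gamma> *\<^sub>R fst p) *v u = \<tau> *s snd p"
      "t < norm ((A + \<gamma> *\<^sub>R fst p) *v u)" by (auto simp: short_preimage_def not_le)
    obtain m1 :: nat where m1: "cmod \<tau> \<le> m1" using real_arch_simple by blast
    obtain m2 :: nat where m2: "1 / Suc m2 < norm ((A + \<gamma> *\<^sub>R fst p) *v u) - t"
      using nat_approx_posE[of "norm ((A + \<gamma> *\<^sub>R fst p) *v u) - t"] u(3) by (metis diff_gt_0_iff_gt)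
    have "1 / real (Suc (max m1 m2)) \<le> 1 / real (Suc m2)" by (intro divide_left_mono) auto
    then have "(u, \<tau>) \<in> ?K (max m1 m2)" "(p, (u, \<tau>)) \<in> ?C (max m1 m2)"
      using u m1 m2 by auto
    then show "p \<in> ?T" by blast
  next
    fix p assume "p \<in> ?T"
    then obtain m k where "k \<in> ?K m" "(p, k) \<in> ?C m" by blast
    then have k: "norm (fst k) = 1" "(p, (fst k, snd k)) \<in> ?C m" by (auto simp: mem_Times_iff)
    have "0 < 1 / real (Suc m)" by simp
    moreover have "t + 1 / real (Suc m) \<le> norm ((A + \<gamma> *\<^sub>R fst p) *v fst k)"
      and eq: "(A + \<gamma> *\<^sub>R fst p) *v fst k = snd k *s snd p"
      using k(2) unfolding mem_Collect_eq fst_conv snd_conv by blast+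
    ultimately have "t < norm ((A + \<gamma> *\<^sub>R fst p) *v fst k)" by linarith
    moreover have "p \<in> ?S \<Longrightarrow> norm ((A + \<gamma> *\<^sub>R fst p) *v fst k) \<le> t"
      using k(1) eq unfolding short_preimage_def by blast
    ultimately show "p \<in> - ?S" by fastforce
  qed
  then have "- ?S \<in> sets borel" using cl by auto
  then show ?thesis using borel_comp[of "- ?S"] by simp
qed

lemma perturbed_mult_vec:
  "((A :: complex^'n^'n) + \<gamma> *\<^sub>R (V - X + Y)) *v u
    = (A + \<gamma> *\<^sub>R V) *v u - \<gamma> *\<^sub>R (X *v u) + \<gamma> *\<^sub>R (Y *v u)"
proof -
  have "(r *\<^sub>R B) *v u = r *\<^sub>R (B *v u)" for r and B :: "complex^'n^'n"
    by (rule linear_cmul[OF linear_mult_matrix])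
  then show ?thesis
    by (simp add: matrix_vector_mult_add_rdistrib matrix_vector_mult_diff_rdistrib algebra_simps)
qed

text \<open>Resample the left component along x. The matrix without this component is singular, and
  a unit kernel vector u of it is mapped by every resampled matrix to a multiple of x, namely an
  affine Gaussian form in \<open>h\<close>. Membership forces the modulus of this form to be at most
  t.\<close>

lemma emeasure_short_preimage:
  fixes A :: "complex^'n^'n" and x :: "complex^'n"
  assumes N: "0 < N" and \<gamma>: "0 < \<gamma>" and t: "0 \<le> t" and x: "x \<noteq> 0"
  shows "emeasure (gauss N) {g. A + \<gamma> *\<^sub>R g \<in> short_preimage t x} \<le> ennreal (N * t\<^sup>2 / \<gamma>\<^sup>2)"
proof -
  define w where "w = (1 / norm x) *\<^sub>R x"
  have w: "norm w = 1" using x by (simp add: w_def)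
  let ?J = "\<lambda>h. (\<chi> i j. w $ i * h $ j) :: complex^'n^'n"
  let ?J' = "\<lambda>g :: complex^'n^'n. (\<chi> j. \<Sum>i\<in>UNIV. cnj (w $ i) * g $ i $ j) :: complex^'n"
  interpret gauss_split ?J ?J' by (rule gauss_split_adjoint_apply[OF w])
  interpret V: prob_space "gauss N :: (complex^'n^'n) measure" by (rule prob_space_gauss[OF N])
  let ?S = "{g. A + \<gamma> *\<^sub>R g \<in> short_preimage t x}"
  have S[measurable]: "?S \<in> sets borel"
  proof -
    have "(\<lambda>g. (g, x)) -` {p. A + \<gamma> *\<^sub>R fst p \<in> short_preimage t (snd p)} \<inter> space borel \<in> sets borel"
      by (rule measurable_sets[OF _ borel_short_preimage])
         (intro borel_measurable_continuous_onI continuous_intros)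
    then show ?thesis by (simp add: vimage_def)
  qed
  have Jv: "?J h *v u = cdot (vcnj u) h *s w" for h u
    by (simp add: vec_eq_iff matrix_vector_mult_def cdot_vcnj sum_distrib_left mult_ac)
  have J'v: "cdot (vcnj u) (?J' v) = cdot w (v *v u)" for u v
    unfolding cdot_vcnj by (simp add: cdot_def matrix_vector_mult_def sum_distrib_left mult_ac) (rule sum.swap)
  have inner: "(\<integral>\<^sup>+h. indicator ?S (v - ?J (?J' v) + ?J h) \<partial>gauss N) \<le> ennreal (N * t\<^sup>2 / \<gamma>\<^sup>2)" for v
  proof -
    let ?m = "A + \<gamma> *\<^sub>R v"
    have app: "(?m - ?J (?J' ?m)) *v y = ?m *v y - cdot w (?m *v y) *s w" for y
      by (simp only: linear_diff[OF linear_mult_matrix] Jv J'v)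
    \<comment> \<open>The range is orthogonal to \<open>w\<close>. The matrix depends on
      \<open>v\<close> only through the part that resampling keeps, so one kernel vector
      \<open>u\<close> serves all \<open>h\<close>.\<close>
    have "\<not> invertible (?m - ?J (?J' ?m))"
    proof
      assume "invertible (?m - ?J (?J' ?m))"
      then obtain B where "(?m - ?J (?J' ?m)) ** B = mat 1" by (auto simp: invertible_def)
      then have "w = (?m - ?J (?J' ?m)) *v (B *v w)" by (simp add: matrix_vector_mul_assoc)
      moreover have "cdot w ((?m - ?J (?J' ?m)) *v (B *v w)) = 0"
        unfolding app by (simp add: cdot_diff_right cdot_smult_right cdot_self w)
      ultimately have "cdot w w = 0" by simp
      then show False using w by (simp add: cdot_self)
    qed
    from ex_kernel_vec[OF this] obtain u where u1: "norm u = 1" "(?m - ?J (?J' ?m)) *v u = 0"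
      by blast
    then have "?m *v u = cdot w (?m *v u) *s w" unfolding app by simp
    note u = u1(1) this
    define c where "c = cdot w (?m *v u) - of_real \<gamma> * cdot w (v *v u)"
    have "indicator ?S (v - ?J (?J' v) + ?J h) \<le> (indicator {h. cmod (c + of_real \<gamma> * cdot (vcnj u) h) \<le> t} h :: ennreal)" for h
    proof -
      let ?g = "v - ?J (?J' v) + ?J h"
      have "(A + \<gamma> *\<^sub>R ?g) *v u = ?m *v u - \<gamma> *\<^sub>R (?J (?J' v) *v u) + \<gamma> *\<^sub>R (?J h *v u)"
        by (rule perturbed_mult_vec)
      also have "\<dots> = cdot w (?m *v u) *s w - \<gamma> *\<^sub>R (cdot w (v *v u) *s w) + \<gamma> *\<^sub>R (cdot (vcnj u) h *s w)"
        by (simp only: Jv J'v u(2)[symmetric])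
      also have "\<dots> = (c + of_real \<gamma> * cdot (vcnj u) h) *s w"
        by (simp add: c_def vec_eq_iff scaleR_conv_of_real[where 'a = complex] algebra_simps)
      finally have eq: "(A + \<gamma> *\<^sub>R ?g) *v u = (c + of_real \<gamma> * cdot (vcnj u) h) *s w" .
      have "w = (of_real (1 / norm x)) *s x"
        by (simp add: w_def vec_eq_iff scaleR_conv_of_real[where 'a = complex])
      then have "(A + \<gamma> *\<^sub>R ?g) *v u = ((c + of_real \<gamma> * cdot (vcnj u) h) * of_real (1 / norm x)) *s x"
        unfolding eq by (simp add: vec_eq_iff algebra_simps add_divide_distrib)
      note eq' = this
      have nrm: "norm ((A + \<gamma> *\<^sub>R ?g) *v u) = cmod (c + of_real \<gamma> * cdot (vcnj u) h)"
        unfolding eq norm_smult_cvec by (simp add: w)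
      have "cmod (c + of_real \<gamma> * cdot (vcnj u) h) \<le> t" if "?g \<in> ?S"
        using short_preimageD[OF that[unfolded mem_Collect_eq] u(1) eq'] unfolding nrm .
      then show ?thesis by (auto simp: indicator_def)
    qed
    then have "(\<integral>\<^sup>+h. indicator ?S (v - ?J (?J' v) + ?J h) \<partial>gauss N)
      \<le> (\<integral>\<^sup>+h. indicator {h. cmod (c + of_real \<gamma> * cdot (vcnj u) h) \<le> t} h \<partial>gauss N)"
      by (rule nn_integral_mono)
    also have "\<dots> = emeasure (gauss N) {h. cmod (c + of_real \<gamma> * cdot (vcnj u) h) \<le> t}"
      by (intro nn_integral_indicator) (simp, intro borel_closed closed_Collect_le continuous_intros)
    also have "\<dots> \<le> ennreal (N * t\<^sup>2 / (\<gamma> * norm (vcnj u))\<^sup>2)"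
      using u by (intro emeasure_gauss_form N t \<gamma>) auto
    finally show ?thesis by (simp add: u)
  qed
  have "emeasure (gauss N) ?S = (\<integral>\<^sup>+v. indicator ?S v \<partial>gauss N)" by simp
  also have "\<dots> = (\<integral>\<^sup>+v. \<integral>\<^sup>+h. indicator ?S (v - ?J (?J' v) + ?J h) \<partial>gauss N \<partial>gauss N)"
    by (rule nn_integral_split[OF N]) simp
  also have "\<dots> \<le> (\<integral>\<^sup>+v. ennreal (N * t\<^sup>2 / \<gamma>\<^sup>2) \<partial>(gauss N :: (complex^'n^'n) measure))"
    by (intro nn_integral_mono inner)
  also have "\<dots> = ennreal (N * t\<^sup>2 / \<gamma>\<^sup>2)" using V.emeasure_space_1 by simp
  finally show ?thesis .
qed

text \<open>The least singular value is at most \<open>s\<close>. Taking the witness on the compact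
  unit sphere makes this a closed condition.\<close>

definition small_singular :: "real \<Rightarrow> (complex^'n^'n) set" where
  "small_singular s = {M. \<exists>u. norm u = 1 \<and> norm (M *v u) \<le> s}"

lemma closed_small_singular: "closed {p. s \<ge> 0 \<and> f p \<in> small_singular s}"
  if f: "continuous_on UNIV f" for f :: "'a::metric_space \<Rightarrow> complex^'n^'n"
proof -
  have "closed {p. \<exists>k\<in>sphere 0 1. (p, k) \<in> {q. norm (f (fst q) *v snd q) \<le> s}}"
    by (intro closed_ex_compact compact_sphere closed_Collect_le continuous_intros
        continuous_on_compose2[OF f]) auto
  then show ?thesis by (simp add: small_singular_def Bex_def conj_commute closed_Collect_conj)
qed

text \<open>If M is invertible, its inverse stretches the direction of M u0 by at least 1/s, and
  \<open>expanding_direction\<close> gives \<open>q\<close> with |L x| >= |<q, x>| / s for the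
  inverse L. On the cap this exceeds |x| / t, so a unit u with M u = \<tau> x has |\<tau>| |x| <= t.
  If M is singular, a left kernel vector serves as \<open>q\<close>: then \<tau> <q, x> = 0 forces
  \<tau> = 0.\<close>

lemma short_preimage_cap:
  fixes M :: "complex^'n^'n"
  assumes M: "M \<in> small_singular s" and s: "0 < s" "0 < t"
  shows "\<exists>q. norm q = 1 \<and> (\<forall>x. (s / t)\<^sup>2 * (norm x)\<^sup>2 < (cmod (cdot q x))\<^sup>2 \<longrightarrow> M \<in> short_preimage t x)"
proof (cases "invertible M")
  case True
  then obtain L where L: "L ** M = mat 1" by (auto simp: invertible_def)
  then have LM: "L *v (M *v u) = u" for u by (simp add: matrix_vector_mul_assoc)
  obtain u0 where u0: "norm u0 = 1" "norm (M *v u0) \<le> s" using M by (auto simp: small_singular_def)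
  have nz: "M *v u0 \<noteq> 0" using LM[of u0] u0(1) linear_0[OF linear_mult_vec, of L] by (metis norm_zero zero_neq_one)
  define p where "p = (1 / norm (M *v u0)) *\<^sub>R (M *v u0)"
  have "norm p = 1" using nz by (simp add: p_def)
  moreover have "1 / s \<le> norm (L *v p)"
    using u0 s nz by (simp add: p_def mult_vec_scaleR LM frac_le)
  ultimately obtain q where q: "norm q = 1" "\<And>x. 1 / s * cmod (cdot q x) \<le> norm (L *v x)"
    using expanding_direction[of p "1 / s" L] s by auto
  have "M \<in> short_preimage t x" if x: "(s / t)\<^sup>2 * (norm x)\<^sup>2 < (cmod (cdot q x))\<^sup>2" for x
    unfolding short_preimage_def
  proof (safe)
    fix u \<tau> assume u: "norm u = 1" "M *v u = \<tau> *s x"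
    have "s / t * norm x < cmod (cdot q x)"
      using x by (simp add: power_mult_distrib[symmetric] power2_less_imp_less)
    then have "s * (s / t * norm x) \<le> s * cmod (cdot q x)" using s by (intro mult_left_mono) auto
    have "u = \<tau> *s (L *v x)" using LM[of u] u(2) by (simp add: vec.scale)
    then have "1 = cmod \<tau> * norm (L *v x)" using u(1) norm_smult_cvec by metis
    moreover have "cmod \<tau> * (norm x / t) \<le> cmod \<tau> * norm (L *v x)"
    proof (intro mult_left_mono)
      have "norm x / t \<le> 1 / s * cmod (cdot q x)"
        using \<open>s / t * norm x < cmod (cdot q x)\<close> s by (simp add: field_simps)
      then show "norm x / t \<le> norm (L *v x)" using q(2)[of x] by linarith
    qed simp
    ultimately show "norm (M *v u) \<le> t" using s by (simp add: u(2) norm_smult_cvec field_simps)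
  qed
  then show ?thesis using q(1) by blast
next
  case False
  from ex_left_kernel_vec[OF this] obtain q where q: "norm q = 1" "\<And>u. cdot q (M *v u) = 0" by blast
  have "M \<in> short_preimage t x" if x: "(s / t)\<^sup>2 * (norm x)\<^sup>2 < (cmod (cdot q x))\<^sup>2" for x
    unfolding short_preimage_def
  proof (safe)
    fix u \<tau> assume u: "norm u = 1" "M *v u = \<tau> *s x"
    have "0 \<le> (s / t)\<^sup>2 * (norm x)\<^sup>2" by simp
    then have "cdot q x \<noteq> 0" using x by (metis le_less_trans less_irrefl norm_zero zero_power2)
    moreover have "\<tau> * cdot q x = 0" using q(2)[of u] by (simp add: u(2) cdot_smult_right)
    ultimately show "norm (M *v u) \<le> t" using s by (simp add: u(2) norm_smult_cvec)
  qed
  then show ?thesis using q(1) by blast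
qed

lemma emeasure_small_singular:
  fixes A :: "complex^'n^'n"
  assumes \<gamma>: "0 < \<gamma>" and s: "0 < s"
  shows "emeasure (gauss (real CARD('n))) {g. A + \<gamma> *\<^sub>R g \<in> small_singular s}
    \<le> ennreal (exp 1 * (real CARD('n) * (real CARD('n) + 1)) * s\<^sup>2 / \<gamma>\<^sup>2)"
proof -
  define N where "N = real CARD('n)"
  have N: "0 < N" by (simp add: N_def)
  \<comment> \<open>This makes the cap parameter (s/t)^2 equal to 1/(n+1), and (1 - 1/(n+1))^n = (1
    + 1/n)^(-n) is at least 1/e. A smaller t would lose the cap, a larger one worsens the bound n
    t^2 / \<gamma>^2.\<close>
  define t where "t = s * sqrt (N + 1)"
  have t: "0 < t" "(s / t)\<^sup>2 = 1 / (N + 1)" using s N by (auto simp: t_def power_divide)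
  let ?S = "{g. A + \<gamma> *\<^sub>R g \<in> small_singular s}"
  have "closed {g. s \<ge> 0 \<and> A + \<gamma> *\<^sub>R g \<in> small_singular s}"
    by (intro closed_small_singular continuous_intros)
  then have [measurable]: "?S \<in> sets borel" using s by simp
  define B where "B = {p :: (complex^'n^'n) \<times> (complex^'n). A + \<gamma> *\<^sub>R fst p \<in> short_preimage t (snd p)}"
  have mB[measurable]: "B \<in> sets (borel \<Otimes>\<^sub>M borel)"
    unfolding B_def borel_prod by (rule borel_short_preimage)
  interpret P: pair_prob_space "gauss N :: (complex^'n^'n) measure" "gauss 1 :: (complex^'n) measure"
    by (simp add: pair_prob_space_def pair_sigma_finite_def prob_space_gauss N
        prob_space_imp_sigma_finite)
  have e: "exp (- 1) \<le> (1 - 1 / (N + 1)) ^ CARD('n)"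
  proof -
    have "(1 + 1 / real CARD('n)) ^ CARD('n) \<le> exp 1"
      by (rule exp_ge_one_plus_x_over_n_power_n) auto
    then have "inverse (exp 1) \<le> inverse ((1 + 1 / N) ^ CARD('n))"
      using N by (intro le_imp_inverse_le) (auto simp: N_def intro!: zero_less_power add_pos_pos)
    also have "\<dots> = (1 - 1 / (N + 1)) ^ CARD('n)"
      using N by (simp add: power_inverse[symmetric] field_simps)
    finally show ?thesis by (simp add: exp_minus)
  qed
  have "ennreal (exp (- 1)) * emeasure (gauss N) ?S = (\<integral>\<^sup>+g. ennreal (exp (- 1)) * indicator ?S g \<partial>gauss N)"
    by (subst nn_integral_cmult_indicator) auto
  also have "\<dots> \<le> (\<integral>\<^sup>+g. \<integral>\<^sup>+x. indicator B (g, x) \<partial>gauss 1 \<partial>gauss N)"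
  proof (rule nn_integral_mono)
    fix g :: "complex^'n^'n"
    show "ennreal (exp (- 1)) * indicator ?S g \<le> (\<integral>\<^sup>+x. indicator B (g, x) \<partial>gauss 1)"
    proof (cases "g \<in> ?S")
      case True
      then obtain q where q: "norm q = 1"
        "\<And>x. (s / t)\<^sup>2 * (norm x)\<^sup>2 < (cmod (cdot q x))\<^sup>2 \<Longrightarrow> A + \<gamma> *\<^sub>R g \<in> short_preimage t x"
        using short_preimage_cap[OF _ s t(1)] by blast
      let ?C = "{x. 1 / (N + 1) * (norm x)\<^sup>2 < (cmod (cdot q x))\<^sup>2}"
      have mC: "?C \<in> sets borel"
        by (intro borel_open open_Collect_less continuous_intros)
      have "ennreal (exp (- 1)) \<le> ennreal ((1 - 1 / (N + 1)) ^ CARD('n))" using e by (rule ennreal_leI)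
      also have "\<dots> \<le> emeasure (gauss 1) ?C" using N by (intro emeasure_gauss_cap q) auto
      also have "\<dots> = (\<integral>\<^sup>+x. indicator ?C x \<partial>gauss 1)"
        using mC by (intro nn_integral_indicator[symmetric]) (simp only: sets_gauss)
      also have "\<dots> \<le> (\<integral>\<^sup>+x. indicator B (g, x) \<partial>gauss 1)"
        using q(2) unfolding t(2) by (intro nn_integral_mono) (auto simp: indicator_def B_def)
      finally show ?thesis using True by simp
    qed simp
  qed
  also have "\<dots> = (\<integral>\<^sup>+x. \<integral>\<^sup>+g. indicator B (g, x) \<partial>gauss N \<partial>gauss 1)"
    by (intro P.Fubini'[symmetric]) simp
  also have "\<dots> \<le> (\<integral>\<^sup>+x. ennreal (N * t\<^sup>2 / \<gamma>\<^sup>2) \<partial>(gauss 1 :: (complex^'n) measure))"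
  proof (rule nn_integral_mono_AE)
    \<comment> \<open>The zero vector has no direction to resample; it is a null set.\<close>
    have "AE x in (gauss 1 :: (complex^'n) measure). x \<noteq> 0"
      unfolding gauss_def by (subst AE_density) (auto intro: AE_mp[OF AE_lborel_singleton])
    then show "AE x in (gauss 1 :: (complex^'n) measure). (\<integral>\<^sup>+g. indicator B (g, x) \<partial>gauss N) \<le> ennreal (N * t\<^sup>2 / \<gamma>\<^sup>2)"
    proof (rule AE_mp, intro AE_I2 impI)
      fix x :: "complex^'n" assume "x \<noteq> 0"
      have "(\<integral>\<^sup>+g. indicator B (g, x) \<partial>gauss N) = (\<integral>\<^sup>+g. indicator ((\<lambda>g. (g, x)) -` B) g \<partial>gauss N)"
        by (intro nn_integral_cong) (auto simp: indicator_def)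
      also have "\<dots> = emeasure (gauss N) ((\<lambda>g. (g, x)) -` B)"
        using measurable_sets[of "\<lambda>g. (g, x)" "gauss N" "borel \<Otimes>\<^sub>M borel" B] mB
        by (intro nn_integral_indicator) auto
      also have "(\<lambda>g. (g, x)) -` B = {g. A + \<gamma> *\<^sub>R g \<in> short_preimage t x}" by (auto simp: B_def)
      also have "emeasure (gauss N) \<dots> \<le> ennreal (N * t\<^sup>2 / \<gamma>\<^sup>2)"
        using t by (intro emeasure_short_preimage N \<gamma> \<open>x \<noteq> 0\<close>) auto
      finally show "(\<integral>\<^sup>+g. indicator B (g, x) \<partial>gauss N) \<le> ennreal (N * t\<^sup>2 / \<gamma>\<^sup>2)" .
    qed
  qed
  also have "\<dots> = ennreal (N * t\<^sup>2 / \<gamma>\<^sup>2)" using P.M2.emeasure_space_1 by simp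
  finally have *: "ennreal (exp (- 1)) * emeasure (gauss N) ?S \<le> ennreal (N * t\<^sup>2 / \<gamma>\<^sup>2)" .
  have "emeasure (gauss N) ?S = ennreal (exp 1) * (ennreal (exp (- 1)) * emeasure (gauss N) ?S)"
    by (simp add: mult.assoc[symmetric] exp_minus flip: ennreal_mult')
  also have "\<dots> \<le> ennreal (exp 1) * ennreal (N * t\<^sup>2 / \<gamma>\<^sup>2)" by (intro mult_left_mono *) auto
  also have "\<dots> = ennreal (exp 1 * (N * (N + 1)) * s\<^sup>2 / \<gamma>\<^sup>2)"
    using N by (simp add: t_def power_mult_distrib mult_ac flip: ennreal_mult')
  finally show ?thesis by (simp add: N_def)
qed

section \<open>Almost dependent columns\<close>

lemma cdot_diff_left: "cdot (x - y) z = cdot x z - cdot y z"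
  by (simp add: cdot_def algebra_simps sum_subtractf)

text \<open>The matrix whose rows are the conjugates of the f k, with row i set to zero, is
  singular; a kernel vector is orthogonal to the other n - 1 vectors.\<close>

lemma ex_unit_orthogonal:
  fixes f :: "'n \<Rightarrow> complex^'n"
  shows "\<exists>y. norm y = 1 \<and> (\<forall>k. k \<noteq> i \<longrightarrow> cdot y (f k) = 0)"
proof -
  let ?A = "(\<chi> r c. if r = i then 0 else cnj (f r $ c)) :: complex^'n^'n"
  have "\<not> invertible ?A"
  proof
    assume "invertible ?A"
    then obtain B where "?A ** B = mat 1" by (auto simp: invertible_def)
    then have "(?A ** B) $ i $ i = 1" by (simp add: mat_def)
    then show False by (simp add: matrix_matrix_mult_def)
  qed
  then obtain u where u: "norm u = 1" "?A *v u = 0" using ex_kernel_vec by blast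
  have "cdot u (f k) = 0" if "k \<noteq> i" for k
  proof -
    have "(?A *v u) $ k = cdot (f k) u" using that by (simp add: matrix_vector_mult_def cdot_def)
    then have "cdot (f k) u = 0" using u by simp
    then show ?thesis by (metis cnj_cdot complex_cnj_zero)
  qed
  then show ?thesis using u by blast
qed

text \<open>Resampling the component along \<open>y1\<close> leaves the form of \<open>y2\<close>
  unchanged because of orthogonality, so the two events are independent and each is a small-ball
  event.\<close>

lemma emeasure_gauss_two_forms:
  fixes c y1 y2 :: "complex^'n"
  assumes N: "0 < N" and \<gamma>: "0 < \<gamma>" and r: "0 \<le> r"
    and y: "norm y1 = 1" "norm y2 = 1" "cdot y1 y2 = 0"
  shows "emeasure (gauss N) {e. cmod (cdot y1 (c + \<gamma> *\<^sub>R e)) \<le> r \<and> cmod (cdot y2 (c + \<gamma> *\<^sub>R e)) \<le> r}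
    \<le> ennreal ((N * r\<^sup>2 / \<gamma>\<^sup>2)\<^sup>2)"
proof -
  interpret gauss_split "\<lambda>z. z *s y1" "\<lambda>v. cdot y1 v" by (rule gauss_split_direction[OF y(1)])
  let ?S = "{e. cmod (cdot y1 (c + \<gamma> *\<^sub>R e)) \<le> r \<and> cmod (cdot y2 (c + \<gamma> *\<^sub>R e)) \<le> r}"
  let ?A = "{z. cmod (cdot y1 c + of_real \<gamma> * z) \<le> r}"
  let ?B = "{v. cmod (cdot y2 c + of_real \<gamma> * cdot y2 v) \<le> r}"
  have S: "?S \<in> sets borel"
    by (intro borel_closed closed_Collect_conj closed_Collect_le continuous_intros)
  have A: "?A \<in> sets borel" by (intro borel_closed closed_Collect_le continuous_intros)
  have B: "?B \<in> sets borel" by (intro borel_closed closed_Collect_le continuous_intros)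
  have y21: "cdot y2 y1 = 0" using y(3) by (metis cnj_cdot complex_cnj_zero)
  have "emeasure (gauss N) ?S = (\<integral>\<^sup>+v. indicator ?S v \<partial>gauss N)"
    using S by (intro nn_integral_indicator[symmetric]) (simp only: sets_gauss)
  also have "\<dots> = (\<integral>\<^sup>+v. \<integral>\<^sup>+z. indicator ?S (v - cdot y1 v *s y1 + z *s y1) \<partial>gauss N \<partial>gauss N)"
    using S by (intro nn_integral_split[OF N] borel_measurable_indicator)
  also have "\<dots> = (\<integral>\<^sup>+v. \<integral>\<^sup>+z. indicator ?B v * indicator ?A z \<partial>gauss N \<partial>gauss N)"
  proof (intro nn_integral_cong)
    fix v z
    let ?e = "v - cdot y1 v *s y1 + z *s y1"
    have "cdot y1 (c + \<gamma> *\<^sub>R ?e) = cdot y1 c + of_real \<gamma> * z"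
      using y by (simp add: cdot_add_right cdot_scaleR_right cdot_diff_right cdot_smult_right cdot_self)
    moreover have "cdot y2 (c + \<gamma> *\<^sub>R ?e) = cdot y2 c + of_real \<gamma> * cdot y2 v"
      by (simp add: cdot_add_right cdot_scaleR_right cdot_diff_right cdot_smult_right y21)
    ultimately show "indicator ?S ?e = (indicator ?B v * indicator ?A z :: ennreal)"
      by (auto simp: indicator_def)
  qed
  also have "\<dots> = (\<integral>\<^sup>+v. emeasure (gauss N) ?A * indicator ?B v \<partial>gauss N)"
  proof (rule nn_integral_cong)
    fix v
    show "(\<integral>\<^sup>+z. indicator ?B v * indicator ?A z \<partial>gauss N) = emeasure (gauss N) ?A * indicator ?B v"
      using A by (subst nn_integral_cmult_indicator) (simp_all only: sets_gauss mult.commute)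
  qed
  also have "\<dots> = emeasure (gauss N) ?A * emeasure (gauss N) ?B"
    using B by (intro nn_integral_cmult_indicator) (simp only: sets_gauss)
  also have "\<dots> \<le> ennreal (N * r\<^sup>2 / \<gamma>\<^sup>2) * ennreal (N * r\<^sup>2 / (\<gamma> * norm y2)\<^sup>2)"
    using y by (intro mult_mono emeasure_gauss_disc emeasure_gauss_form N \<gamma> r) auto
  also have "\<dots> = ennreal ((N * r\<^sup>2 / \<gamma>\<^sup>2)\<^sup>2)"
    using y N by (simp add: power2_eq_square[of "N * r\<^sup>2 / \<gamma>\<^sup>2"] flip: ennreal_mult')
  finally show ?thesis .
qed

lemma ex_dyadic:
  fixes b :: real
  assumes "0 < b" "b \<le> 1"
  shows "\<exists>K. (1 / 2) ^ K \<le> b \<and> b \<le> 2 * (1 / 2) ^ K"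
proof -
  have ex: "\<exists>K. (1 / 2) ^ K < b" using assms by (intro real_arch_pow_inv) auto
  define K where "K = (LEAST K. (1 / 2) ^ K \<le> b)"
  have 1: "(1 / 2) ^ K \<le> b" unfolding K_def using ex by (metis (mono_tags) LeastI less_imp_le)
  have 2: "b \<le> 2 * (1 / 2) ^ K"
  proof (cases K)
    case 0
    then show ?thesis using assms by simp
  next
    case (Suc k)
    then have "\<not> (1 / 2) ^ k \<le> b" unfolding K_def by (intro not_less_Least) simp
    then show ?thesis using Suc by simp
  qed
  show ?thesis using 1 2 by blast
qed

text \<open>A dyadic decomposition of \<open>min 1 (a / W)\<close> replaces the expectation of \<open>1 / W\<close>,
  which is finite because two orthogonal forms are jointly small only with fourth-order probability.\<close>
lemma nn_integral_inverse_two_forms: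
  fixes c y1 y2 :: "complex^'n"
  assumes N: "0 < N" and \<gamma>: "0 < \<gamma>" and a: "0 < a"
    and y: "norm y1 = 1" "norm y2 = 1" "cdot y1 y2 = 0"
    and h: "\<And>e. h e \<le> 1"
      "\<And>e k. (cmod (cdot y1 (c + \<gamma> *\<^sub>R e)))\<^sup>2 + (cmod (cdot y2 (c + \<gamma> *\<^sub>R e)))\<^sup>2 > a * 2 ^ k \<Longrightarrow> h e \<le> (1 / 2) ^ k"
  shows "(\<integral>\<^sup>+e. ennreal (h e) \<partial>gauss N) \<le> ennreal (6 * N * a / \<gamma>\<^sup>2)"
proof -
  interpret prob_space "gauss N :: (complex^'n) measure" by (rule prob_space_gauss[OF N])
  \<comment> \<open>Scaled so that level k of the decomposition has probability at most b^2 4^k. The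
    claimed bound is 3 b, which is trivial once b exceeds 1.\<close>
  define b where "b = 2 * N * a / \<gamma>\<^sup>2"
  have b: "0 < b" using N a \<gamma> by (simp add: b_def)
  show ?thesis
  proof (cases "b \<le> 1")
    case False
    have "(\<integral>\<^sup>+e. ennreal (h e) \<partial>gauss N) \<le> (\<integral>\<^sup>+e. 1 \<partial>(gauss N :: (complex^'n) measure))"
      using h(1) by (intro nn_integral_mono) simp
    also have "\<dots> = ennreal 1" using emeasure_space_1 by simp
    also have "\<dots> \<le> ennreal (6 * N * a / \<gamma>\<^sup>2)" using False by (intro ennreal_leI) (simp add: b_def)
    finally show ?thesis .
  next
    case True
    from ex_dyadic[OF b True] obtain K where K: "(1 / 2) ^ K \<le> b" "b \<le> 2 * (1 / 2) ^ K" by blast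
    let ?W = "\<lambda>e. (cmod (cdot y1 (c + \<gamma> *\<^sub>R e)))\<^sup>2 + (cmod (cdot y2 (c + \<gamma> *\<^sub>R e)))\<^sup>2"
    let ?D = "\<lambda>k::nat. {e. ?W e \<le> a * 2 ^ (k + 1)}"
    have D: "?D k \<in> sets borel" for k
      by (intro borel_closed closed_Collect_le continuous_intros)
    have De: "emeasure (gauss N) (?D k) \<le> ennreal (b\<^sup>2 * 4 ^ k)" for k
    proof -
      let ?r = "sqrt (a * 2 ^ (k + 1))"
      have r: "0 \<le> ?r" "?r\<^sup>2 = a * 2 ^ (k + 1)" using a by auto
      have "emeasure (gauss N) (?D k) \<le> emeasure (gauss N) {e. cmod (cdot y1 (c + \<gamma> *\<^sub>R e)) \<le> ?r \<and> cmod (cdot y2 (c + \<gamma> *\<^sub>R e)) \<le> ?r}"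
      proof (rule emeasure_mono)
        show "?D k \<subseteq> {e. cmod (cdot y1 (c + \<gamma> *\<^sub>R e)) \<le> ?r \<and> cmod (cdot y2 (c + \<gamma> *\<^sub>R e)) \<le> ?r}"
        proof safe
          fix e assume *: "?W e \<le> a * 2 ^ (k + 1)"
          have "(cmod (cdot y1 (c + \<gamma> *\<^sub>R e)))\<^sup>2 \<le> ?W e" "(cmod (cdot y2 (c + \<gamma> *\<^sub>R e)))\<^sup>2 \<le> ?W e" by auto
          from this[THEN order_trans, OF *]
          show "cmod (cdot y1 (c + \<gamma> *\<^sub>R e)) \<le> ?r" "cmod (cdot y2 (c + \<gamma> *\<^sub>R e)) \<le> ?r"
            by (auto intro!: real_le_rsqrt)
        qed
        show "{e. cmod (cdot y1 (c + \<gamma> *\<^sub>R e)) \<le> ?r \<and> cmod (cdot y2 (c + \<gamma> *\<^sub>R e)) \<le> ?r} \<in> sets (gauss N)"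
          unfolding sets_gauss by (intro borel_closed closed_Collect_conj closed_Collect_le continuous_intros)
      qed
      also have "\<dots> \<le> ennreal ((N * ?r\<^sup>2 / \<gamma>\<^sup>2)\<^sup>2)" by (intro emeasure_gauss_two_forms N \<gamma> r y)
      also have "(N * ?r\<^sup>2 / \<gamma>\<^sup>2)\<^sup>2 = b\<^sup>2 * 4 ^ k"
      proof -
        have "N * ?r\<^sup>2 / \<gamma>\<^sup>2 = b * 2 ^ k" unfolding r by (simp add: b_def)
        then show ?thesis by (simp add: power_mult_distrib power2_eq_square flip: power_mult_distrib)
      qed
      finally show ?thesis .
    qed
    have point: "h e \<le> (\<Sum>k<K. (1 / 2) ^ k * indicator (?D k) e) + (1 / 2) ^ K" for e
    proof -
      \<comment> \<open>Induction on the truncation level: inside \<open>?D L\<close> the new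
        summand (1/2)^L pays for the whole old remainder, outside it the assumption on
        \<open>h\<close> gives (1/2)^(L+1) directly.\<close>
      have "h e \<le> (\<Sum>k<L. (1 / 2) ^ k * indicator (?D k) e) + (1 / 2) ^ L" for L
      proof (induction L)
        case (Suc L)
        show ?case
        proof (cases "e \<in> ?D L")
          case True
          then have ind: "indicator (?D L) e = (1::real)" by (simp only: indicator_simps)
          have "0 \<le> (1 / 2 :: real) ^ Suc L" by simp
          then show ?thesis using Suc unfolding sum.lessThan_Suc ind by linarith
        next
          case False
          then have "?W e > a * 2 ^ Suc L" by simp
          from h(2)[OF this] have "h e \<le> (1 / 2) ^ Suc L" .
          moreover have "0 \<le> (\<Sum>k<Suc L. (1 / 2) ^ k * indicator (?D k) e :: real)" by (intro sum_nonneg) auto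
          ultimately show ?thesis by linarith
        qed
      qed (simp add: h)
      then show ?thesis .
    qed
    have "(\<integral>\<^sup>+e. ennreal (h e) \<partial>gauss N)
      \<le> (\<integral>\<^sup>+e. (\<Sum>k<K. ennreal ((1 / 2) ^ k) * indicator (?D k) e) + ennreal ((1 / 2) ^ K) \<partial>gauss N)"
    proof (rule nn_integral_mono)
      fix e
      have "ennreal (h e) \<le> ennreal ((\<Sum>k<K. (1 / 2) ^ k * indicator (?D k) e) + (1 / 2) ^ K)"
        by (rule ennreal_leI[OF point])
      also have "\<dots> = ennreal (\<Sum>k<K. (1 / 2) ^ k * indicator (?D k) e) + ennreal ((1 / 2) ^ K)"
        by (intro ennreal_plus sum_nonneg) auto
      also have "ennreal (\<Sum>k<K. (1 / 2) ^ k * indicator (?D k) e) = (\<Sum>k<K. ennreal ((1 / 2) ^ k * indicator (?D k) e))"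
        by (intro sum_ennreal[symmetric]) auto
      also have "\<dots> = (\<Sum>k<K. ennreal ((1 / 2) ^ k) * indicator (?D k) e)"
        by (intro sum.cong) (auto simp: indicator_def)
      finally show "ennreal (h e) \<le> (\<Sum>k<K. ennreal ((1 / 2) ^ k) * indicator (?D k) e) + ennreal ((1 / 2) ^ K)" .
    qed
    also have "\<dots> = (\<Sum>k<K. ennreal ((1 / 2) ^ k) * emeasure (gauss N) (?D k)) + ennreal ((1 / 2) ^ K)"
    proof -
      have m: "(\<lambda>e. ennreal ((1 / 2) ^ k) * indicator (?D k) e) \<in> borel_measurable (gauss N)" for k
        using D[of k] by (intro borel_measurable_times_ennreal borel_measurable_const borel_measurable_indicator) (simp only: sets_gauss)
      have "(\<integral>\<^sup>+e. (\<Sum>k<K. ennreal ((1 / 2) ^ k) * indicator (?D k) e) + ennreal ((1 / 2) ^ K) \<partial>gauss N)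
        = (\<integral>\<^sup>+e. (\<Sum>k<K. ennreal ((1 / 2) ^ k) * indicator (?D k) e) \<partial>gauss N) + (\<integral>\<^sup>+e. ennreal ((1 / 2) ^ K) \<partial>(gauss N :: (complex^'n) measure))"
        by (intro nn_integral_add borel_measurable_sum m) auto
      also have "(\<integral>\<^sup>+e. (\<Sum>k<K. ennreal ((1 / 2) ^ k) * indicator (?D k) e) \<partial>gauss N)
        = (\<Sum>k<K. (\<integral>\<^sup>+e. ennreal ((1 / 2) ^ k) * indicator (?D k) e \<partial>gauss N))"
        by (intro nn_integral_sum m)
      also have "\<dots> = (\<Sum>k<K. ennreal ((1 / 2) ^ k) * emeasure (gauss N) (?D k))"
        using D by (intro sum.cong nn_integral_cmult_indicator refl) (simp only: sets_gauss)
      also have "(\<integral>\<^sup>+e. ennreal ((1 / 2) ^ K) \<partial>(gauss N :: (complex^'n) measure)) = ennreal ((1 / 2) ^ K)"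
        using emeasure_space_1 by simp
      finally show ?thesis .
    qed
    also have "\<dots> \<le> (\<Sum>k<K. ennreal ((1 / 2) ^ k) * ennreal (b\<^sup>2 * 4 ^ k)) + ennreal ((1 / 2) ^ K)"
      by (intro add_mono sum_mono mult_left_mono De order_refl) simp
    also have "\<dots> = ennreal ((\<Sum>k<K. b\<^sup>2 * 2 ^ k) + (1 / 2) ^ K)"
    proof -
      have *: "(1 / 2) ^ k * (b\<^sup>2 * 4 ^ k) = b\<^sup>2 * 2 ^ k" for k
      proof -
        have "(1 / 2 :: real) ^ k * 4 ^ k = 2 ^ k" by (simp flip: power_mult_distrib)
        then show ?thesis by (metis mult.assoc mult.left_commute)
      qed
      have "(\<Sum>k<K. ennreal ((1 / 2) ^ k) * ennreal (b\<^sup>2 * 4 ^ k)) = (\<Sum>k<K. ennreal (b\<^sup>2 * 2 ^ k))"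
        by (intro sum.cong refl, subst ennreal_mult'[symmetric]) (simp_all only: * zero_le_power zero_le_divide_1_iff zero_le_numeral)
      also have "\<dots> = ennreal (\<Sum>k<K. b\<^sup>2 * 2 ^ k)" by (intro sum_ennreal) auto
      finally show ?thesis by (simp add: sum_nonneg)
    qed
    also have "\<dots> \<le> ennreal (6 * N * a / \<gamma>\<^sup>2)"
    proof (rule ennreal_leI)
      \<comment> \<open>By the choice of \<open>K\<close>, b 2^K is at most 2: the levels contribute
        at most 2 b and the remainder at most b.\<close>
      have "(\<Sum>k<K. (2::real) ^ k) \<le> 2 ^ K" by (induction K) auto
      then have "(\<Sum>k<K. b\<^sup>2 * 2 ^ k) \<le> b * (b * 2 ^ K)"
        using b by (simp add: sum_distrib_left[symmetric] power2_eq_square mult.assoc)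
      also have "\<dots> \<le> b * 2"
        using K(2) b by (intro mult_left_mono) (auto simp: power_divide field_simps)
      finally show "(\<Sum>k<K. b\<^sup>2 * 2 ^ k) + (1 / 2) ^ K \<le> 6 * N * a / \<gamma>\<^sup>2"
        using K(1) by (simp add: b_def)
    qed
    finally show ?thesis .
  qed
qed

text \<open>The condition bounds the area spanned by the projections of the columns \<open>i\<close> and \<open>j\<close> to
  the orthogonal complement of the remaining columns.\<close>
definition near_dependent :: "real \<Rightarrow> 'n \<Rightarrow> 'n \<Rightarrow> (complex^'n^'n) set" where
  "near_dependent t i j = {M. \<forall>y1 y2. norm y1 = 1 \<and> norm y2 = 1 \<and> cdot y1 y2 = 0 \<and>
     (\<forall>k. k \<noteq> i \<and> k \<noteq> j \<longrightarrow> cdot y1 (column k M) = 0 \<and> cdot y2 (column k M) = 0) \<longrightarrow>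
     cmod (cdot y1 (column i M) * cdot y2 (column j M) - cdot y2 (column i M) * cdot y1 (column j M)) \<le> t}"

lemma near_dependentD:
  assumes "M \<in> near_dependent t i j" "norm y1 = 1" "norm y2 = 1" "cdot y1 y2 = 0"
    "\<And>k. k \<noteq> i \<Longrightarrow> k \<noteq> j \<Longrightarrow> cdot y1 (column k M) = 0"
    "\<And>k. k \<noteq> i \<Longrightarrow> k \<noteq> j \<Longrightarrow> cdot y2 (column k M) = 0"
  shows "cmod (cdot y1 (column i M) * cdot y2 (column j M) - cdot y2 (column i M) * cdot y1 (column j M)) \<le> t"
  using assms unfolding near_dependent_def by blast

lemma continuous_on_column [continuous_intros]:
  fixes f :: "'a::topological_space \<Rightarrow> complex^'n^'n"
  assumes "continuous_on S f"
  shows "continuous_on S (\<lambda>x. column k (f x))"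
  unfolding column_def using assms by (intro continuous_intros continuous_on_vec_lambda)

lemma closed_Collect_all_imp:
  assumes "\<And>k. closed {x. Q k x}"
  shows "closed {x. \<forall>k. P k \<longrightarrow> Q k x}"
proof -
  have "{x. \<forall>k. P k \<longrightarrow> Q k x} = (\<Inter>k\<in>{k. P k}. {x. Q k x})" by auto
  then show ?thesis using assms by auto
qed

text \<open>The complement is a countable union, over the margins 1/(m+1), of projections along a
  product of two unit spheres.\<close>

lemma borel_near_dependent:
  fixes C :: "complex^'n^'n"
  shows "{g. C + \<gamma> *\<^sub>R g \<in> near_dependent t i j} \<in> sets borel"
proof -
  let ?M = "\<lambda>q :: (complex^'n^'n) \<times> (complex^'n) \<times> (complex^'n). C + \<gamma> *\<^sub>R fst q"
  let ?y1 = "\<lambda>q :: (complex^'n^'n) \<times> (complex^'n) \<times> (complex^'n). fst (snd q)"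
  let ?y2 = "\<lambda>q :: (complex^'n^'n) \<times> (complex^'n) \<times> (complex^'n). snd (snd q)"
  let ?D = "\<lambda>q. cmod (cdot (?y1 q) (column i (?M q)) * cdot (?y2 q) (column j (?M q))
    - cdot (?y2 q) (column i (?M q)) * cdot (?y1 q) (column j (?M q)))"
  let ?C = "\<lambda>m::nat. {q. cdot (?y1 q) (?y2 q) = 0 \<and>
     (\<forall>k. k \<noteq> i \<and> k \<noteq> j \<longrightarrow> cdot (?y1 q) (column k (?M q)) = 0 \<and> cdot (?y2 q) (column k (?M q)) = 0) \<and>
     t + 1 / Suc m \<le> ?D q}"
  let ?K = "sphere (0::complex^'n) 1 \<times> sphere (0::complex^'n) 1"
  have "closed (?C m)" for m
    by (intro closed_Collect_conj closed_Collect_eq closed_Collect_le closed_Collect_all_imp continuous_intros)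
  moreover have "compact ?K" by (intro compact_Times compact_sphere)
  ultimately have cl: "closed {g. \<exists>k\<in>?K. (g, k) \<in> ?C m}" for m by (rule closed_ex_compact)
  have "- {g. C + \<gamma> *\<^sub>R g \<in> near_dependent t i j} = (\<Union>m. {g. \<exists>k\<in>?K. (g, k) \<in> ?C m})" (is "- ?S = ?T")
  proof (intro set_eqI iffI)
    fix g assume "g \<in> - ?S"
    then obtain y1 y2 where y: "norm y1 = 1" "norm y2 = 1" "cdot y1 y2 = 0"
      "\<forall>k. k \<noteq> i \<and> k \<noteq> j \<longrightarrow> cdot y1 (column k (C + \<gamma> *\<^sub>R g)) = 0 \<and> cdot y2 (column k (C + \<gamma> *\<^sub>R g)) = 0"
      "t < ?D (g, y1, y2)" unfolding near_dependent_def by (simp add: not_le) blast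
    from y(5) obtain m :: nat where m: "1 / Suc m < ?D (g, y1, y2) - t"
      using nat_approx_posE[of "?D (g, y1, y2) - t"] by (metis diff_gt_0_iff_gt)
    have "(y1, y2) \<in> ?K" using y by simp
    moreover have "t + 1 / Suc m \<le> ?D (g, y1, y2)" using m by linarith
    then have "(g, (y1, y2)) \<in> ?C m"
      using y(3,4) unfolding mem_Collect_eq fst_conv snd_conv by blast
    ultimately show "g \<in> ?T" by blast
  next
    fix g assume "g \<in> ?T"
    then obtain m k where k: "k \<in> ?K" "(g, k) \<in> ?C m" by blast
    obtain y1 y2 where ky: "k = (y1, y2)" by (cases k)
    have "0 < 1 / real (Suc m)" by simp
    then have "t < ?D (g, y1, y2)" using k(2) unfolding ky mem_Collect_eq fst_conv snd_conv by linarith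
    moreover have "?D (g, y1, y2) \<le> t" if "g \<in> ?S"
    proof -
      have "norm y1 = 1" "norm y2 = 1" using k(1) by (auto simp: ky)
      then show ?thesis
        using that k(2) unfolding ky near_dependent_def mem_Collect_eq fst_conv snd_conv by blast
    qed
    ultimately show "g \<in> - ?S" by fastforce
  qed
  then have "- ?S \<in> sets borel" using cl by auto
  then show ?thesis using borel_comp[of "- ?S"] by simp
qed

definition set_column :: "'n \<Rightarrow> complex^'n \<Rightarrow> complex^'n^'n \<Rightarrow> complex^'n^'n" where
  "set_column i x M = (\<chi> a b. if b = i then x $ a else M $ a $ b)"

lemma column_set_column: "column k (set_column i x M) = (if k = i then x else column k M)"
  by (simp add: set_column_def column_def vec_eq_iff)

lemma set_column_split:
  "g - (\<chi> a b. if b = i then column i g $ a else 0) + (\<chi> a b. if b = i then e $ a else 0) = set_column i e g"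
  by (simp add: set_column_def column_def vec_eq_iff)

lemma column_affine: "column k (C + \<gamma> *\<^sub>R g) = column k C + \<gamma> *\<^sub>R column k (g :: complex^'n^'n)"
  by (simp add: column_def vec_eq_iff)

text \<open>The columns other than i and j stay frozen and determine y1, y2. Once column i is drawn,
  the two-by-two determinant is an affine form in column j whose coefficient vector has squared
  length W, so the conditional probability is at most the smaller of 1 and N t^2 / (\<gamma>^2 W).
  Averaging over column i is \<open>nn_integral_inverse_two_forms\<close>.\<close>

lemma emeasure_near_dependent:
  fixes C :: "complex^'n^'n"
  assumes N: "0 < N" and \<gamma>: "0 < \<gamma>" and t: "0 < t" and ij: "i \<noteq> j"
  shows "emeasure (gauss N) {g. C + \<gamma> *\<^sub>R g \<in> near_dependent t i j} \<le> ennreal (6 * N\<^sup>2 * t\<^sup>2 / \<gamma> ^ 4)"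
proof -
  let ?S = "{g. C + \<gamma> *\<^sub>R g \<in> near_dependent t i j}"
  have S: "?S \<in> sets borel" by (rule borel_near_dependent)
  interpret I: gauss_split "\<lambda>e. (\<chi> a b. if b = i then e $ a else 0) :: complex^'n^'n" "column i"
    by (rule gauss_split_column)
  interpret J: gauss_split "\<lambda>e. (\<chi> a b. if b = j then e $ a else 0) :: complex^'n^'n" "column j"
    by (rule gauss_split_column)
  interpret V: prob_space "gauss N :: (complex^'n^'n) measure" by (rule prob_space_gauss[OF N])
  interpret E: prob_space "gauss N :: (complex^'n) measure" by (rule prob_space_gauss[OF N])
  have cont: "continuous_on UNIV (\<lambda>p. set_column j (snd p) (fst p) :: complex^'n^'n)"
    unfolding set_column_def
    by (intro continuous_on_vec_lambda, rename_tac a b, case_tac "b = j")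
       (simp_all, intro continuous_intros, intro continuous_intros)
  have [measurable]: "(\<lambda>p. set_column j (snd p) (fst p) :: complex^'n^'n) \<in> borel_measurable (borel \<Otimes>\<^sub>M borel)"
    unfolding borel_prod by (rule borel_measurable_continuous_onI[OF cont])
  define ind where "ind = (indicator ?S :: complex^'n^'n \<Rightarrow> ennreal)"
  have ind[measurable]: "ind \<in> borel_measurable borel"
    unfolding ind_def using S by (rule borel_measurable_indicator)
  have "emeasure (gauss N) ?S = (\<integral>\<^sup>+g. ind g \<partial>gauss N)"
    unfolding ind_def using S by (intro nn_integral_indicator[symmetric]) (simp only: sets_gauss)
  also have "\<dots> = (\<integral>\<^sup>+g. \<integral>\<^sup>+f. ind (set_column j f g) \<partial>gauss N \<partial>gauss N)"
    unfolding set_column_split[symmetric] by (rule J.nn_integral_split[OF N ind])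
  also have "\<dots> = (\<integral>\<^sup>+g. \<integral>\<^sup>+e. \<integral>\<^sup>+f. ind (set_column j f (set_column i e g)) \<partial>gauss N \<partial>gauss N \<partial>gauss N)"
    unfolding set_column_split[of _ i, symmetric]
    by (rule I.nn_integral_split[OF N])
       (intro E.borel_measurable_nn_integral[of "\<lambda>g f. ind (set_column j f g)" borel, unfolded split_def] , measurable)
  also have "\<dots> \<le> (\<integral>\<^sup>+g. ennreal (6 * N * (N * t\<^sup>2 / \<gamma>\<^sup>2) / \<gamma>\<^sup>2) \<partial>(gauss N :: (complex^'n^'n) measure))"
  proof (rule nn_integral_mono)
    fix g :: "complex^'n^'n"
    let ?c = "\<lambda>k. column k (C + \<gamma> *\<^sub>R g)"
    \<comment> \<open>Only n - 2 columns constrain \<open>y1\<close>, so slot \<open>j\<close> is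
      filled with 0. For \<open>y2\<close> the same slot takes \<open>y1\<close> itself, which makes
      the pair orthonormal.\<close>
    from ex_unit_orthogonal[of i "\<lambda>k. if k = j then 0 else ?c k"] obtain y1 where y1': "norm y1 = 1"
      "\<forall>k. k \<noteq> i \<longrightarrow> cdot y1 (if k = j then 0 else ?c k) = 0" by blast
    have y1: "norm y1 = 1" "\<And>k. k \<noteq> i \<Longrightarrow> k \<noteq> j \<Longrightarrow> cdot y1 (?c k) = 0"
      using y1'(1) y1'(2)[rule_format] by (simp, metis)
    from ex_unit_orthogonal[of i "\<lambda>k. if k = j then y1 else ?c k"] obtain y2 where y2: "norm y2 = 1"
      "\<And>k. k \<noteq> i \<Longrightarrow> cdot y2 (if k = j then y1 else ?c k) = 0" by blast
    have y21: "cdot y2 y1 = 0" using y2(2)[of j] ij by simp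
    then have y12: "cdot y1 y2 = 0" by (metis cnj_cdot complex_cnj_zero)
    let ?X1 = "\<lambda>e. cdot y1 (column i C + \<gamma> *\<^sub>R e)" and ?X2 = "\<lambda>e. cdot y2 (column i C + \<gamma> *\<^sub>R e)"
    let ?W = "\<lambda>e. (cmod (?X1 e))\<^sup>2 + (cmod (?X2 e))\<^sup>2"
    let ?a = "N * t\<^sup>2 / \<gamma>\<^sup>2"
    have a: "0 < ?a" using N t \<gamma> by simp
    \<comment> \<open>Division by zero would give the value 0 at \<open>?W e = 0\<close>, where only
      the trivial bound 1 is available.\<close>
    define h where "h e = (if ?W e = 0 then 1 else min 1 (?a / ?W e))" for e
    have h1: "h e \<le> 1" for e by (simp add: h_def)
    have h2: "h e \<le> (1 / 2) ^ k" if "?W e > ?a * 2 ^ k" for e k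
    proof -
      have W: "?W e > 0" using that a by (smt (verit) zero_less_mult_iff zero_less_power)
      then have "?W e \<noteq> 0" by linarith
      then have "h e = min 1 (?a / ?W e)" unfolding h_def by (rule if_not_P)
      then have "h e \<le> ?a / ?W e" by simp
      also have "\<dots> \<le> (1 / 2) ^ k"
      proof -
        have "x / w \<le> (1 / 2) ^ k" if "x * 2 ^ k < w" "0 < w" for x w :: real
          using that by (simp add: power_divide divide_simps mult.commute)
        from this[OF that W] show ?thesis .
      qed
      finally show ?thesis .
    qed
    have "(\<integral>\<^sup>+f. ind (set_column j f (set_column i e g)) \<partial>gauss N) \<le> ennreal (h e)" for e
    proof -
      \<comment> \<open>The coefficient vector of the determinant as a form in column j;
        orthonormality of y1 and y2 gives (norm q)^2 = W.\<close>
      define q where "q = cnj (?X1 e) *s y2 - cnj (?X2 e) *s y1"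
      define d where "d = ?X1 e * cdot y2 (column j C) - ?X2 e * cdot y1 (column j C)"
      have cq: "cdot q f = ?X1 e * cdot y2 f - ?X2 e * cdot y1 f" for f
        by (simp add: q_def cdot_diff_left cdot_smult_left)
      have "complex_of_real ((norm q)\<^sup>2) = cdot q q" by (simp add: cdot_self)
      also have "\<dots> = ?X1 e * cnj (?X1 e) + ?X2 e * cnj (?X2 e)"
        unfolding cq by (simp add: q_def cdot_diff_right cdot_smult_right y12 y21 cdot_self y1 y2)
      also have "\<dots> = complex_of_real (?W e)" by (simp only: complex_norm_square of_real_add)
      finally have nq: "(norm q)\<^sup>2 = ?W e" by (simp only: of_real_eq_iff)
      let ?F = "{f. cmod (d + of_real \<gamma> * cdot q f) \<le> t}"
      have F: "?F \<in> sets borel" by (intro borel_closed closed_Collect_le continuous_intros)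
      have "(\<integral>\<^sup>+f. ind (set_column j f (set_column i e g)) \<partial>gauss N) \<le> (\<integral>\<^sup>+f. indicator ?F f \<partial>gauss N)"
      proof (rule nn_integral_mono)
        fix f
        let ?M = "C + \<gamma> *\<^sub>R set_column j f (set_column i e g)"
        have ci: "column i ?M = column i C + \<gamma> *\<^sub>R e" and cj: "column j ?M = column j C + \<gamma> *\<^sub>R f"
          using ij by (simp_all add: column_affine column_set_column)
        have ck: "column k ?M = ?c k" if "k \<noteq> i \<and> k \<noteq> j" for k
          using that by (simp add: column_affine column_set_column)
        have "cmod (d + of_real \<gamma> * cdot q f) \<le> t" if M: "?M \<in> near_dependent t i j"
        proof -
          have "cmod (cdot y1 (column i ?M) * cdot y2 (column j ?M) - cdot y2 (column i ?M) * cdot y1 (column j ?M)) \<le> t"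
          proof (rule near_dependentD[OF M y1(1) y2(1) y12])
            fix k assume k: "k \<noteq> i" "k \<noteq> j"
            then show "cdot y1 (column k ?M) = 0" using ck y1(2) by simp
            show "cdot y2 (column k ?M) = 0" using k ck y2(2)[of k] by simp
          qed
          moreover have "cdot y1 (column i ?M) * cdot y2 (column j ?M) - cdot y2 (column i ?M) * cdot y1 (column j ?M)
            = d + of_real \<gamma> * cdot q f"
            unfolding ci cj cq d_def by (simp add: cdot_add_right cdot_scaleR_right algebra_simps)
          ultimately show ?thesis by simp
        qed
        then show "ind (set_column j f (set_column i e g)) \<le> indicator ?F f"
          by (auto simp: ind_def indicator_def)
      qed
      also have "\<dots> = emeasure (gauss N) ?F"
        using F by (intro nn_integral_indicator) (simp only: sets_gauss)
      also have "\<dots> \<le> ennreal (h e)"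
      proof (cases "?W e = 0")
        case True
        then show ?thesis using E.emeasure_le_1[of ?F] by (simp add: h_def)
      next
        case False
        then have "q \<noteq> 0" using nq by auto
        have "emeasure (gauss N) ?F \<le> ennreal (N * t\<^sup>2 / (\<gamma> * norm q)\<^sup>2)"
          using t by (intro emeasure_gauss_form N \<gamma> \<open>q \<noteq> 0\<close>) auto
        also have "N * t\<^sup>2 / (\<gamma> * norm q)\<^sup>2 = ?a / ?W e" by (simp add: power_mult_distrib nq)
        finally have "emeasure (gauss N) ?F \<le> ennreal (min 1 (?a / ?W e))"
          using E.emeasure_le_1[of ?F] by (simp add: min_def)
        moreover have "h e = min 1 (?a / ?W e)" unfolding h_def using False by (rule if_not_P)
        ultimately show ?thesis by (simp only:)
      qed
      finally show ?thesis .
    qed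
    then have "(\<integral>\<^sup>+e. \<integral>\<^sup>+f. ind (set_column j f (set_column i e g)) \<partial>gauss N \<partial>gauss N) \<le> (\<integral>\<^sup>+e. ennreal (h e) \<partial>gauss N)"
      by (intro nn_integral_mono)
    also have "\<dots> \<le> ennreal (6 * N * ?a / \<gamma>\<^sup>2)"
      by (rule nn_integral_inverse_two_forms[OF N \<gamma> a y1(1) y2(1) y12 h1 h2])
    finally show "(\<integral>\<^sup>+e. \<integral>\<^sup>+f. ind (set_column j f (set_column i e g)) \<partial>gauss N \<partial>gauss N) \<le> ennreal (6 * N * ?a / \<gamma>\<^sup>2)" .
  qed
  also have "\<dots> = ennreal (6 * N\<^sup>2 * t\<^sup>2 / \<gamma> ^ 4)"
    using V.emeasure_space_1 by (simp add: power2_eq_square power4_eq_xxxx mult_ac)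
  finally show ?thesis .
qed

section \<open>Two nearby roots of the characteristic polynomial of a pencil\<close>

definition pencil_at :: "complex^'n^'n \<Rightarrow> complex^'n^'n \<Rightarrow> complex \<Rightarrow> complex^'n^'n" where
  "pencil_at A B z = (\<chi> i j. A $ i $ j - z * B $ i $ j)"

lemma poly_det: "poly (det M) z = det (\<chi> i j. poly (M $ i $ j) z)"
  for M :: "complex poly^'n^'n"
  by (simp add: det_def poly_sum poly_prod)

lemma poly_pencil_poly: "poly (pencil_poly A B) z = det (pencil_at A B z)"
  by (simp add: pencil_poly_def pencil_at_def poly_det)

lemma pencil_at_mult: "pencil_at A B z *v u = A *v u - z *s (B *v u)"
  by (simp add: pencil_at_def matrix_vector_mult_def vec_eq_iff sum_subtractf sum_distrib_left algebra_simps)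

lemma continuous_on_pencil_at [continuous_intros]:
  assumes "continuous_on S A" "continuous_on S B" "continuous_on S z"
  shows "continuous_on S (\<lambda>x. pencil_at (A x) (B x) (z x))"
  unfolding pencil_at_def using assms by (intro continuous_on_vec_lambda continuous_intros)

lemma continuous_on_det_complex [continuous_intros]:
  fixes f :: "'a::topological_space \<Rightarrow> complex^'n^'n"
  assumes "continuous_on S f"
  shows "continuous_on S (\<lambda>x. det (f x))"
  unfolding det_def using assms by (intro continuous_intros)

lemma continuous_on_set_column [continuous_intros]:
  fixes M :: "'a::topological_space \<Rightarrow> complex^'n^'n"
  assumes "continuous_on S x" "continuous_on S M"
  shows "continuous_on S (\<lambda>p. set_column i (x p) (M p))"
  unfolding set_column_def using assms
  by (intro continuous_on_vec_lambda, rename_tac a b, case_tac "b = i")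
     (auto intro!: continuous_intros)

lemma det_set_column_mult: "det (set_column i (M *v v) M) = v $ i * det M"
  using cramer_lemma[where A = M and x = v and k = i]
  by (simp add: set_column_def)

lemma det_set_column_smult: "det (set_column i (c *s x) M) = c * det (set_column i x M)"
proof -
  have *: "transpose (set_column i y M) = (\<chi> r. if r = i then y else row r (transpose M))" for y
    by (simp add: vec_eq_iff set_column_def transpose_def row_def)
  show ?thesis
    unfolding det_transpose[of "set_column i (c *s x) M", symmetric] det_transpose[of "set_column i x M", symmetric] *
    by (rule det_row_mul)
qed

lemma set_column_mult: "set_column i x M *v w = w $ i *s x + M *v (\<chi> k. if k = i then 0 else w $ k)"
proof -
  have *: "(\<Sum>k\<in>UNIV - {i}. w $ k *s column k (set_column i x M)) = (\<Sum>k\<in>UNIV - {i}. w $ k *s column k M)"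
    by (intro sum.cong) (auto simp: column_set_column)
  show ?thesis
    unfolding matrix_mult_sum
    by (subst (1 2) sum.remove[of _ i]) (simp_all add: * column_set_column if_distrib[of "\<lambda>c. c *s _"] cong: if_cong)
qed

text \<open>Division by an entry of largest modulus. The entry 1 lets a column be replaced by the
  image of the vector without changing the determinant (Cramer), and the bound on the other entries
  keeps the vector in a compact set.\<close>

lemma ex_max_normalized:
  fixes u :: "complex^'n"
  assumes "u \<noteq> 0"
  shows "\<exists>i c. u $ i \<noteq> 0 \<and> c = inverse (u $ i) \<and> (c *s u) $ i = 1 \<and> (\<forall>k. cmod ((c *s u) $ k) \<le> 1)"
proof -
  have "Max (range (\<lambda>k. cmod (u $ k))) \<in> range (\<lambda>k. cmod (u $ k))" by (intro Max_in) auto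
  then obtain i where i: "cmod (u $ i) = Max (range (\<lambda>k. cmod (u $ k)))" by (metis imageE)
  have max: "cmod (u $ k) \<le> cmod (u $ i)" for k unfolding i by (intro Max_ge) auto
  have nz: "u $ i \<noteq> 0"
  proof
    assume "u $ i = 0"
    then have "u $ k = 0" for k using max[of k] by simp
    then show False using assms by (simp add: vec_eq_iff)
  qed
  then have "\<forall>k. cmod ((inverse (u $ i) *s u) $ k) \<le> 1"
    using max by (simp add: norm_divide divide_le_eq_1 field_simps)
  then show ?thesis using nz by (intro exI[of _ i] exI[of _ "inverse (u $ i)"]) simp
qed

lemma smult_mult_vec: "(M :: complex^'n^'n) *v (c *s x) = c *s (M *v x)"
  by (rule vec.scale)

text \<open>The right-hand side says that \<open>v\<close> is an eigenvector for \<open>l1\<close> and that, up to the component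
  along \<open>v\<close>, there is a (generalized) eigenvector for \<open>l2\<close>; this treats \<open>l1 = l2\<close> uniformly.\<close>
lemma two_roots_iff:
  fixes A B :: "complex^'n^'n"
  shows "[:- l1, 1:] * [:- l2, 1:] dvd pencil_poly A B \<longleftrightarrow>
    (\<exists>i v. v $ i = 1 \<and> (\<forall>k. cmod (v $ k) \<le> 1) \<and> pencil_at A B l1 *v v = 0 \<and>
      det (set_column i (B *v v) (pencil_at A B l2)) = 0)"
proof -
  \<comment> \<open>Since (A - z B) v = (l1 - z) B v and v $ i = 1, putting B v into column i
    divides the determinant by l1 - z, as a polynomial in z. The roots of the quotient are the
    remaining eigenvalues, a second copy of l1 included.\<close>
  have fac: "\<exists>Q. pencil_poly A B = [:- l1, 1:] * Q \<and> (poly Q l2 = 0 \<longleftrightarrow> det (set_column i (B *v v) (pencil_at A B l2)) = 0)"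
    if v: "v $ i = 1" "pencil_at A B l1 *v v = 0" for i v
  proof -
    define R where "R = det ((\<chi> a b. if b = i then [:(B *v v) $ a:] else [:A $ a $ b, - B $ a $ b:]) :: complex poly^'n^'n)"
    have R: "poly R z = det (set_column i (B *v v) (pencil_at A B z))" for z
    proof -
      have "(\<chi> a b. poly (((\<chi> a b. if b = i then [:(B *v v) $ a:] else [:A $ a $ b, - B $ a $ b:]) :: complex poly^'n^'n) $ a $ b) z)
        = set_column i (B *v v) (pencil_at A B z)"
        by (simp add: vec_eq_iff set_column_def pencil_at_def)
      then show ?thesis unfolding R_def poly_det by simp
    qed
    have "poly (pencil_poly A B) z = poly ([:- l1, 1:] * (- R)) z" for z
    proof -
      have "A *v v = l1 *s (B *v v)" using v(2) by (simp add: pencil_at_mult)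
      then have "pencil_at A B z *v v = (l1 - z) *s (B *v v)"
        by (simp add: pencil_at_mult vec_eq_iff algebra_simps)
      then have "det (pencil_at A B z) = (l1 - z) * det (set_column i (B *v v) (pencil_at A B z))"
        using det_set_column_mult[of i "pencil_at A B z" v] v(1) by (simp only: det_set_column_smult mult_1)
      then show ?thesis by (simp add: poly_pencil_poly R algebra_simps)
    qed
    then have "pencil_poly A B = [:- l1, 1:] * (- R)" using poly_eq_poly_eq_iff by blast
    then show ?thesis by (intro exI[of _ "- R"]) (simp add: R)
  qed
  show ?thesis
  proof
    assume dvd: "[:- l1, 1:] * [:- l2, 1:] dvd pencil_poly A B"
    then have "[:- l1, 1:] dvd pencil_poly A B" by (rule dvd_mult_left)
    then have "det (pencil_at A B l1) = 0" by (simp add: poly_eq_0_iff_dvd[symmetric] poly_pencil_poly)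
    then obtain u where u: "norm u = 1" "pencil_at A B l1 *v u = 0"
      using ex_kernel_vec[of "pencil_at A B l1"] by (auto simp: invertible_det_nz)
    from ex_max_normalized[of u] u(1) obtain i c where c: "(c *s u) $ i = 1" "\<forall>k. cmod ((c *s u) $ k) \<le> 1"
      by (metis norm_zero zero_neq_one)
    have ker: "pencil_at A B l1 *v (c *s u) = 0" by (simp add: smult_mult_vec u)
    from fac[OF c(1) ker] obtain Q where Q: "pencil_poly A B = [:- l1, 1:] * Q"
      "poly Q l2 = 0 \<longleftrightarrow> det (set_column i (B *v (c *s u)) (pencil_at A B l2)) = 0" by blast
    have "[:- l2, 1:] dvd Q" using dvd unfolding Q(1) by (subst (asm) dvd_mult_cancel_left) simp
    then have "poly Q l2 = 0" by (simp add: poly_eq_0_iff_dvd)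
    then show "\<exists>i v. v $ i = 1 \<and> (\<forall>k. cmod (v $ k) \<le> 1) \<and> pencil_at A B l1 *v v = 0 \<and>
      det (set_column i (B *v v) (pencil_at A B l2)) = 0" using c ker Q(2) by blast
  next
    assume "\<exists>i v. v $ i = 1 \<and> (\<forall>k. cmod (v $ k) \<le> 1) \<and> pencil_at A B l1 *v v = 0 \<and>
      det (set_column i (B *v v) (pencil_at A B l2)) = 0"
    then obtain i v where v: "v $ i = 1" "pencil_at A B l1 *v v = 0"
      "det (set_column i (B *v v) (pencil_at A B l2)) = 0" by blast
    from fac[OF v(1,2)] v(3) obtain Q where Q: "pencil_poly A B = [:- l1, 1:] * Q" "poly Q l2 = 0" by blast
    have "[:- l2, 1:] dvd Q" using Q(2) by (simp add: poly_eq_0_iff_dvd)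
    then show "[:- l1, 1:] * [:- l2, 1:] dvd pencil_poly A B" unfolding Q(1) by (rule mult_dvd_mono[OF dvd_refl])
  qed
qed

lemma norm_le_sqrt_card:
  fixes v :: "complex^'n"
  assumes "\<forall>k. cmod (v $ k) \<le> 1"
  shows "norm v \<le> sqrt (real CARD('n))"
proof -
  have "(\<Sum>k\<in>UNIV. (cmod (v $ k))\<^sup>2) \<le> (\<Sum>k\<in>(UNIV :: 'n set). 1)"
    using assms by (intro sum_mono) (simp add: power_le_one)
  then show ?thesis by (simp add: norm_vec_def L2_set_def)
qed

text \<open>At z, the eigenvector v is mapped to (l1 - z) B v, and v2 to \<kappa> B v + (l2 - z) B
  v2. As v has entry 1 at i and v2 has entries 0 at i and 1 at j, column operations turn the
  determinant of the projected columns into that of the projected images. The possibly huge \<kappa>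
  cancels, which leaves (l1 - z)(l2 - z) times a determinant bounded by 2 K^2 n.\<close>

lemma near_dependent_of_two_roots:
  fixes A B :: "complex^'n^'n"
  assumes dvd: "[:- l1, 1:] * [:- l2, 1:] dvd pencil_poly A B"
    and r: "cmod (l1 - z) \<le> r" "cmod (l2 - z) \<le> r"
    and K: "\<And>u. norm (B *v u) \<le> K * norm u" and inj: "\<And>u. B *v u = 0 \<Longrightarrow> u = 0"
  shows "\<exists>i j. i \<noteq> j \<and> pencil_at A B z \<in> near_dependent (2 * r\<^sup>2 * K\<^sup>2 * real CARD('n)) i j"
proof -
  from dvd obtain i v where v: "v $ i = 1" "\<forall>k. cmod (v $ k) \<le> 1" "pencil_at A B l1 *v v = 0"
    "det (set_column i (B *v v) (pencil_at A B l2)) = 0" unfolding two_roots_iff by blast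
  from v(4) obtain w where w: "norm w = 1" "set_column i (B *v v) (pencil_at A B l2) *v w = 0"
    using ex_kernel_vec by (metis invertible_det_nz)
  define w' where "w' = (\<chi> k. if k = i then 0 else w $ k)"
  have eq: "w $ i *s (B *v v) + pencil_at A B l2 *v w' = 0" using w(2) by (simp add: set_column_mult w'_def)
  \<comment> \<open>Otherwise w is concentrated at i and w $ i annihilates B v, which injectivity of
    B excludes.\<close>
  have "w' \<noteq> 0"
  proof
    assume w'0: "w' = 0"
    then have 0: "w $ k = 0" if "k \<noteq> i" for k using that by (auto simp: w'_def vec_eq_iff split: if_splits)
    have "w $ i *s (B *v v) = 0" using eq by (simp add: w'0)
    then have "w $ i = 0 \<or> v = 0" using inj by (auto simp: vec_eq_iff[of "_ *s _"]) (metis inj vec_eq_iff zero_index)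
    moreover have "v \<noteq> 0" using v(1) by auto
    ultimately have "w $ k = 0" for k using 0[of k] by (cases "k = i") auto
    then have "w = 0" by (simp add: vec_eq_iff)
    then show False using w(1) by simp
  qed
  then obtain j c where c: "w' $ j \<noteq> 0" "(c *s w') $ j = 1" "\<forall>k. cmod ((c *s w') $ k) \<le> 1"
    using ex_max_normalized by blast
  define v2 where "v2 = c *s w'"
  have ji: "i \<noteq> j" using c(1) by (auto simp: w'_def)
  have v2: "v2 $ i = 0" "v2 $ j = 1" "\<forall>k. cmod (v2 $ k) \<le> 1" using c by (auto simp: v2_def w'_def)
  define \<kappa> where "\<kappa> = - (c * w $ i)"
  have p2: "pencil_at A B l2 *v v2 = \<kappa> *s (B *v v)"
  proof -
    have "pencil_at A B l2 *v w' = - (w $ i *s (B *v v))" using eq by (simp add: add_eq_0_iff)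
    then show ?thesis by (simp add: v2_def smult_mult_vec \<kappa>_def vec_eq_iff)
  qed
  let ?M = "pencil_at A B z"
  have M1: "?M *v v = (l1 - z) *s (B *v v)"
    using v(3) by (simp add: pencil_at_mult vec_eq_iff algebra_simps)
  have M2: "?M *v v2 = \<kappa> *s (B *v v) + (l2 - z) *s (B *v v2)"
    using p2 by (simp add: pencil_at_mult vec_eq_iff algebra_simps)
  have "?M \<in> near_dependent (2 * r\<^sup>2 * K\<^sup>2 * real CARD('n)) i j"
    unfolding near_dependent_def
  proof safe
    fix y1 y2 assume y: "norm y1 = 1" "norm y2 = 1" "cdot y1 y2 = 0"
      and "\<forall>k. k \<noteq> i \<and> k \<noteq> j \<longrightarrow> cdot y1 (column k ?M) = 0 \<and> cdot y2 (column k ?M) = 0"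
    then have o: "\<And>k. k \<noteq> i \<Longrightarrow> k \<noteq> j \<Longrightarrow> cdot y1 (column k ?M) = 0"
      "\<And>k. k \<noteq> i \<Longrightarrow> k \<noteq> j \<Longrightarrow> cdot y2 (column k ?M) = 0" by auto
    have exp: "cdot y (?M *v u) = u $ i * cdot y (column i ?M) + u $ j * cdot y (column j ?M)"
      if "\<And>k. k \<noteq> i \<Longrightarrow> k \<noteq> j \<Longrightarrow> cdot y (column k ?M) = 0" for y u
    proof -
      have "cdot y (?M *v u) = (\<Sum>k\<in>UNIV. u $ k * cdot y (column k ?M))"
        by (simp add: matrix_mult_sum cdot_sum_right cdot_smult_right)
      also have "\<dots> = (\<Sum>k\<in>{i, j}. u $ k * cdot y (column k ?M))"
        using that by (intro sum.mono_neutral_right) auto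
      finally show ?thesis using ji by simp
    qed
    define a1 a2 b1 b2 x1 x2 z1 z2 where
      "a1 = cdot y1 (column i ?M)" and "a2 = cdot y2 (column i ?M)" and
      "b1 = cdot y1 (column j ?M)" and "b2 = cdot y2 (column j ?M)" and
      "x1 = cdot y1 (B *v v)" and "x2 = cdot y2 (B *v v)" and
      "z1 = cdot y1 (B *v v2)" and "z2 = cdot y2 (B *v v2)"
    note defs = this
    have e1: "a1 + v $ j * b1 = (l1 - z) * x1" "a2 + v $ j * b2 = (l1 - z) * x2"
      using exp[OF o(1), of v] exp[OF o(2), of v] unfolding M1 defs by (simp_all add: cdot_smult_right cdot_diff_right left_diff_distrib v)
    have e2: "b1 = \<kappa> * x1 + (l2 - z) * z1" "b2 = \<kappa> * x2 + (l2 - z) * z2"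
      using exp[OF o(1), of v2] exp[OF o(2), of v2] unfolding M2 defs
      by (simp_all add: cdot_smult_right cdot_add_right cdot_diff_right left_diff_distrib v2)
    have "a1 * b2 - a2 * b1 = (a1 + v $ j * b1) * b2 - (a2 + v $ j * b2) * b1" by (simp add: algebra_simps)
    also have "\<dots> = (l1 - z) * (l2 - z) * (x1 * z2 - x2 * z1)"
      unfolding e1 unfolding e2 by (simp add: algebra_simps)
    finally have D: "cmod (a1 * b2 - a2 * b1) = cmod (l1 - z) * cmod (l2 - z) * cmod (x1 * z2 - x2 * z1)"
      by (simp add: norm_mult)
    let ?n = "real CARD('n)"
    have K0: "0 \<le> K"
    proof -
      have "0 \<le> K * norm w" using K[of w] norm_ge_zero order_trans by blast
      then show ?thesis by (simp add: w(1))
    qed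
    have x: "cmod x \<le> K * sqrt ?n" if "x = cdot y (B *v u)" "norm y = 1" "\<forall>k. cmod (u $ k) \<le> 1" for x y u
    proof -
      have "cmod x \<le> norm (B *v u)" using cmod_cdot_le[of y "B *v u"] that by simp
      also have "\<dots> \<le> K * norm u" by (rule K)
      also have "\<dots> \<le> K * sqrt ?n" using K0 norm_le_sqrt_card[OF that(3)] by (rule mult_left_mono[rotated])
      finally show ?thesis .
    qed
    have "cmod (x1 * z2 - x2 * z1) \<le> cmod x1 * cmod z2 + cmod x2 * cmod z1"
      using norm_triangle_ineq4[of "x1 * z2" "x2 * z1"] by (simp add: norm_mult)
    also have "\<dots> \<le> (K * sqrt ?n) * (K * sqrt ?n) + (K * sqrt ?n) * (K * sqrt ?n)"
      using K0 by (intro add_mono mult_mono x[OF x1_def y(1) v(2)] x[OF x2_def y(2) v(2)]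
          x[OF z1_def y(1) v2(3)] x[OF z2_def y(2) v2(3)]) auto
    also have "\<dots> = 2 * K\<^sup>2 * ?n" by (simp add: power2_eq_square)
    finally have xz: "cmod (x1 * z2 - x2 * z1) \<le> 2 * K\<^sup>2 * ?n" .
    have "cmod (l1 - z) * cmod (l2 - z) \<le> r * r"
      using r by (intro mult_mono) (auto intro: order_trans[OF norm_ge_zero])
    from mult_mono[OF this xz] have "cmod (a1 * b2 - a2 * b1) \<le> (r * r) * (2 * K\<^sup>2 * ?n)"
      unfolding D by simp
    then show "cmod (cdot y1 (column i ?M) * cdot y2 (column j ?M) - cdot y2 (column i ?M) * cdot y1 (column j ?M))
      \<le> 2 * r\<^sup>2 * K\<^sup>2 * ?n" unfolding defs by (simp add: power2_eq_square mult_ac)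
  qed
  then show ?thesis using ji by blast
qed

section \<open>Residues of the resolvent\<close>

lemma small_singularI:
  fixes M :: "complex^'n^'n"
  assumes "norm (M *v u) \<le> s * norm u" "u \<noteq> 0"
  shows "M \<in> small_singular s"
  unfolding small_singular_def
  using assms by (auto intro!: exI[of _ "(1 / norm u) *\<^sub>R u"] simp: mult_vec_scaleR field_simps)

lemma pencil_at_perturb: "pencil_at (A + \<gamma> *\<^sub>R g) B z = pencil_at A B z + \<gamma> *\<^sub>R g"
  by (simp add: pencil_at_def vec_eq_iff)

lemma pencil_at_shift: "pencil_at A B l *v v = 0 \<Longrightarrow> pencil_at A B z *v v = (l - z) *s (B *v v)"
  by (simp add: pencil_at_mult vec_eq_iff algebra_simps)

text \<open>Applying the pencil at l k to a relation removes v k and turns every other v i into (l i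
  - l k) B v i; injectivity of B then strips off B, and induction applies to a shorter
  relation.\<close>

lemma eigenvectors_independent:
  fixes v :: "'n \<Rightarrow> complex^'n"
  assumes inj: "\<And>u. B *v u = 0 \<Longrightarrow> u = 0" and l: "inj l"
    and v: "\<And>i. v i \<noteq> 0" "\<And>i. pencil_at A B (l i) *v v i = 0"
    and "finite S" "(\<Sum>i\<in>S. c i *s v i) = 0"
  shows "\<forall>i\<in>S. c i = 0"
  using assms(5,6)
proof (induction S arbitrary: c)
  case (insert k S)
  have "B *v (\<Sum>i\<in>S. (c i * (l i - l k)) *s v i) = (\<Sum>i\<in>insert k S. c i *s (pencil_at A B (l k) *v v i))"
    by (simp only: vec.sum vec.scale pencil_at_shift[OF v(2)] sum.insert[OF insert.hyps(1,2)] vector_smult_assoc)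
       simp
  also have "\<dots> = pencil_at A B (l k) *v (\<Sum>i\<in>insert k S. c i *s v i)"
    unfolding vec.sum vec.scale ..
  also have "\<dots> = 0" by (simp only: insert.prems matrix_vector_mult_0_right)
  finally have "(\<Sum>i\<in>S. (c i * (l i - l k)) *s v i) = 0" by (rule inj)
  from insert.IH[OF this] have z: "c i = 0" if "i \<in> S" for i
    using that l insert.hyps by (auto simp: inj_eq)
  then have "(\<Sum>i\<in>S. c i *s v i) = 0" by (intro sum.neutral) simp
  then have "c k *s v k = 0" using insert.prems insert.hyps by simp
  then have "c k = 0" using v(1)[of k] by (auto simp: vec_eq_iff)
  then show ?case using z by auto
qed simp

text \<open>Writing \<open>S\<close> for the matrix of eigenvectors and \<open>T\<close> for the inverse of \<open>B S\<close>, the resolvent is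
  \<open>S diag (1 / (l i - z)) T\<close>. A large residue at \<open>l i\<close> makes the pencil nearly singular on a disc
  around \<open>l i\<close> whose radius is proportional to \<open>s\<close>.\<close>
lemma resolvent_bound:
  fixes A B :: "complex^'n^'n" and l :: "'n \<Rightarrow> complex"
  assumes inj: "\<And>u. B *v u = 0 \<Longrightarrow> u = 0" and l: "inj l"
    and v: "\<And>i. v i \<noteq> 0" "\<And>i. pencil_at A B (l i) *v v i = 0"
    and \<rho>: "0 < \<rho>"
    and discs: "\<And>i s0. 0 < s0 \<Longrightarrow> \<exists>s. 0 < s \<and> s < s0 \<and> \<not> cball (l i) (\<rho> * s) \<subseteq> {z. pencil_at A B z \<in> small_singular s}"
    and D: "\<And>i. D \<le> cmod (l i - z)" "0 \<le> D"
  shows "D * norm u \<le> real CARD('n) * \<rho> * norm (pencil_at A B z *v u)"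
proof -
  define S :: "complex^'n^'n" where "S = (\<chi> a i. v i $ a)"
  have colS: "column i S = v i" for i by (simp add: S_def column_def vec_eq_iff)
  have Sv: "S *v c = (\<Sum>i\<in>UNIV. c $ i *s v i)" for c by (simp add: matrix_mult_sum colS)
  have kerS: "c = 0" if "S *v c = 0" for c
    using eigenvectors_independent[OF inj l v, of UNIV "\<lambda>i. c $ i"] that by (simp add: Sv vec_eq_iff)
  obtain Si where "Si ** S = mat 1" using matrix_left_invertible_ker[of S] kerS by blast
  then have "S ** Si = mat 1" by (simp add: matrix_left_right_inverse)
  then have SSi: "S *v (Si *v u) = u" for u by (simp add: matrix_vector_mul_assoc)
  have "\<forall>c. (B ** S) *v c = 0 \<longrightarrow> c = 0"
    unfolding matrix_vector_mul_assoc[symmetric] using inj kerS by blast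
  then obtain T where TBS: "T ** (B ** S) = mat 1" using matrix_left_invertible_ker[of "B ** S"] by auto
  then have BST: "(B ** S) ** T = mat 1" by (simp add: matrix_left_right_inverse)
  have T1: "T *v (B *v (S *v c)) = c" for c
    using TBS by (simp add: matrix_vector_mul_assoc matrix_mul_assoc)
  have T2: "B *v (S *v (T *v x)) = x" for x
    using BST by (simp add: matrix_vector_mul_assoc matrix_mul_assoc)
  have Ti: "(T *v x) $ i = cdot (vcnj (T $ i)) x" for x i
    by (simp add: cdot_vcnj matrix_vector_mult_def)
  have MS: "pencil_at A B z *v (S *v c) = B *v (S *v (\<chi> i. (l i - z) * c $ i))" for z c
    by (simp only: Sv vec.sum vec.scale pencil_at_shift[OF v(2)] vec_lambda_beta vector_smult_assoc mult.commute)
  \<comment> \<open>The residue at \<open>l i\<close> is, up to sign, the rank-one product of the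
    column \<open>v i\<close> and row i of \<open>T\<close>; the left-hand side is its norm.\<close>
  have res: "norm (v i) * norm (T $ i) \<le> \<rho>" for i
  proof (rule ccontr)
    assume "\<not> norm (v i) * norm (T $ i) \<le> \<rho>"
    then have gt: "\<rho> < norm (v i) * norm (T $ i)" by simp
    define x where "x = vcnj (T $ i)"
    define \<tau> where "\<tau> = norm (T $ i)"
    have \<tau>: "0 < \<tau>" using gt \<rho> unfolding \<tau>_def by (cases "T $ i = 0") auto
    have nx: "norm x = \<tau>" by (simp add: x_def \<tau>_def)
    define e where "e = T *v x"
    have ei: "e $ i = of_real (\<tau>\<^sup>2)" unfolding e_def Ti x_def[symmetric] by (simp add: cdot_self nx)
    \<comment> \<open>Half the distance to the nearest other eigenvalue, capped at 1/2. The inserted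
      1 keeps the set nonempty in dimension one.\<close>
    define \<delta> where "\<delta> = Min (insert 1 ((\<lambda>j. cmod (l j - l i)) ` (UNIV - {i}))) / 2"
    have \<delta>: "0 < \<delta>" unfolding \<delta>_def using l by (auto simp: inj_eq)
    have \<delta>j: "2 * \<delta> \<le> cmod (l j - l i)" if "j \<noteq> i" for j
      unfolding \<delta>_def using that by (auto intro!: Min_le)
    define C where "C = (\<Sum>j\<in>UNIV - {i}. cmod (e $ j) * norm (v j)) / \<delta>"
    have C: "0 \<le> C" using \<delta> by (auto simp: C_def intro!: sum_nonneg divide_nonneg_pos)
    \<comment> \<open>The first term keeps the disc of radius \<rho> s at distance \<delta> from the
      other eigenvalues. The second makes their joint contribution at most the excess of \<tau>^2 |v
      i| over \<tau> \<rho>; the added 1 guards against a zero denominator.\<close>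
    define s0 where "s0 = min (\<delta> / \<rho>) (\<tau> * (norm (v i) * \<tau> - \<rho>) / (\<rho> * C + 1))"
    have \<rho>C: "0 < \<rho> * C + 1" using \<rho> C by (simp add: add_nonneg_pos)
    have s0: "0 < s0" using \<delta> \<rho> \<tau> gt \<rho>C by (simp add: s0_def \<tau>_def)
    from discs[OF s0] obtain s where s: "0 < s" "s < s0"
      "\<not> cball (l i) (\<rho> * s) \<subseteq> {z. pencil_at A B z \<in> small_singular s}" by blast
    have "pencil_at A B y \<in> small_singular s" if y: "y \<in> cball (l i) (\<rho> * s)" for y
    proof -
      have dy: "cmod (l i - y) \<le> \<rho> * s" using y by (simp add: dist_norm)
      have "\<rho> * s \<le> \<delta>" using s(2) \<rho> by (simp add: s0_def field_simps)
      then have ne: "\<delta> \<le> cmod (l j - y)" if "j \<noteq> i" for j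
        using \<delta>j[OF that] dy norm_triangle_ineq4[of "l j - y" "l i - y"] by simp
      then have nz: "l j - y \<noteq> 0" if "j \<noteq> i" for j using that \<delta> by (metis norm_zero not_less)
      \<comment> \<open>The coefficients of the resolvent at y applied to x, multiplied by l i - y.
        This cancels the pole, so y = l i needs no separate treatment.\<close>
      define c where "c = (\<chi> j. if j = i then e $ i else (l i - y) * e $ j / (l j - y))"
      have "(\<chi> j. (l j - y) * c $ j) = (l i - y) *s e"
      proof -
        have gen: "d * (a / d) = a" if "d \<noteq> 0" for a d :: complex using that by simp
        have "(l j - y) * c $ j = (l i - y) * e $ j" for j
          using gen[OF nz[of j]] by (cases "j = i") (auto simp only: c_def vec_lambda_beta if_True if_False simp_thms)
        then show ?thesis by (simp only: vec_eq_iff vec_lambda_beta vector_smult_component simp_thms)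
      qed
      then have M: "pencil_at A B y *v (S *v c) = (l i - y) *s x"
        unfolding MS by (simp only: e_def T2 vec.scale)
      have "S *v c = e $ i *s v i + (\<Sum>j\<in>UNIV - {i}. ((l i - y) * e $ j / (l j - y)) *s v j)"
        unfolding Sv by (subst sum.remove[of _ i]) (auto simp: c_def intro!: sum.cong)
      then have "norm (S *v c) \<ge> norm (e $ i *s v i) - norm (\<Sum>j\<in>UNIV - {i}. ((l i - y) * e $ j / (l j - y)) *s v j)"
        by (simp only: norm_diff_ineq)
      moreover have "norm (\<Sum>j\<in>UNIV - {i}. ((l i - y) * e $ j / (l j - y)) *s v j) \<le> \<rho> * s * C"
      proof -
        have "norm (\<Sum>j\<in>UNIV - {i}. ((l i - y) * e $ j / (l j - y)) *s v j)
          \<le> (\<Sum>j\<in>UNIV - {i}. (\<rho> * s) * (cmod (e $ j) * norm (v j) / \<delta>))"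
        proof (rule sum_norm_le)
          fix j assume j: "j \<in> UNIV - {i}"
          then have "norm (((l i - y) * e $ j / (l j - y)) *s v j) = cmod (l i - y) * (cmod (e $ j) * norm (v j) / cmod (l j - y))"
            by (simp add: norm_smult_cvec norm_mult norm_divide)
          also have "\<dots> \<le> (\<rho> * s) * (cmod (e $ j) * norm (v j) / \<delta>)"
          proof (intro mult_mono divide_left_mono)
            show "\<delta> \<le> cmod (l j - y)" using ne[of j] j by blast
            then show "0 < cmod (l j - y) * \<delta>" using \<delta> by (intro mult_pos_pos) linarith+
          qed (use dy \<rho> s(1) in simp_all)
          finally show "norm (((l i - y) * e $ j / (l j - y)) *s v j) \<le> (\<rho> * s) * (cmod (e $ j) * norm (v j) / \<delta>)" .
        qed
        also have "\<dots> = \<rho> * s * C" by (simp add: C_def sum_distrib_left sum_divide_distrib)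
        finally show ?thesis .
      qed
      moreover have "norm (e $ i *s v i) = \<tau>\<^sup>2 * norm (v i)"
        unfolding ei norm_smult_cvec by (simp add: norm_power)
      ultimately have lower: "\<tau>\<^sup>2 * norm (v i) - \<rho> * s * C \<le> norm (S *v c)" by linarith
      have "s * (\<rho> * C + 1) \<le> \<tau> * (norm (v i) * \<tau> - \<rho>)"
        using s(2) \<rho>C by (simp add: s0_def field_simps)
      then have "\<rho> * s * C \<le> \<tau>\<^sup>2 * norm (v i) - \<tau> * \<rho>"
        using s(1) by (simp add: algebra_simps power2_eq_square)
      then have big: "\<tau> * \<rho> \<le> norm (S *v c)" using lower by linarith
      have "norm (pencil_at A B y *v (S *v c)) \<le> (\<rho> * s) * \<tau>"
        unfolding M norm_smult_cvec nx using dy \<tau> by (intro mult_right_mono) auto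
      also have "\<dots> \<le> s * norm (S *v c)" using mult_left_mono[OF big, of s] s by (simp add: mult_ac)
      finally show ?thesis
      proof (rule small_singularI)
        have "0 < \<tau> * \<rho>" using \<tau> \<rho> by simp
        then show "S *v c \<noteq> 0" using big by auto
      qed
    qed
    then show False using s(3) by blast
  qed
  define c where "c = Si *v u"
  have u: "u = S *v c" by (simp add: c_def SSi)
  let ?M = "norm (pencil_at A B z *v u)"
  have ci: "cmod (c $ i) * D \<le> norm (T $ i) * ?M" for i
  proof -
    have "(l i - z) * c $ i = (T *v (pencil_at A B z *v u)) $ i"
      unfolding u MS T1 by simp
    then have "cmod ((l i - z) * c $ i) \<le> norm (T $ i) * ?M"
      unfolding Ti using cmod_cdot_le[of "vcnj (T $ i)"] by simp
    moreover have "cmod (c $ i) * D \<le> cmod ((l i - z) * c $ i)"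
      unfolding norm_mult mult.commute[of "cmod (c $ i)"] by (intro mult_right_mono D(1)) simp
    ultimately show ?thesis by linarith
  qed
  have "D * norm u \<le> D * (\<Sum>i\<in>UNIV. cmod (c $ i) * norm (v i))"
    unfolding u Sv using D(2) by (intro mult_left_mono sum_norm_le) (auto simp: norm_smult_cvec)
  also have "\<dots> = (\<Sum>i\<in>UNIV. (cmod (c $ i) * D) * norm (v i))"
    by (simp add: sum_distrib_left mult_ac)
  also have "\<dots> \<le> (\<Sum>i\<in>(UNIV :: 'n set). \<rho> * ?M)"
  proof (rule sum_mono)
    fix i
    have "(cmod (c $ i) * D) * norm (v i) \<le> (norm (T $ i) * ?M) * norm (v i)"
      by (intro mult_right_mono ci) simp
    also have "\<dots> = (norm (v i) * norm (T $ i)) * ?M" by simp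
    also have "\<dots> \<le> \<rho> * ?M" by (intro mult_right_mono res) simp
    finally show "(cmod (c $ i) * D) * norm (v i) \<le> \<rho> * ?M" .
  qed
  also have "\<dots> = real CARD('n) * \<rho> * ?M" by simp
  finally show ?thesis .
qed

text \<open>Let f m g be the area of the part of the disc of radius 4 where the least singular value
  is at most s m, divided by (s m)^2. The singular value estimate bounds its expectation uniformly
  in m, and Fatou passes this on to the liminf. A point z as in the event makes the liminf at least
  pi \<rho>^2, so Markov's inequality applies.\<close>

lemma emeasure_large_residue:
  fixes A B :: "complex^'n^'n"
  assumes \<gamma>: "0 < \<gamma>" and \<rho>: "0 < \<rho>"
  shows "\<exists>R \<in> sets borel. {g. \<exists>z\<in>ball 0 4. \<exists>s0>0. \<forall>s. 0 < s \<and> s < s0 \<longrightarrow>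
      cball z (\<rho> * s) \<subseteq> {y. pencil_at (A + \<gamma> *\<^sub>R g) B y \<in> small_singular s}} \<subseteq> R \<and>
    emeasure (gauss (real CARD('n))) R \<le> ennreal (16 * exp 1 * (real CARD('n) * (real CARD('n) + 1)) / (\<gamma>\<^sup>2 * \<rho>\<^sup>2))"
proof -
  define N where "N = real CARD('n)"
  have N: "0 < N" by (simp add: N_def)
  interpret V: prob_space "gauss N :: (complex^'n^'n) measure" by (rule prob_space_gauss[OF N])
  interpret P: pair_sigma_finite "gauss N :: (complex^'n^'n) measure" "lborel :: complex measure"
    by (simp add: pair_sigma_finite_def V.sigma_finite_measure_axioms sigma_finite_lborel)
  define s where "s m = 1 / real (Suc m)" for m
  have s: "0 < s m" for m by (simp add: s_def)
  define T where "T m = {p :: (complex^'n^'n) \<times> complex. snd p \<in> ball 0 4 \<and> pencil_at (A + \<gamma> *\<^sub>R fst p) B (snd p) \<in> small_singular (s m)}" for m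
  have T[measurable]: "T m \<in> sets (borel \<Otimes>\<^sub>M borel)" for m
  proof -
    have "closed {p :: (complex^'n^'n) \<times> complex. s m \<ge> 0 \<and> pencil_at (A + \<gamma> *\<^sub>R fst p) B (snd p) \<in> small_singular (s m)}"
      by (intro closed_small_singular continuous_intros)
    moreover have "open {p :: (complex^'n^'n) \<times> complex. snd p \<in> ball 0 4}"
      unfolding mem_ball by (intro open_Collect_less continuous_intros)
    moreover have "T m = {p. snd p \<in> ball 0 4} \<inter> {p. s m \<ge> 0 \<and> pencil_at (A + \<gamma> *\<^sub>R fst p) B (snd p) \<in> small_singular (s m)}"
      using s[of m] by (auto simp: T_def)
    ultimately show ?thesis unfolding borel_prod by (simp only: sets.Int borel_open borel_closed)
  qed
  define f where "f m g = ennreal (1 / (s m)\<^sup>2) * (\<integral>\<^sup>+z. indicator (T m) (g, z) \<partial>lborel)" for m g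
  have f[measurable]: "f m \<in> borel_measurable borel" for m
    unfolding f_def by measurable
  have int: "(\<integral>\<^sup>+g. f m g \<partial>gauss N) \<le> ennreal (16 * pi * exp 1 * (N * (N + 1)) / \<gamma>\<^sup>2)" for m
  proof -
    have "(\<integral>\<^sup>+g. f m g \<partial>gauss N) = ennreal (1 / (s m)\<^sup>2) * (\<integral>\<^sup>+g. \<integral>\<^sup>+z. indicator (T m) (g, z) \<partial>lborel \<partial>gauss N)"
      unfolding f_def by (intro nn_integral_cmult) measurable
    also have "(\<integral>\<^sup>+g. \<integral>\<^sup>+z. indicator (T m) (g, z) \<partial>lborel \<partial>gauss N) = (\<integral>\<^sup>+z. \<integral>\<^sup>+g. indicator (T m) (g, z) \<partial>gauss N \<partial>lborel)"
      by (intro P.Fubini'[symmetric]) measurable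
    also have "\<dots> \<le> (\<integral>\<^sup>+z. ennreal (exp 1 * (N * (N + 1)) * (s m)\<^sup>2 / \<gamma>\<^sup>2) * indicator (ball (0::complex) 4) z \<partial>lborel)"
    proof (rule nn_integral_mono)
      fix z :: complex
      let ?S = "{g. pencil_at A B z + \<gamma> *\<^sub>R g \<in> small_singular (s m)}"
      have "closed {g. s m \<ge> 0 \<and> pencil_at A B z + \<gamma> *\<^sub>R g \<in> small_singular (s m)}"
        by (intro closed_small_singular continuous_intros)
      then have S: "?S \<in> sets borel" using s[of m] by (simp add: less_imp_le)
      have "(\<integral>\<^sup>+g. indicator (T m) (g, z) \<partial>gauss N) = (\<integral>\<^sup>+g. indicator (ball 0 4) z * indicator ?S g \<partial>gauss N)"
        by (intro nn_integral_cong) (auto simp: T_def indicator_def pencil_at_perturb)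
      also have "\<dots> = indicator (ball 0 4) z * emeasure (gauss N) ?S"
        using S by (intro nn_integral_cmult_indicator) (simp only: sets_gauss)
      also have "\<dots> \<le> indicator (ball 0 4) z * ennreal (exp 1 * (N * (N + 1)) * (s m)\<^sup>2 / \<gamma>\<^sup>2)"
        unfolding N_def by (intro mult_left_mono emeasure_small_singular \<gamma> s) simp
      finally show "(\<integral>\<^sup>+g. indicator (T m) (g, z) \<partial>gauss N)
        \<le> ennreal (exp 1 * (N * (N + 1)) * (s m)\<^sup>2 / \<gamma>\<^sup>2) * indicator (ball 0 4) z" by (simp add: mult.commute)
    qed
    also have "\<dots> = ennreal (exp 1 * (N * (N + 1)) * (s m)\<^sup>2 / \<gamma>\<^sup>2) * ennreal (pi * 16)"
      by (subst nn_integral_cmult_indicator) (auto simp: emeasure_ball unit_ball_vol_2)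
    finally have "(\<integral>\<^sup>+g. f m g \<partial>gauss N) \<le> ennreal (1 / (s m)\<^sup>2) * (ennreal (exp 1 * (N * (N + 1)) * (s m)\<^sup>2 / \<gamma>\<^sup>2) * ennreal (pi * 16))"
      by (simp add: mult_left_mono)
    also have "\<dots> = ennreal (1 / (s m)\<^sup>2 * (exp 1 * (N * (N + 1)) * (s m)\<^sup>2 / \<gamma>\<^sup>2 * (pi * 16)))"
    proof -
      have q: "0 \<le> exp 1 * (N * (N + 1)) * (s m)\<^sup>2 / \<gamma>\<^sup>2" using N by simp
      show ?thesis unfolding ennreal_mult'[OF q, symmetric] by (rule ennreal_mult'[symmetric]) simp
    qed
    also have "1 / (s m)\<^sup>2 * (exp 1 * (N * (N + 1)) * (s m)\<^sup>2 / \<gamma>\<^sup>2 * (pi * 16)) = 16 * pi * exp 1 * (N * (N + 1)) / \<gamma>\<^sup>2"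
      using s[of m] by simp
    finally show ?thesis .
  qed
  define F where "F g = liminf (\<lambda>m. f m g)" for g
  have F[measurable]: "F \<in> borel_measurable borel" unfolding F_def by measurable
  have intF: "(\<integral>\<^sup>+g. F g \<partial>gauss N) \<le> ennreal (16 * pi * exp 1 * (N * (N + 1)) / \<gamma>\<^sup>2)"
  proof -
    have "(\<integral>\<^sup>+g. F g \<partial>gauss N) \<le> liminf (\<lambda>m. \<integral>\<^sup>+g. f m g \<partial>gauss N)"
      unfolding F_def by (intro nn_integral_liminf) measurable
    also have "\<dots> \<le> limsup (\<lambda>m. \<integral>\<^sup>+g. f m g \<partial>gauss N)" by (rule Liminf_le_Limsup) simp
    also have "\<dots> \<le> ennreal (16 * pi * exp 1 * (N * (N + 1)) / \<gamma>\<^sup>2)"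
      by (intro Limsup_bounded always_eventually allI int)
    finally show ?thesis .
  qed
  \<comment> \<open>A measurable majorant: the event itself has a quantifier over uncountably many
    points z.\<close>
  define R where "R = {g. ennreal (pi * \<rho>\<^sup>2) \<le> F g}"
  have R: "R \<in> sets borel" unfolding R_def by measurable
  have "ennreal (pi * \<rho>\<^sup>2) * emeasure (gauss N) R = (\<integral>\<^sup>+g. ennreal (pi * \<rho>\<^sup>2) * indicator R g \<partial>gauss N)"
    using R by (intro nn_integral_cmult_indicator[symmetric]) simp
  also have "\<dots> \<le> (\<integral>\<^sup>+g. F g \<partial>gauss N)"
    by (intro nn_integral_mono) (auto simp: R_def indicator_def)
  finally have *: "ennreal (pi * \<rho>\<^sup>2) * emeasure (gauss N) R \<le> ennreal (16 * pi * exp 1 * (N * (N + 1)) / \<gamma>\<^sup>2)"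
    using intF by (rule order_trans)
  have "emeasure (gauss N) R = ennreal (1 / (pi * \<rho>\<^sup>2)) * (ennreal (pi * \<rho>\<^sup>2) * emeasure (gauss N) R)"
  proof -
    have "ennreal (1 / (pi * \<rho>\<^sup>2)) * ennreal (pi * \<rho>\<^sup>2) = 1" using \<rho> by (subst ennreal_mult'[symmetric]) auto
    then show ?thesis by (simp only: mult.assoc[symmetric] mult_1)
  qed
  also have "\<dots> \<le> ennreal (1 / (pi * \<rho>\<^sup>2)) * ennreal (16 * pi * exp 1 * (N * (N + 1)) / \<gamma>\<^sup>2)"
    by (intro mult_left_mono *) simp
  also have "\<dots> = ennreal (1 / (pi * \<rho>\<^sup>2) * (16 * pi * exp 1 * (N * (N + 1)) / \<gamma>\<^sup>2))"
    by (rule ennreal_mult'[symmetric]) simp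
  also have "1 / (pi * \<rho>\<^sup>2) * (16 * pi * exp 1 * (N * (N + 1)) / \<gamma>\<^sup>2) = 16 * exp 1 * (N * (N + 1)) / (\<gamma>\<^sup>2 * \<rho>\<^sup>2)"
    by (simp add: mult_ac)
  finally have bound: "emeasure (gauss N) R \<le> ennreal (16 * exp 1 * (N * (N + 1)) / (\<gamma>\<^sup>2 * \<rho>\<^sup>2))" .
  have sub: "g \<in> R" if z: "z \<in> ball 0 4" and s0: "0 < s0"
    and disc: "\<And>s. 0 < s \<Longrightarrow> s < s0 \<Longrightarrow> cball z (\<rho> * s) \<subseteq> {y. pencil_at (A + \<gamma> *\<^sub>R g) B y \<in> small_singular s}" for g z s0
  proof -
    have "0 < 4 - cmod z" using z by simp
    then have "0 < min s0 ((4 - cmod z) / (2 * \<rho>))" using s0 \<rho> by simp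
    then have ev: "eventually (\<lambda>m. s m < min s0 ((4 - cmod z) / (2 * \<rho>))) sequentially"
      unfolding s_def by (intro order_tendstoD(2)[OF LIMSEQ_Suc[OF lim_1_over_n]])
    have "eventually (\<lambda>m. ennreal (pi * \<rho>\<^sup>2) \<le> f m g) sequentially"
      using ev
    proof (rule eventually_mono)
      fix m assume m: "s m < min s0 ((4 - cmod z) / (2 * \<rho>))"
      have in_ball: "cball z (\<rho> * s m) \<subseteq> ball 0 4"
      proof
        fix y assume "y \<in> cball z (\<rho> * s m)"
        then have "cmod y \<le> cmod z + \<rho> * s m"
          using norm_triangle_ineq2[of y z] by (simp add: dist_norm norm_minus_commute)
        moreover have "\<rho> * s m \<le> (4 - cmod z) / 2" using m \<rho> by (simp add: field_simps)
        ultimately show "y \<in> ball 0 4" using \<open>0 < 4 - cmod z\<close> by simp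
      qed
      have "ennreal (pi * \<rho>\<^sup>2) = ennreal (1 / (s m)\<^sup>2) * ennreal (pi * (\<rho> * s m)\<^sup>2)"
        using s[of m] by (subst ennreal_mult'[symmetric]) (auto simp: power_mult_distrib)
      also have "ennreal (pi * (\<rho> * s m)\<^sup>2) = emeasure lborel (cball z (\<rho> * s m))"
        using \<rho> s[of m] by (simp add: emeasure_cball unit_ball_vol_2)
      also have "\<dots> = (\<integral>\<^sup>+y. indicator (cball z (\<rho> * s m)) y \<partial>lborel)"
        by (intro nn_integral_indicator[symmetric]) simp
      also have "ennreal (1 / (s m)\<^sup>2) * \<dots> \<le> f m g"
        unfolding f_def
      proof (intro mult_left_mono nn_integral_mono)
        fix y
        show "indicator (cball z (\<rho> * s m)) y \<le> (indicator (T m) (g, y) :: ennreal)"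
          using disc[OF s[of m]] in_ball m by (auto simp: T_def indicator_def subset_eq)
      qed simp
      finally show "ennreal (pi * \<rho>\<^sup>2) \<le> f m g" .
    qed
    then show ?thesis unfolding R_def F_def mem_Collect_eq by (rule Liminf_bounded)
  qed
  show ?thesis
    using R bound sub unfolding N_def by (intro bexI[of _ R] conjI) blast+
qed

lemma emeasure_close_roots:
  fixes A B :: "complex^'n^'n"
  assumes \<gamma>: "0 < \<gamma>" and t: "0 < t" and Z: "finite Z"
  defines "S \<equiv> {g. \<exists>z\<in>Z. \<exists>i j. i \<noteq> j \<and> pencil_at (A + \<gamma> *\<^sub>R g) B z \<in> near_dependent t i j}"
  shows "S \<in> sets borel"
    and "emeasure (gauss (real CARD('n))) S \<le> ennreal (6 * real (card Z) * real CARD('n) ^ 4 * t\<^sup>2 / \<gamma> ^ 4)"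
proof -
  define N where "N = real CARD('n)"
  have N: "0 < N" by (simp add: N_def)
  define I where "I = {(z, i :: 'n, j). z \<in> Z \<and> i \<noteq> j}"
  have I_sub: "I \<subseteq> Z \<times> UNIV \<times> UNIV" by (auto simp: I_def)
  have I: "finite I" using Z by (intro finite_subset[OF I_sub]) auto
  define E where "E k = (case k of (z, i, j) \<Rightarrow> {g. pencil_at A B z + \<gamma> *\<^sub>R g \<in> near_dependent t i j})" for k
  have S: "S = (\<Union>k\<in>I. E k)"
    unfolding S_def I_def E_def pencil_at_perturb by auto
  have E: "E k \<in> sets borel" for k unfolding E_def by (cases k) (simp add: borel_near_dependent)
  then show "S \<in> sets borel" unfolding S using I by auto
  have cI: "real (card I) \<le> real (card Z) * N\<^sup>2"
  proof -
    have "card I \<le> card (Z \<times> (UNIV :: 'n set) \<times> (UNIV :: 'n set))" using Z by (intro card_mono I_sub) auto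
    then have "card I \<le> card Z * (CARD('n) * CARD('n))" by (simp add: card_cartesian_product)
    then have "real (card I) \<le> real (card Z * (CARD('n) * CARD('n)))" by (rule of_nat_mono)
    then show ?thesis by (simp add: N_def power2_eq_square)
  qed
  have "emeasure (gauss N) S \<le> (\<Sum>k\<in>I. emeasure (gauss N) (E k))"
    unfolding S using E I by (intro emeasure_subadditive_finite) auto
  also have "\<dots> \<le> (\<Sum>k\<in>I. ennreal (6 * N\<^sup>2 * t\<^sup>2 / \<gamma> ^ 4))"
    by (intro sum_mono) (auto simp: I_def E_def intro!: emeasure_near_dependent N \<gamma> t)
  also have "\<dots> = ennreal (real (card I) * (6 * N\<^sup>2 * t\<^sup>2 / \<gamma> ^ 4))"
    unfolding sum_constant ennreal_of_nat_eq_real_of_nat by (rule ennreal_mult'[symmetric]) simp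
  also have "\<dots> \<le> ennreal ((real (card Z) * N\<^sup>2) * (6 * N\<^sup>2 * t\<^sup>2 / \<gamma> ^ 4))"
    by (intro ennreal_leI mult_right_mono cI) auto
  finally show "emeasure (gauss (real CARD('n))) S \<le> ennreal (6 * real (card Z) * real CARD('n) ^ 4 * t\<^sup>2 / \<gamma> ^ 4)"
    unfolding N_def by (simp add: power2_eq_square power4_eq_xxxx mult_ac)
qed

section \<open>Distribution of Ginibre matrices and pseudospectra of pencils\<close>

lemma emeasure_gauss_box:
  fixes l u :: "'a::euclidean_space"
  assumes "0 < a"
  shows "emeasure (gauss a) (box l u) = (\<Prod>b\<in>Basis. \<integral>\<^sup>+x. ennreal (sqrt (a / pi) * exp (- a * x\<^sup>2)) * indicator {l \<bullet> b<..<u \<bullet> b} x \<partial>lborel)"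
proof -
  have "emeasure (gauss a) (box l u) = (\<integral>\<^sup>+x. ennreal (sqrt (a / pi) ^ DIM('a) * exp (- a * (norm x)\<^sup>2)) * indicator (box l u) x \<partial>lborel)"
    unfolding gauss_def by (subst emeasure_density) auto
  also have "\<dots> = (\<integral>\<^sup>+x. (\<Prod>b\<in>Basis. ennreal (sqrt (a / pi) * exp (- a * (x \<bullet> b)\<^sup>2)) * indicator {l \<bullet> b<..<u \<bullet> b} (x \<bullet> b)) \<partial>(lborel :: 'a measure))"
  proof (rule nn_integral_cong)
    fix x :: 'a
    have "(indicator (box l u) x :: ennreal) = (\<Prod>b\<in>Basis. indicator {l \<bullet> b<..<u \<bullet> b} (x \<bullet> b))"
    proof (cases "x \<in> box l u")
      case False
      then obtain b where "b \<in> Basis" "x \<bullet> b \<notin> {l \<bullet> b<..<u \<bullet> b}" by (auto simp: mem_box)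
      then show ?thesis using False by (subst prod_zero[where A = Basis]) (auto intro!: bexI[of _ b])
    qed (auto simp: mem_box intro!: prod.neutral[symmetric])
    moreover have "ennreal (sqrt (a / pi) ^ DIM('a) * exp (- a * (norm x)\<^sup>2)) = (\<Prod>b\<in>Basis. ennreal (sqrt (a / pi) * exp (- a * (x \<bullet> b)\<^sup>2)))"
      unfolding prod_gauss_density using assms by (intro prod_ennreal[symmetric]) auto
    ultimately show "ennreal (sqrt (a / pi) ^ DIM('a) * exp (- a * (norm x)\<^sup>2)) * indicator (box l u) x
      = (\<Prod>b\<in>Basis. ennreal (sqrt (a / pi) * exp (- a * (x \<bullet> b)\<^sup>2)) * indicator {l \<bullet> b<..<u \<bullet> b} (x \<bullet> b))"
      by (simp add: prod.distrib)
  qed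
  also have "\<dots> = (\<Prod>b\<in>Basis. \<integral>\<^sup>+x. ennreal (sqrt (a / pi) * exp (- a * x\<^sup>2)) * indicator {l \<bullet> b<..<u \<bullet> b} x \<partial>lborel)"
    by (intro nn_integral_lborel_prod) auto
  finally show ?thesis .
qed

lemma prod_Basis_vec:
  "(\<Prod>b\<in>(Basis :: ('a::euclidean_space^'n) set). f b) = (\<Prod>i\<in>UNIV. \<Prod>b\<in>Basis. f (axis i b))"
proof -
  have eq: "(Basis :: ('a^'n) set) = (\<lambda>(i, b). axis i b) ` (UNIV \<times> Basis)"
    by (auto simp: Basis_vec_def)
  have inj: "inj_on (\<lambda>(i, b). axis i b :: 'a^'n) (UNIV \<times> Basis)"
    by (auto simp: inj_on_def axis_eq_axis)
  show ?thesis
    unfolding eq by (subst prod.reindex[OF inj]) (simp add: prod.cartesian_product comp_def split_def)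
qed

lemma emeasure_gauss_box_vec:
  fixes l u :: "'a::euclidean_space^'n"
  assumes "0 < a"
  shows "emeasure (gauss a) (box l u) = (\<Prod>i\<in>UNIV. emeasure (gauss a) (box (l $ i) (u $ i)))"
  unfolding emeasure_gauss_box[OF assms] prod_Basis_vec by (simp add: inner_axis)

lemma mem_box_vec: "(x :: 'a::euclidean_space^'n) \<in> box l u \<longleftrightarrow> (\<forall>i. x $ i \<in> box (l $ i) (u $ i))"
  by (auto simp: mem_box Basis_vec_def inner_axis)

text \<open>Independence determines the law on boxes, an intersection-stable generator. The entries
  match because variance 1/(2n) per real coordinate is the parameter a = n.\<close>

lemma distr_complex_ginibre:
  fixes G :: "'a \<Rightarrow> complex^'n^'n"
  assumes "prob_space M" and G: "complex_ginibre M G" and meas[measurable]: "G \<in> borel_measurable M"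
  shows "distr M borel G = gauss (real CARD('n))"
proof -
  interpret prob_space M by fact
  define N where "N = real CARD('n)"
  have N: "0 < N" by (simp add: N_def)
  have entry: "emeasure M ((\<lambda>x. G x $ i $ j) -` A \<inter> space M) = emeasure (gauss N) A" if "A \<in> sets borel" for i j A
  proof -
    have "distributed M lborel (\<lambda>x. G x $ i $ j) (\<lambda>z. ennreal (complex_normal_density (1 / N) z))"
      using G by (simp add: complex_ginibre_def N_def)
    then have "emeasure M ((\<lambda>x. G x $ i $ j) -` A \<inter> space M) = (\<integral>\<^sup>+z. ennreal (complex_normal_density (1 / N) z) * indicator A z \<partial>lborel)"
      using that by (intro distributed_emeasure) auto
    also have "\<dots> = (\<integral>\<^sup>+z. ennreal (sqrt (N / pi) ^ DIM(complex) * exp (- N * (norm z)\<^sup>2)) * indicator A z \<partial>lborel)"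
    proof -
      have "complex_normal_density (1 / N) z = sqrt (N / pi) ^ DIM(complex) * exp (- N * (norm z)\<^sup>2)" for z
      proof -
        have "1 / N / 2 = 1 / (2 * N)" by simp
        then show ?thesis
          unfolding complex_normal_density_def
          by (simp only: normal_density_gauss[OF N])
             (simp only: cmod_power2 DIM_complex distrib_left exp_add power2_eq_square[of "sqrt (N / pi)"] mult_ac)
      qed
      then show ?thesis by simp
    qed
    also have "\<dots> = emeasure (gauss N) A"
      unfolding gauss_def using that by (subst emeasure_density) auto
    finally show ?thesis .
  qed
  have box: "emeasure (distr M borel G) (box l u) = emeasure (gauss N) (box l u)" for l u
  proof -
    let ?X = "\<lambda>p x. case p of (i, j) \<Rightarrow> G x $ i $ j"
    let ?A = "\<lambda>p. case p of (i, j) \<Rightarrow> box (l $ i $ j) (u $ i $ j)"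
    have ind: "indep_vars (\<lambda>_. borel) ?X UNIV"
      using G by (simp add: complex_ginibre_def split_def)
    have "G -` box l u \<inter> space M = (\<Inter>p\<in>UNIV. ?X p -` ?A p \<inter> space M)"
      by (auto simp: mem_box_vec)
    moreover have "prob (\<Inter>p\<in>UNIV. ?X p -` ?A p \<inter> space M) = (\<Prod>p\<in>UNIV. prob (?X p -` ?A p \<inter> space M))"
      by (intro indep_varsD[OF ind]) auto
    ultimately have "emeasure M (G -` box l u \<inter> space M) = (\<Prod>p\<in>UNIV. emeasure M (?X p -` ?A p \<inter> space M))"
      by (simp add: emeasure_eq_measure prod_ennreal)
    also have "\<dots> = (\<Prod>p\<in>UNIV. emeasure (gauss N) (?A p))"
      by (intro prod.cong) (auto simp: entry)
    also have "\<dots> = (\<Prod>i\<in>UNIV. \<Prod>j\<in>UNIV. emeasure (gauss N) (box (l $ i $ j) (u $ i $ j)))"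
      by (simp add: prod.cartesian_product split_def)
    also have "\<dots> = emeasure (gauss N) (box l u)" by (simp add: emeasure_gauss_box_vec[OF N])
    finally show ?thesis by (simp add: emeasure_distr)
  qed
  show ?thesis
    unfolding N_def[symmetric]
  proof (rule measure_eqI_generator_eq)
    let ?E = "range (\<lambda>(a, b). box a b :: (complex^'n^'n) set)"
    show "Int_stable ?E" by (auto simp: Int_stable_def Int_interval box_Int_box)
    show "?E \<subseteq> Pow UNIV" by auto
    show "emeasure (distr M borel G) X = emeasure (gauss N) X" if "X \<in> ?E" for X using that box by auto
    show "sets (distr M borel G) = sigma_sets UNIV ?E"
      unfolding sets_distr borel_eq_box by simp
    show "sets (gauss N) = sigma_sets UNIV ?E"
      unfolding sets_gauss borel_eq_box by simp
    let ?B = "\<lambda>i::nat. box (- real i *\<^sub>R One) (real i *\<^sub>R One) :: (complex^'n^'n) set"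
    show "range ?B \<subseteq> ?E" by auto
    show "(\<Union>i. ?B i) = UNIV" using UN_box_eq_UNIV[where 'a = "complex^'n^'n"] by (simp add: scaleR_minus_left)
    show "emeasure (distr M borel G) (?B i) \<noteq> \<infinity>" for i
      using emeasure_space_1 prob_space_distr[OF meas]
      by (simp add: prob_space.finite_measure finite_measure.emeasure_finite)
  qed
qed

lemma distr_pair_indep_random_variables:
  assumes M: "prob_space M" and ind: "indep_random_variables M S X T Y"
  shows "distr M (S \<Otimes>\<^sub>M T) (\<lambda>x. (X x, Y x)) = distr M S X \<Otimes>\<^sub>M distr M T Y"
proof -
  interpret prob_space M by fact
  have X[measurable]: "X \<in> measurable M S" and Y[measurable]: "Y \<in> measurable M T"
    and i: "indep_set (sets (vimage_algebra (space M) X S)) (sets (vimage_algebra (space M) Y T))"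
    using ind by (auto simp: indep_random_variables_def)
  interpret X: prob_space "distr M S X" by (rule prob_space_distr[OF X])
  interpret Y: prob_space "distr M T Y" by (rule prob_space_distr[OF Y])
  show ?thesis
  proof (rule pair_measure_eqI[symmetric])
    show "sigma_finite_measure (distr M S X)" "sigma_finite_measure (distr M T Y)" by unfold_locales
    show "sets (distr M S X \<Otimes>\<^sub>M distr M T Y) = sets (distr M (S \<Otimes>\<^sub>M T) (\<lambda>x. (X x, Y x)))"
      by (simp cong: sets_pair_measure_cong)
    fix A B assume "A \<in> sets (distr M S X)" "B \<in> sets (distr M T Y)"
    then have A[measurable]: "A \<in> sets S" and B[measurable]: "B \<in> sets T" by auto
    have "prob ((X -` A \<inter> space M) \<inter> (Y -` B \<inter> space M)) = prob (X -` A \<inter> space M) * prob (Y -` B \<inter> space M)"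
      by (rule indep_setD[OF i]) (auto intro: in_vimage_algebra A B)
    moreover have "(\<lambda>x. (X x, Y x)) -` (A \<times> B) \<inter> space M = (X -` A \<inter> space M) \<inter> (Y -` B \<inter> space M)" by auto
    ultimately show "emeasure (distr M S X) A * emeasure (distr M T Y) B = emeasure (distr M (S \<Otimes>\<^sub>M T) (\<lambda>x. (X x, Y x))) (A \<times> B)"
      by (simp add: emeasure_distr emeasure_eq_measure ennreal_mult)
  qed
qed

section \<open>Pseudospectra and characteristic polynomials of pencils\<close>

lemma spectral_norm_le:
  fixes A :: "complex^'n^'n"
  assumes "0 \<le> c"
  shows "spectral_norm A \<le> c \<longleftrightarrow> (\<forall>u. norm (A *v u) \<le> c * norm u)"
proof
  have bl: "bounded_linear ((*v) A)" using linear_mult_vec by (simp add: linear_conv_bounded_linear)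
  assume le: "spectral_norm A \<le> c"
  show "\<forall>u. norm (A *v u) \<le> c * norm u"
  proof
    fix u
    have "norm (A *v u) \<le> onorm ((*v) A) * norm u" by (rule onorm[OF bl])
    also have "\<dots> \<le> c * norm u" using le by (intro mult_right_mono) (auto simp: spectral_norm_def)
    finally show "norm (A *v u) \<le> c * norm u" .
  qed
next
  assume "\<forall>u. norm (A *v u) \<le> c * norm u"
  then show "spectral_norm A \<le> c" unfolding spectral_norm_def by (intro onorm_bound assms) auto
qed

text \<open>One inclusion is the triangle inequality. For the other, rank-one perturbations suffice:
  with w = (A - z B) u, both are multiples of the matrix sending u to w and killing its orthogonal
  complement, and the phases make their effects add up.\<close>

lemma pencil_pseudospectrum_eq:
  fixes A B :: "complex^'n^'n"
  assumes \<epsilon>: "0 \<le> \<epsilon>"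
  shows "pencil_pseudospectrum \<epsilon> A B = {z. pencil_at A B z \<in> small_singular (\<epsilon> * (1 + cmod z))}"
proof (intro set_eqI iffI)
  fix z assume "z \<in> pencil_pseudospectrum \<epsilon> A B"
  then obtain u P Q where u: "u \<noteq> 0" "spectral_norm P \<le> \<epsilon>" "spectral_norm Q \<le> \<epsilon>"
    "(A + P) *v u = z *s ((B + Q) *v u)" by (auto simp: pencil_pseudospectrum_def)
  have "pencil_at A B z *v u = z *s (Q *v u) - P *v u"
    using u(4) by (simp add: pencil_at_mult matrix_vector_mult_add_rdistrib vec.scale_right_distrib algebra_simps)
  then have "norm (pencil_at A B z *v u) \<le> cmod z * norm (Q *v u) + norm (P *v u)"
    by (metis norm_triangle_ineq4 norm_smult_cvec)
  also have "\<dots> \<le> cmod z * (\<epsilon> * norm u) + \<epsilon> * norm u"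
    using u(2,3) \<epsilon> by (intro add_mono mult_left_mono) (auto simp: spectral_norm_le)
  finally have "norm (pencil_at A B z *v u) \<le> (\<epsilon> * (1 + cmod z)) * norm u" by (simp add: algebra_simps)
  then show "z \<in> {z. pencil_at A B z \<in> small_singular (\<epsilon> * (1 + cmod z))}"
    using u(1) by (simp add: small_singularI)
next
  fix z assume "z \<in> {z. pencil_at A B z \<in> small_singular (\<epsilon> * (1 + cmod z))}"
  then obtain u where u: "norm u = 1" "norm (pencil_at A B z *v u) \<le> \<epsilon> * (1 + cmod z)"
    by (auto simp: small_singular_def)
  define w where "w = pencil_at A B z *v u"
  define R where "R c = (\<chi> i j. c * w $ i * cnj (u $ j))" for c
  have R: "R c *v x = (c * cdot u x) *s w" for c x
    by (simp add: R_def matrix_vector_mult_def vec_eq_iff cdot_def sum_distrib_left mult_ac)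
  have pos: "0 < 1 + cmod z" by (simp add: add_pos_nonneg)
  have Rn: "spectral_norm (R c) \<le> \<epsilon>" if c: "cmod c \<le> 1 / (1 + cmod z)" for c
    unfolding spectral_norm_le[OF \<epsilon>]
  proof
    fix x
    have "norm (R c *v x) = cmod c * cmod (cdot u x) * norm w" by (simp add: R norm_smult_cvec norm_mult)
    also have "\<dots> \<le> (1 / (1 + cmod z)) * norm x * (\<epsilon> * (1 + cmod z))"
      using c u cmod_cdot_le[of u x] pos \<epsilon> by (intro mult_mono) (auto simp: w_def)
    also have "\<dots> = \<epsilon> * norm x" using pos by simp
    finally show "norm (R c *v x) \<le> \<epsilon> * norm x" .
  qed
  \<comment> \<open>Both have modulus at most 1/(1 + |z|), and the conjugate phase of z in
    \<open>q\<close> achieves z q - p = 1. At z = 0 the sign is 0 and \<open>p\<close> alone does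
    it.\<close>
  define p q where "p = - (1 / of_real (1 + cmod z) :: complex)" and "q = cnj (sgn z) / of_real (1 + cmod z)"
  have cp: "cmod p \<le> 1 / (1 + cmod z)"
  proof -
    have "cmod p = 1 / cmod (of_real (1 + cmod z))" by (simp only: p_def norm_minus_cancel norm_divide norm_one)
    then show ?thesis using pos by (simp only: norm_of_real abs_of_pos)
  qed
  have cq: "cmod q \<le> 1 / (1 + cmod z)"
  proof -
    have "cmod q = cmod (sgn z) / cmod (of_real (1 + cmod z))" by (simp only: q_def norm_divide complex_mod_cnj)
    also have "\<dots> = cmod (sgn z) / (1 + cmod z)" using pos by (simp only: norm_of_real abs_of_pos)
    also have "\<dots> \<le> 1 / (1 + cmod z)" using pos by (intro divide_right_mono) (auto simp: norm_sgn)
    finally show ?thesis .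
  qed
  have zq: "z * q - p = 1"
  proof -
    have "z * cnj (sgn z) = of_real (cmod z)"
      by (cases "z = 0") (auto simp: sgn_div_norm scaleR_conv_of_real complex_norm_square[symmetric] power2_eq_square
          mult.left_commute[of z] divide_inverse)
    then have "z * q - p = (of_real (cmod z) + 1) / of_real (1 + cmod z)"
      unfolding p_def q_def by (simp add: add_divide_distrib)
    also have "\<dots> = of_real (1 + cmod z) / of_real (1 + cmod z)" by (simp add: add.commute)
    also have "\<dots> = 1" using pos by (intro divide_self) (metis less_irrefl of_real_eq_0_iff)
    finally show ?thesis .
  qed
  have "A *v u - z *s (B *v u) = w" by (simp add: w_def pencil_at_mult)
  moreover have "z *s (R q *v u) - R p *v u = w"
  proof -
    have "z *s (R q *v u) - R p *v u = (z * q - p) *s w"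
      by (simp add: R cdot_self u vec_eq_iff algebra_simps)
    then show ?thesis by (simp add: zq)
  qed
  ultimately have "(A + R p) *v u = z *s ((B + R q) *v u)"
    by (simp add: matrix_vector_mult_add_rdistrib vec.scale_right_distrib algebra_simps)
  moreover have "u \<noteq> 0" using u(1) by auto
  ultimately show "z \<in> pencil_pseudospectrum \<epsilon> A B"
    unfolding pencil_pseudospectrum_def using Rn[OF cp] Rn[OF cq] by blast
qed

lemma coeff_prod_linear:
  fixes a b :: "'i \<Rightarrow> complex"
  assumes "finite I"
  shows "coeff (\<Prod>i\<in>I. [:a i, b i:]) (card I) = (\<Prod>i\<in>I. b i) \<and> degree (\<Prod>i\<in>I. [:a i, b i:]) \<le> card I"
  using assms
proof (induction I rule: finite_induct)
  case (insert x I)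
  have "degree (\<Prod>i\<in>insert x I. [:a i, b i:]) \<le> degree [:a x, b x:] + degree (\<Prod>i\<in>I. [:a i, b i:])"
    by (simp only: prod.insert[OF insert.hyps] degree_mult_le)
  also have "\<dots> \<le> 1 + card I" using insert.IH by (intro add_mono) auto
  finally have d: "degree (\<Prod>i\<in>insert x I. [:a i, b i:]) \<le> card (insert x I)" using insert.hyps by simp
  have "coeff (\<Prod>i\<in>I. [:a i, b i:]) (Suc (card I)) = 0"
    using insert.IH by (intro coeff_eq_0) simp
  then show ?case using insert.hyps insert.IH d by (simp add: mult_pCons_left)
qed simp

text \<open>The coefficient of z^n shows that the degree is n, so that no eigenvalue is infinite,
  exactly when B is invertible.\<close>

lemma degree_pencil_poly:
  fixes A B :: "complex^'n^'n"
  shows "degree (pencil_poly A B) \<le> CARD('n)"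
    and "coeff (pencil_poly A B) CARD('n) = det (- B)"
proof -
  let ?t = "\<lambda>p. of_int (sign p) * (\<Prod>i\<in>UNIV. [:A $ i $ p i, - B $ i $ p i:])"
  have e: "pencil_poly A B = (\<Sum>p\<in>{p. p permutes (UNIV :: 'n set)}. ?t p)"
    by (simp add: pencil_poly_def det_def)
  have of: "of_int k = [:of_int k :: complex:]" for k by (simp add: of_int_poly)
  have t: "coeff (?t p) CARD('n) = of_int (sign p) * (\<Prod>i\<in>UNIV. - B $ i $ p i)" "degree (?t p) \<le> CARD('n)" for p :: "'n \<Rightarrow> 'n"
    using coeff_prod_linear[of UNIV "\<lambda>i. A $ i $ p i" "\<lambda>i. - B $ i $ p i"]
    by (auto simp: of intro: order_trans[OF degree_smult_le])
  show "degree (pencil_poly A B) \<le> CARD('n)"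
    unfolding e by (intro degree_sum_le t) simp
  show "coeff (pencil_poly A B) CARD('n) = det (- B)"
    unfolding e coeff_sum t(1) by (simp add: det_def)
qed

lemma det_uminus_eq_0: "det (- B) = 0 \<longleftrightarrow> det (B :: complex^'n^'n) = 0"
proof -
  have "invertible (- B) \<longleftrightarrow> invertible B" for B :: "complex^'n^'n"
  proof -
    have neg: "(- B) *v u = - (B *v u)" for u and B :: "complex^'n^'n"
      by (simp add: matrix_vector_mult_def vec_eq_iff sum_negf)
    show ?thesis
      unfolding invertible_left_inverse matrix_left_invertible_ker neg by simp
  qed
  then show ?thesis by (simp add: invertible_det_nz)
qed

text \<open>Divisibility expresses two roots counted with multiplicity, so the case l1 = l2 is
  included and \<open>two_roots_iff\<close> applies.\<close>

lemma pair_in_proots_iff: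
  fixes p :: "complex poly"
  assumes "p \<noteq> 0"
  shows "{#l1, l2#} \<subseteq># proots p \<longleftrightarrow> [:- l1, 1:] * [:- l2, 1:] dvd p"
proof
  assume sub: "{#l1, l2#} \<subseteq># proots p"
  then have "l1 \<in># proots p" by (simp add: insert_subset_eq_iff)
  then obtain q where q: "p = [:- l1, 1:] * q" using assms by (auto simp: poly_eq_0_iff_dvd elim: dvdE)
  have "q \<noteq> 0" using assms q by auto
  then have "proots p = {#l1#} + proots q" unfolding q by (subst proots_mult) auto
  then have "l2 \<in># proots q" using sub by (simp add: insert_subset_eq_iff)
  then have "[:- l2, 1:] dvd q" using \<open>q \<noteq> 0\<close> by (simp add: poly_eq_0_iff_dvd)
  then show "[:- l1, 1:] * [:- l2, 1:] dvd p" unfolding q by (rule mult_dvd_mono[OF dvd_refl])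
next
  assume "[:- l1, 1:] * [:- l2, 1:] dvd p"
  then obtain q where q: "p = [:- l1, 1:] * [:- l2, 1:] * q" by (elim dvdE)
  have "q \<noteq> 0" using assms q by auto
  then have "proots p = {#l1#} + {#l2#} + proots q" unfolding q
    by (subst proots_mult, simp, simp, subst proots_mult) auto
  then show "{#l1, l2#} \<subseteq># proots p" by simp
qed

lemma size_ge_2_iff: "2 \<le> size M \<longleftrightarrow> (\<exists>x y. {#x, y#} \<subseteq># M)"
proof
  assume "2 \<le> size M"
  then obtain x M' where x: "M = add_mset x M'" by (cases M) auto
  then obtain y M'' where "M' = add_mset y M''" using \<open>2 \<le> size M\<close> by (cases M') auto
  then show "\<exists>x y. {#x, y#} \<subseteq># M" using x by (intro exI[of _ x] exI[of _ y]) simp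
next
  assume "\<exists>x y. {#x, y#} \<subseteq># M"
  then obtain x y where "{#x, y#} \<subseteq># M" by blast
  then have "size {#x, y#} \<le> size M" by (rule size_mset_mono)
  then show "2 \<le> size M" by simp
qed

section \<open>Measurability of shattering\<close>

lemma mem_grid_box:
  "l \<in> grid_box z \<omega> j k \<longleftrightarrow> Re z + \<omega> * j \<le> Re l \<and> Re l \<le> Re z + \<omega> * (real j + 1) \<and>
    Im z + \<omega> * k \<le> Im l \<and> Im l \<le> Im z + \<omega> * (real k + 1)"
  by (auto simp: grid_box_def in_cbox_complex_iff)

lemma frontier_grid_box:
  assumes "0 < \<omega>"
  shows "frontier (grid_box z \<omega> j k) = grid_box z \<omega> j k -
    {l. Re z + \<omega> * j < Re l \<and> Re l < Re z + \<omega> * (real j + 1) \<and> Im z + \<omega> * k < Im l \<and> Im l < Im z + \<omega> * (real k + 1)}"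
proof -
  have "interior (grid_box z \<omega> j k) =
    {l. Re z + \<omega> * j < Re l \<and> Re l < Re z + \<omega> * (real j + 1) \<and> Im z + \<omega> * k < Im l \<and> Im l < Im z + \<omega> * (real k + 1)}"
    unfolding grid_box_def interior_cbox by (auto simp: in_box_complex_iff)
  moreover have "closed (grid_box z \<omega> j k)" unfolding grid_box_def by (rule closed_cbox)
  ultimately show ?thesis by (simp add: frontier_def closure_closed)
qed

lemma finite_grid_boxes: "finite (grid_boxes z \<omega> s1 s2)"
proof -
  have "grid_boxes z \<omega> s1 s2 = (\<lambda>(j, k). grid_box z \<omega> j k) ` ({..<s1} \<times> {..<s2})"
    by (auto simp: grid_boxes_def)
  then show ?thesis by simp
qed

lemma strip_unique:
  fixes \<omega> x a :: real and j k :: nat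
  assumes "0 < \<omega>" "a + \<omega> * j < x" "x < a + \<omega> * (real j + 1)" "a + \<omega> * k \<le> x" "x \<le> a + \<omega> * (real k + 1)"
  shows "j = k"
proof -
  have "\<omega> * k < \<omega> * (real j + 1)" "\<omega> * j < \<omega> * (real k + 1)" using assms by linarith+
  then have "real k < real j + 1" "real j < real k + 1" using assms(1) mult_less_cancel_left_pos by blast+
  then show ?thesis by linarith
qed

lemma grid_box_unique:
  assumes \<omega>: "0 < \<omega>" and b: "b \<in> grid_boxes z \<omega> s1 s2" "b' \<in> grid_boxes z \<omega> s1 s2"
    and l: "l \<in> b" "l \<in> b'" "l \<notin> grid z \<omega> s1 s2"
  shows "b = b'"
proof -
  obtain j k where jk: "b = grid_box z \<omega> j k" using b by (auto simp: grid_boxes_def)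
  obtain j' k' where jk': "b' = grid_box z \<omega> j' k'" using b by (auto simp: grid_boxes_def)
  have "l \<notin> frontier b" using l b by (auto simp: grid_def)
  then have "Re z + \<omega> * j < Re l \<and> Re l < Re z + \<omega> * (real j + 1) \<and> Im z + \<omega> * k < Im l \<and> Im l < Im z + \<omega> * (real k + 1)"
    using l(1) by (simp add: jk frontier_grid_box[OF \<omega>])
  moreover have "Re z + \<omega> * j' \<le> Re l \<and> Re l \<le> Re z + \<omega> * (real j' + 1) \<and> Im z + \<omega> * k' \<le> Im l \<and> Im l \<le> Im z + \<omega> * (real k' + 1)"
    using l(2) by (simp add: jk' mem_grid_box)
  ultimately have "j = j'" "k = k'" using strip_unique[OF \<omega>] by blast+
  then show ?thesis by (simp add: jk jk')
qed

text \<open>Multisets and uniqueness of boxes are traded for determinants, kernel vectors and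
  divisibility, a form fit for both measurability and verification. Invertibility of B excludes the
  infinite eigenvalue, and the box is unique because an eigenvalue lies off the grid lines.\<close>

lemma shattered_iff:
  fixes A B :: "complex^'n^'n"
  assumes \<epsilon>: "0 \<le> \<epsilon>" and \<omega>: "0 < \<omega>"
  shows "shattered \<epsilon> A B z \<omega> s1 s2 \<longleftrightarrow>
    (\<forall>l\<in>grid z \<omega> s1 s2. pencil_at A B l \<notin> small_singular (\<epsilon> * (1 + cmod l))) \<and> det B \<noteq> 0 \<and>
    (\<forall>l. det (pencil_at A B l) = 0 \<longrightarrow> (\<exists>b\<in>grid_boxes z \<omega> s1 s2. l \<in> b)) \<and>
    (\<forall>b\<in>grid_boxes z \<omega> s1 s2. \<forall>l1\<in>b. \<forall>l2\<in>b. \<not> [:- l1, 1:] * [:- l2, 1:] dvd pencil_poly A B)"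
    (is "_ \<longleftrightarrow> ?C1 \<and> ?C2 \<and> ?C3 \<and> ?C4")
proof -
  let ?p = "pencil_poly A B" and ?E = "pencil_eigenvalues A B" and ?G = "grid_boxes z \<omega> s1 s2"
  have c1: "pencil_pseudospectrum \<epsilon> A B \<inter> grid z \<omega> s1 s2 = {} \<longleftrightarrow> ?C1"
    by (auto simp: pencil_pseudospectrum_eq[OF \<epsilon>])
  have lead: "?p \<noteq> 0 \<and> degree ?p = CARD('n) \<longleftrightarrow> det B \<noteq> 0"
  proof
    assume "?p \<noteq> 0 \<and> degree ?p = CARD('n)"
    then have "coeff ?p CARD('n) \<noteq> 0" by (metis leading_coeff_neq_0)
    then show "det B \<noteq> 0" by (simp add: degree_pencil_poly det_uminus_eq_0)
  next
    assume "det B \<noteq> 0"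
    then have "coeff ?p CARD('n) \<noteq> 0" by (simp add: degree_pencil_poly det_uminus_eq_0)
    then show "?p \<noteq> 0 \<and> degree ?p = CARD('n)"
      using degree_pencil_poly(1)[of A B] le_degree by (metis antisym coeff_0)
  qed
  have Eeq: "?E = image_mset Some (proots ?p)" if "degree ?p = CARD('n)" using that by (simp add: pencil_eigenvalues_def)
  have filt: "filter_mset (\<lambda>l. l \<in> Some ` b) (image_mset Some S) = image_mset Some (filter_mset (\<lambda>l. l \<in> b) S)" for b and S :: "complex multiset"
    by (induction S) auto
  have c4: "(\<forall>b\<in>?G. size {#l \<in># ?E. l \<in> Some ` b#} \<le> 1) \<longleftrightarrow> ?C4" if B: "det B \<noteq> 0"
  proof -
    have p: "?p \<noteq> 0" "degree ?p = CARD('n)" using B lead by auto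
    have a1: "size {#l \<in># ?E. l \<in> Some ` b#} \<le> 1 \<longleftrightarrow> \<not> 2 \<le> size {#l \<in># proots ?p. l \<in> b#}" for b
      by (simp add: Eeq[OF p(2)] filt) linarith
    have a2: "2 \<le> size {#l \<in># proots ?p. l \<in> b#} \<longleftrightarrow> (\<exists>l1\<in>b. \<exists>l2\<in>b. {#l1, l2#} \<subseteq># proots ?p)" for b
    proof -
      have "{#l1, l2#} \<subseteq># {#l \<in># S. l \<in> b#} \<longleftrightarrow> l1 \<in> b \<and> l2 \<in> b \<and> {#l1, l2#} \<subseteq># S" for l1 l2 and S :: "complex multiset"
      proof
        assume sub: "{#l1, l2#} \<subseteq># {#l \<in># S. l \<in> b#}"
        then have "l1 \<in># {#l \<in># S. l \<in> b#}" "l2 \<in># {#l \<in># S. l \<in> b#}" using set_mset_mono[OF sub] by auto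
        moreover have "{#l1, l2#} \<subseteq># S" using sub multiset_filter_subset subset_mset.order_trans by blast
        ultimately show "l1 \<in> b \<and> l2 \<in> b \<and> {#l1, l2#} \<subseteq># S" by auto
      next
        assume "l1 \<in> b \<and> l2 \<in> b \<and> {#l1, l2#} \<subseteq># S"
        then show "{#l1, l2#} \<subseteq># {#l \<in># S. l \<in> b#}"
          using multiset_filter_mono[of "{#l1, l2#}" S "\<lambda>l. l \<in> b"] by simp
      qed
      then show ?thesis unfolding size_ge_2_iff by blast
    qed
    show ?thesis unfolding a1 a2 pair_in_proots_iff[OF p(1)] by blast
  qed
  have root_E: "Some l \<in># ?E \<longleftrightarrow> det (pencil_at A B l) = 0" if B: "det B \<noteq> 0" for l
  proof -
    have p: "?p \<noteq> 0" "degree ?p = CARD('n)" using B lead by auto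
    show ?thesis by (auto simp: Eeq[OF p(2)] p(1) poly_pencil_poly)
  qed
  show ?thesis
  proof
    assume sh: "shattered \<epsilon> A B z \<omega> s1 s2"
    then have p: "?p \<noteq> 0" and E: "\<And>l. l \<in># ?E \<Longrightarrow> \<exists>b\<in>?G. l \<in> Some ` b"
      and s: "\<forall>b\<in>?G. size {#l \<in># ?E. l \<in> Some ` b#} \<le> 1" and C1: ?C1
      using c1 unfolding shattered_def by blast+
    \<comment> \<open>The infinite eigenvalue lies in no box, so the degree deficit must
      vanish.\<close>
    have "None \<notin># ?E" using E[of None] by auto
    then have "degree ?p = CARD('n)"
      using degree_pencil_poly(1)[of A B] by (auto simp: pencil_eigenvalues_def split: if_splits)
    then have B: ?C2 using p lead by blast
    have "?C3"
    proof (intro allI impI)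
      fix l assume "det (pencil_at A B l) = 0"
      then have "Some l \<in># ?E" using root_E[OF B] by simp
      from E[OF this] show "\<exists>b\<in>?G. l \<in> b" by auto
    qed
    then show "?C1 \<and> ?C2 \<and> ?C3 \<and> ?C4" using C1 B c4[OF B] s by blast
  next
    assume "?C1 \<and> ?C2 \<and> ?C3 \<and> ?C4"
    then have C1: ?C1 and B: ?C2 and C3: ?C3 and C4: ?C4 by blast+
    have p: "?p \<noteq> 0" "degree ?p = CARD('n)" using B lead by auto
    have "\<exists>!b. b \<in> ?G \<and> l \<in> Some ` b" if l: "l \<in># ?E" for l
    proof -
      obtain r where r: "l = Some r" "det (pencil_at A B r) = 0"
        using l by (auto simp: Eeq[OF p(2)] p(1) poly_pencil_poly)
      from C3 r(2) obtain b where b: "b \<in> ?G" "r \<in> b" by blast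
      obtain u where "norm u = 1" "pencil_at A B r *v u = 0"
        using ex_kernel_vec[of "pencil_at A B r"] r(2) by (auto simp: invertible_det_nz)
      \<comment> \<open>The left side of the singular value bound is 0, so nonnegative \<epsilon>
        puts every eigenvalue into the pseudospectrum and hence off the grid.\<close>
      then have "pencil_at A B r \<in> small_singular (\<epsilon> * (1 + cmod r))"
        using \<epsilon> by (auto simp: small_singular_def intro!: exI[of _ u])
      then have nr: "r \<notin> grid z \<omega> s1 s2" using C1 by blast
      show ?thesis
      proof (rule ex1I[of _ b])
        show "b \<in> ?G \<and> l \<in> Some ` b" using b r by auto
        fix b' assume "b' \<in> ?G \<and> l \<in> Some ` b'"
        then have "b' \<in> ?G" "r \<in> b'" using r by auto
        then show "b' = b" using grid_box_unique[OF \<omega>] b nr by blast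
      qed
    qed
    then have u: "\<forall>l\<in>#?E. \<exists>!b. b \<in> ?G \<and> l \<in> Some ` b" by (rule ballI)
    show "shattered \<epsilon> A B z \<omega> s1 s2"
      unfolding shattered_def by (intro conjI iffD2[OF c1 C1] p(1) u iffD2[OF c4[OF B] C4])
  qed
qed

lemma grid_box_shift: "grid_box z \<omega> j k = (+) z ` grid_box 0 \<omega> j k"
proof -
  have "l \<in> (+) z ` grid_box 0 \<omega> j k \<longleftrightarrow> l - z \<in> grid_box 0 \<omega> j k" for l
    by (auto simp: image_iff) (metis add_diff_cancel_left' diff_add_cancel add.commute)
  then show ?thesis by (auto simp: mem_grid_box algebra_simps)
qed

lemma mem_grid: "l \<in> grid z \<omega> s1 s2 \<longleftrightarrow> (\<exists>j k. j < s1 \<and> k < s2 \<and> l \<in> frontier (grid_box z \<omega> j k))"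
  unfolding grid_def grid_boxes_def by blast

text \<open>With a random corner z, quantifiers over the grid become quantifiers over a fixed
  compact set.\<close>

lemma grid_shift: "grid z \<omega> s1 s2 = (+) z ` grid 0 \<omega> s1 s2"
proof -
  have "frontier (grid_box z \<omega> j k) = (+) z ` frontier (grid_box 0 \<omega> j k)" for j k
    unfolding grid_box_shift[of z] by (rule frontier_translation)
  then show ?thesis
    by (intro set_eqI) (simp only: mem_grid[of _ z], auto simp: mem_grid image_iff, blast)
qed

lemma compact_grid: "compact (grid z \<omega> s1 s2)"
  unfolding grid_def
proof (rule compact_UN[OF finite_grid_boxes])
  fix b assume "b \<in> grid_boxes z \<omega> s1 s2"
  then obtain j k where "b = cbox (z + of_real \<omega> * Complex (real j) (real k)) (z + of_real \<omega> * Complex (real j + 1) (real k + 1))"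
    by (auto simp: grid_boxes_def grid_box_def)
  then show "compact (frontier b)" by (simp add: compact_frontier)
qed

lemma closed_det_root_in_compact:
  fixes K :: "complex set"
  assumes "compact K"
  shows "closed {p :: ((complex^'n^'n) \<times> (complex^'n^'n)) \<times> complex.
    \<exists>y\<in>K. det (pencil_at (fst (fst p)) (snd (fst p)) (snd p + y)) = 0}"
proof -
  let ?C = "{q :: (((complex^'n^'n) \<times> (complex^'n^'n)) \<times> complex) \<times> complex.
    det (pencil_at (fst (fst (fst q))) (snd (fst (fst q))) (snd (fst q) + snd q)) = 0}"
  have "closed ?C" by (intro closed_Collect_eq continuous_intros)
  from closed_ex_compact[OF this assms] show ?thesis by simp
qed

text \<open>Each clause of \<open>shattered_iff\<close>, after translation by the corner, is decided
  by projections along compact sets: the grid times the unit sphere, compact pieces outside the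
  boxes, and pairs of points of a box with a normalised vector.\<close>

lemma borel_shattered:
  assumes \<epsilon>: "0 \<le> \<epsilon>" and \<omega>: "0 < \<omega>"
  shows "{p :: ((complex^'n^'n) \<times> (complex^'n^'n)) \<times> complex.
    shattered \<epsilon> (fst (fst p)) (snd (fst p)) (snd p) \<omega> s1 s2} \<in> sets borel"
proof -
  let ?A = "\<lambda>p :: ((complex^'n^'n) \<times> (complex^'n^'n)) \<times> complex. fst (fst p)"
  let ?B = "\<lambda>p :: ((complex^'n^'n) \<times> (complex^'n^'n)) \<times> complex. snd (fst p)"
  define S1 where "S1 = {p. \<exists>k\<in>grid 0 \<omega> s1 s2 \<times> sphere 0 1.
    norm (pencil_at (?A p) (?B p) (snd p + fst k) *v snd k) \<le> \<epsilon> * (1 + cmod (snd p + fst k))}"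
  have S1: "closed S1"
  proof -
    let ?C = "{q :: (((complex^'n^'n) \<times> (complex^'n^'n)) \<times> complex) \<times> (complex \<times> (complex^'n)).
      norm (pencil_at (?A (fst q)) (?B (fst q)) (snd (fst q) + fst (snd q)) *v snd (snd q))
        \<le> \<epsilon> * (1 + cmod (snd (fst q) + fst (snd q)))}"
    have "closed ?C" by (intro closed_Collect_le continuous_intros)
    moreover have "compact (grid 0 \<omega> s1 s2 \<times> sphere (0 :: complex^'n) 1)"
      by (intro compact_Times compact_grid compact_sphere)
    ultimately have "closed {p. \<exists>k\<in>grid 0 \<omega> s1 s2 \<times> sphere 0 1. (p, k) \<in> ?C}" by (rule closed_ex_compact)
    then show ?thesis by (simp add: S1_def)
  qed
  have S1': "(\<forall>l\<in>grid z \<omega> s1 s2. pencil_at A B l \<notin> small_singular (\<epsilon> * (1 + cmod l))) \<longleftrightarrow> ((A, B), z) \<notin> S1" for A B z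
    unfolding S1_def small_singular_def grid_shift[of z] by auto
  define S2 where "S2 = {p. det (?B p) \<noteq> 0}"
  have S2: "open S2" unfolding S2_def by (intro open_Collect_neq continuous_intros)
  define U where "U = \<Union> (grid_boxes 0 \<omega> s1 s2)"
  have "closed U"
  proof -
    have "closed b" if "b \<in> grid_boxes 0 \<omega> s1 s2" for b
      using that by (auto simp: grid_boxes_def grid_box_def intro: closed_cbox)
    then show ?thesis unfolding U_def by (intro closed_Union finite_grid_boxes) auto
  qed
  \<comment> \<open>Roots outside all boxes range over a noncompact set, which is exhausted by
    countably many compact ones.\<close>
  then have "open (- U)" by (simp add: open_Compl)
  then obtain K :: "nat \<Rightarrow> complex set" where K: "\<And>m. compact (K m)" "\<Union> (range K) = - U"
    by (elim open_Union_compact_subsets) blast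
  define S3 where "S3 = (\<Union>m. {p. \<exists>y\<in>K m. det (pencil_at (?A p) (?B p) (snd p + y)) = 0})"
  have S3: "S3 \<in> sets borel" unfolding S3_def
    by (rule borel_Un_countable_closed[OF refl]) (rule closed_det_root_in_compact[OF K(1)])
  have U_shift: "(\<exists>b\<in>grid_boxes z \<omega> s1 s2. z + y \<in> b) \<longleftrightarrow> y \<in> U" for z y
  proof -
    have m: "z + y \<in> grid_box z \<omega> j k \<longleftrightarrow> y \<in> grid_box 0 \<omega> j k" for j k by (simp add: mem_grid_box)
    have "(\<exists>b\<in>grid_boxes z' \<omega> s1 s2. x \<in> b) \<longleftrightarrow> (\<exists>j k. j < s1 \<and> k < s2 \<and> x \<in> grid_box z' \<omega> j k)" for x z'
      unfolding grid_boxes_def by blast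
    then show ?thesis unfolding U_def Union_iff by (simp add: m)
  qed
  have S3': "(\<forall>l. det (pencil_at A B l) = 0 \<longrightarrow> (\<exists>b\<in>grid_boxes z \<omega> s1 s2. l \<in> b)) \<longleftrightarrow> ((A, B), z) \<notin> S3" for A B z
  proof -
    have "(\<forall>l. det (pencil_at A B l) = 0 \<longrightarrow> (\<exists>b\<in>grid_boxes z \<omega> s1 s2. l \<in> b))
      \<longleftrightarrow> (\<forall>y. det (pencil_at A B (z + y)) = 0 \<longrightarrow> y \<in> U)"
      unfolding U_shift[of z, symmetric] by (metis add_diff_cancel_left' diff_add_cancel add.commute)
    also have "\<dots> \<longleftrightarrow> (\<forall>y\<in>\<Union> (range K). det (pencil_at A B (z + y)) \<noteq> 0)" unfolding K(2) by blast
    also have "\<dots> \<longleftrightarrow> ((A, B), z) \<notin> S3" unfolding S3_def by auto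
    finally show ?thesis .
  qed
  \<comment> \<open>The normalisation in \<open>two_roots_iff\<close> confines the eigenvector to
    this polydisc.\<close>
  define V where "V = {v :: complex^'n. \<forall>k. cmod (v $ k) \<le> 1}"
  have V: "compact V"
  proof -
    have "V = (\<Inter>k. {v. cmod (v $ k) \<le> 1})" by (auto simp: V_def)
    moreover have "closed {v :: complex^'n. cmod (v $ k) \<le> 1}" for k by (intro closed_Collect_le continuous_intros)
    ultimately have "closed V" by auto
    moreover have "bounded V" using norm_le_sqrt_card unfolding V_def bounded_iff by blast
    ultimately show ?thesis by (simp add: compact_eq_bounded_closed)
  qed
  define S4 where "S4 b i = {p. \<exists>k\<in>b \<times> b \<times> V. snd (snd k) $ i = 1 \<and>
    pencil_at (?A p) (?B p) (snd p + fst k) *v snd (snd k) = 0 \<and>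
    det (set_column i (?B p *v snd (snd k)) (pencil_at (?A p) (?B p) (snd p + fst (snd k)))) = 0}" for b i
  have S4: "closed (S4 b i)" if "b \<in> grid_boxes 0 \<omega> s1 s2" for b i
  proof -
    let ?C = "{q :: (((complex^'n^'n) \<times> (complex^'n^'n)) \<times> complex) \<times> (complex \<times> complex \<times> (complex^'n)).
      snd (snd (snd q)) $ i = 1 \<and>
      pencil_at (?A (fst q)) (?B (fst q)) (snd (fst q) + fst (snd q)) *v snd (snd (snd q)) = 0 \<and>
      det (set_column i (?B (fst q) *v snd (snd (snd q))) (pencil_at (?A (fst q)) (?B (fst q)) (snd (fst q) + fst (snd (snd q))))) = 0}"
    have "closed ?C" by (intro closed_Collect_conj closed_Collect_eq continuous_intros)
    moreover have "compact b" using that by (auto simp: grid_boxes_def grid_box_def intro: compact_cbox)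
    then have "compact (b \<times> b \<times> V)" by (intro compact_Times V)
    ultimately have "closed {p. \<exists>k\<in>b \<times> b \<times> V. (p, k) \<in> ?C}" by (rule closed_ex_compact)
    then show ?thesis by (simp add: S4_def)
  qed
  have S4': "(\<forall>b\<in>grid_boxes z \<omega> s1 s2. \<forall>l1\<in>b. \<forall>l2\<in>b. \<not> [:- l1, 1:] * [:- l2, 1:] dvd pencil_poly A B)
    \<longleftrightarrow> ((A, B), z) \<notin> (\<Union>b\<in>grid_boxes 0 \<omega> s1 s2. \<Union>i. S4 b i)" for A B z
  proof -
    have G: "grid_boxes z \<omega> s1 s2 = (\<lambda>b. (+) z ` b) ` grid_boxes 0 \<omega> s1 s2"
      unfolding grid_boxes_def by (auto simp: grid_box_shift[of z])
    have "((A, B), z) \<in> S4 b i \<longleftrightarrow> (\<exists>y1\<in>b. \<exists>y2\<in>b. \<exists>v. v $ i = 1 \<and> (\<forall>k. cmod (v $ k) \<le> 1) \<and>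
      pencil_at A B (z + y1) *v v = 0 \<and> det (set_column i (B *v v) (pencil_at A B (z + y2))) = 0)" for b i
      unfolding S4_def V_def by (simp add: Bex_def mem_Times_iff) blast
    then show ?thesis unfolding G two_roots_iff by (simp add: Ball_def Bex_def) blast
  qed
  have "{p. shattered \<epsilon> (?A p) (?B p) (snd p) \<omega> s1 s2} = (- S1) \<inter> S2 \<inter> (- S3) \<inter> - (\<Union>b\<in>grid_boxes 0 \<omega> s1 s2. \<Union>i. S4 b i)"
  proof (intro set_eqI)
    fix p :: "((complex^'n^'n) \<times> (complex^'n^'n)) \<times> complex"
    obtain A B z where p: "p = ((A, B), z)" by (metis prod.collapse)
    show "p \<in> {p. shattered \<epsilon> (?A p) (?B p) (snd p) \<omega> s1 s2} \<longleftrightarrow>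
      p \<in> (- S1) \<inter> S2 \<inter> (- S3) \<inter> - (\<Union>b\<in>grid_boxes 0 \<omega> s1 s2. \<Union>i. S4 b i)"
      unfolding p mem_Collect_eq fst_conv snd_conv shattered_iff[OF \<epsilon> \<omega>] S1' S3' S4'
      by (simp add: S2_def)
  qed
  moreover have "(\<Union>b\<in>grid_boxes 0 \<omega> s1 s2. \<Union>i. S4 b i) \<in> sets borel"
    by (intro sets.finite_UN finite_grid_boxes) (auto simp: S4)
  moreover have "- S1 \<in> sets borel" "S2 \<in> sets borel" using S1 S2 by auto
  ultimately show ?thesis using S3 by (simp only: sets.Int borel_comp)
qed

section \<open>A sufficient condition for shattering\<close>

text \<open>Independent of the random shift, so that a union bound over it only involves the
  matrices. Its mesh \<omega> covers the square of points with both coordinates between -4 and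
  4.\<close>

definition box_lattice :: "real \<Rightarrow> complex set" where
  "box_lattice \<omega> = (\<lambda>(j, k). Complex (\<omega> * of_int j) (\<omega> * of_int k)) ` ({- \<lceil>4 / \<omega>\<rceil>..\<lceil>4 / \<omega>\<rceil>} \<times> {- \<lceil>4 / \<omega>\<rceil>..\<lceil>4 / \<omega>\<rceil>})"

lemma finite_box_lattice: "finite (box_lattice \<omega>)"
  by (simp add: box_lattice_def)

lemma card_box_lattice:
  assumes "0 < \<omega>" "\<omega> \<le> 1 / 3"
  shows "real (card (box_lattice \<omega>)) \<le> 81 / \<omega>\<^sup>2"
proof -
  let ?m = "\<lceil>4 / \<omega>\<rceil>"
  have "0 < 4 / \<omega>" using assms by simp
  then have m: "0 \<le> ?m" by linarith
  have "card (box_lattice \<omega>) \<le> card ({- ?m..?m} \<times> {- ?m..?m})"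
    unfolding box_lattice_def by (intro card_image_le) auto
  also have "\<dots> = nat (2 * ?m + 1) * nat (2 * ?m + 1)" by (simp add: card_cartesian_product algebra_simps)
  finally have "real (card (box_lattice \<omega>)) \<le> real (nat (2 * ?m + 1) * nat (2 * ?m + 1))" by (rule of_nat_mono)
  also have "\<dots> = (2 * real_of_int ?m + 1)\<^sup>2" using m by (simp add: power2_eq_square)
  \<comment> \<open>Rounding up gives at most 8/\<omega> + 3 points per row, and 3 is at most
    1/\<omega>.\<close>
  also have "\<dots> \<le> (9 / \<omega>)\<^sup>2"
  proof (rule power_mono)
    have "real_of_int ?m \<le> 4 / \<omega> + 1" by linarith
    moreover have "3 \<le> 1 / \<omega>" using assms by (simp add: field_simps)
    ultimately show "2 * real_of_int ?m + 1 \<le> 9 / \<omega>" by (simp add: field_simps)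
    show "0 \<le> 2 * real_of_int ?m + 1" using m by simp
  qed
  finally show ?thesis by (simp add: power_divide)
qed

lemma box_lattice_near:
  assumes \<omega>: "0 < \<omega>" and l: "\<bar>Re l\<bar> \<le> 4" "\<bar>Im l\<bar> \<le> 4"
  shows "\<exists>y\<in>box_lattice \<omega>. \<bar>Re l - Re y\<bar> \<le> \<omega> \<and> \<bar>Im l - Im y\<bar> \<le> \<omega>"
proof -
  have *: "\<lfloor>x / \<omega>\<rfloor> \<in> {- \<lceil>4 / \<omega>\<rceil>..\<lceil>4 / \<omega>\<rceil>}" "\<bar>x - \<omega> * of_int \<lfloor>x / \<omega>\<rfloor>\<bar> \<le> \<omega>" if x: "\<bar>x\<bar> \<le> 4" for x
  proof -
    have "- (4 / \<omega>) \<le> x / \<omega>" "x / \<omega> \<le> 4 / \<omega>" using x \<omega> by (auto simp: field_simps)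
    then show "\<lfloor>x / \<omega>\<rfloor> \<in> {- \<lceil>4 / \<omega>\<rceil>..\<lceil>4 / \<omega>\<rceil>}" by auto linarith+
    have "of_int \<lfloor>x / \<omega>\<rfloor> \<le> x / \<omega>" "x / \<omega> < of_int \<lfloor>x / \<omega>\<rfloor> + 1" by linarith+
    then have "\<omega> * of_int \<lfloor>x / \<omega>\<rfloor> \<le> \<omega> * (x / \<omega>)" "\<omega> * (x / \<omega>) < \<omega> * (of_int \<lfloor>x / \<omega>\<rfloor> + 1)"
      using \<omega> by (intro mult_left_mono mult_strict_left_mono; simp)+
    then have "\<omega> * of_int \<lfloor>x / \<omega>\<rfloor> \<le> x" "x < \<omega> * of_int \<lfloor>x / \<omega>\<rfloor> + \<omega>"
      using \<omega> by (simp_all add: distrib_left)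
    then show "\<bar>x - \<omega> * of_int \<lfloor>x / \<omega>\<rfloor>\<bar> \<le> \<omega>" by linarith
  qed
  have "Complex (\<omega> * of_int \<lfloor>Re l / \<omega>\<rfloor>) (\<omega> * of_int \<lfloor>Im l / \<omega>\<rfloor>) \<in> box_lattice \<omega>"
    unfolding box_lattice_def using *(1)[OF l(1)] *(1)[OF l(2)]
    by (intro image_eqI[where x = "(\<lfloor>Re l / \<omega>\<rfloor>, \<lfloor>Im l / \<omega>\<rfloor>)"]) auto
  then show ?thesis using *(2)[OF l(1)] *(2)[OF l(2)] by (intro bexI) auto
qed

text \<open>The shift moves the first line to -4 + 1/64 at most, still left of -3.84, and x - c
  stays below 8, so the index stays below the number of boxes.\<close>

lemma ex_strip:
  fixes x c \<omega> :: real
  assumes \<omega>: "0 < \<omega>" and "- 4 \<le> c" "c \<le> - 4 + \<omega>" "\<bar>x\<bar> \<le> 384 / 100" "\<omega> \<le> 1 / 64"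
  shows "\<exists>j<nat \<lceil>8 / \<omega>\<rceil>. c + \<omega> * real j \<le> x \<and> x \<le> c + \<omega> * (real j + 1)"
proof -
  define q where "q = (x - c) / \<omega>"
  have "0 \<le> x - c" "x - c < 8" using assms by linarith+
  then have q: "0 \<le> q" "q < 8 / \<omega>" using \<omega> by (auto simp: q_def divide_strict_right_mono)
  have xq: "x = c + \<omega> * q" using \<omega> by (simp add: q_def)
  let ?j = "nat \<lfloor>q\<rfloor>"
  have j: "real ?j \<le> q" "q \<le> real ?j + 1" using q by linarith+
  have "real ?j < 8 / \<omega>" using j q by linarith
  then have "?j < nat \<lceil>8 / \<omega>\<rceil>" by linarith
  moreover have "c + \<omega> * real ?j \<le> x" "x \<le> c + \<omega> * (real ?j + 1)"
    unfolding xq using j \<omega> by (auto intro!: mult_left_mono)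
  ultimately show ?thesis by blast
qed

lemma size_eq_card_set_mset:
  assumes "\<And>x. count M x \<le> 1"
  shows "size M = card (set_mset M)"
proof -
  have "count M x = 1" if "x \<in># M" for x using assms[of x] that count_greater_zero_iff[of M x] by linarith
  then show ?thesis by (simp add: size_multiset_overloaded_eq)
qed

text \<open>The deterministic core. \<open>gap\<close> rules out two eigenvalues in one box, hence
  also double ones, which supplies the eigenbasis for the partial fractions. \<open>res\<close>
  bounds the residues by \<rho> and \<open>sep\<close> the distance to the grid lines by D; a grid
  point in the pseudospectrum would then give D <= 10 n \<rho> \<epsilon>.\<close>

lemma shattered_good:
  fixes X B :: "complex^'n^'n"
  assumes \<omega>: "0 < \<omega>" "\<omega> \<le> 1 / 64" and \<epsilon>: "0 \<le> \<epsilon>" and \<rho>: "0 < \<rho>"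
    and z: "- 4 \<le> Re z" "Re z \<le> - 4 + \<omega>" "- 4 \<le> Im z" "Im z \<le> - 4 + \<omega>"
    and X: "\<And>u. norm (X *v u) \<le> 23 / 10 * norm u"
    and B: "\<And>u. 6 / 10 * norm u \<le> norm (B *v u)" "\<And>u. norm (B *v u) \<le> K * norm u"
    and D: "real CARD('n) * \<rho> * (10 * \<epsilon>) < D"
    and gap: "\<not> (\<exists>y\<in>box_lattice \<omega>. \<exists>i j. i \<noteq> j \<and> pencil_at X B y \<in> near_dependent (18 * \<omega>\<^sup>2 * K\<^sup>2 * real CARD('n)) i j)"
    and res: "\<not> (\<exists>y\<in>ball 0 4. \<exists>s0>0. \<forall>s. 0 < s \<and> s < s0 \<longrightarrow> cball y (\<rho> * s) \<subseteq> {y. pencil_at X B y \<in> small_singular s})"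
    and sep: "\<And>l j. det (pencil_at X B l) = 0 \<Longrightarrow> D \<le> \<bar>Re l - (Re z + \<omega> * real j)\<bar> \<and> D \<le> \<bar>Im l - (Im z + \<omega> * real j)\<bar>"
  shows "shattered \<epsilon> X B z \<omega> (nat \<lceil>8 / \<omega>\<rceil>) (nat \<lceil>8 / \<omega>\<rceil>)"
proof -
  let ?s = "nat \<lceil>8 / \<omega>\<rceil>" and ?n = "real CARD('n)" and ?p = "pencil_poly X B"
  have inj: "u = 0" if "B *v u = 0" for u using B(1)[of u] that by simp
  have det: "det B \<noteq> 0"
  proof
    assume "det B = 0"
    then obtain u where "norm u = 1" "B *v u = 0" using ex_kernel_vec[of B] by (auto simp: invertible_det_nz)
    then show False using inj by force
  qed
  \<comment> \<open>23/10 divided by 6/10 is 3.8333..., hence 3.84; both the disc of radius 4 and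
    the grid have room for it.\<close>
  have root: "cmod l \<le> 384 / 100" if l: "det (pencil_at X B l) = 0" for l
  proof -
    obtain u where u: "norm u = 1" "pencil_at X B l *v u = 0"
      using ex_kernel_vec[of "pencil_at X B l"] l by (auto simp: invertible_det_nz)
    then have "X *v u = l *s (B *v u)" by (simp add: pencil_at_mult)
    then have "cmod l * norm (B *v u) \<le> 23 / 10" using X[of u] u(1) norm_smult_cvec[of l "B *v u"] by simp
    moreover have "cmod l * (6 / 10) \<le> cmod l * norm (B *v u)" using B(1)[of u] u(1) by (intro mult_left_mono) auto
    ultimately show ?thesis by simp
  qed
  have C3: "\<exists>b\<in>grid_boxes z \<omega> ?s ?s. l \<in> b" if l: "det (pencil_at X B l) = 0" for l
  proof -
    have "\<bar>Re l\<bar> \<le> 384 / 100" "\<bar>Im l\<bar> \<le> 384 / 100"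
      using root[OF l] abs_Re_le_cmod[of l] abs_Im_le_cmod[of l] by linarith+
    then obtain j k where "j < ?s" "Re z + \<omega> * real j \<le> Re l \<and> Re l \<le> Re z + \<omega> * (real j + 1)"
      "k < ?s" "Im z + \<omega> * real k \<le> Im l \<and> Im l \<le> Im z + \<omega> * (real k + 1)"
      using ex_strip[OF \<omega>(1) z(1,2) _ \<omega>(2)] ex_strip[OF \<omega>(1) z(3,4) _ \<omega>(2)] by metis
    then have "l \<in> grid_box z \<omega> j k" "grid_box z \<omega> j k \<in> grid_boxes z \<omega> ?s ?s"
      by (auto simp: mem_grid_box grid_boxes_def)
    then show ?thesis by blast
  qed
  have C4: "\<not> [:- l1, 1:] * [:- l2, 1:] dvd ?p" if b: "b \<in> grid_boxes z \<omega> ?s ?s" "l1 \<in> b" "l2 \<in> b" for b l1 l2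
  proof
    assume dvd: "[:- l1, 1:] * [:- l2, 1:] dvd ?p"
    then have "[:- l1, 1:] dvd ?p" by (rule dvd_mult_left)
    then have "det (pencil_at X B l1) = 0" by (simp add: poly_eq_0_iff_dvd[symmetric] poly_pencil_poly)
    from root[OF this] have "\<bar>Re l1\<bar> \<le> 4" "\<bar>Im l1\<bar> \<le> 4"
      using abs_Re_le_cmod[of l1] abs_Im_le_cmod[of l1] by linarith+
    from box_lattice_near[OF \<omega>(1) this] obtain y where y: "y \<in> box_lattice \<omega>" "\<bar>Re l1 - Re y\<bar> \<le> \<omega>" "\<bar>Im l1 - Im y\<bar> \<le> \<omega>" by blast
    obtain j k where "b = grid_box z \<omega> j k" using b(1) by (auto simp: grid_boxes_def)
    then have "\<bar>Re l2 - Re l1\<bar> \<le> \<omega>" "\<bar>Im l2 - Im l1\<bar> \<le> \<omega>"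
      using b(2,3) by (auto simp: mem_grid_box algebra_simps)
    then have "\<bar>Re l2 - Re y\<bar> \<le> 2 * \<omega>" "\<bar>Im l2 - Im y\<bar> \<le> 2 * \<omega>" using y by linarith+
    \<comment> \<open>The lattice point is within \<omega> of l1 in each coordinate, hence within
      2\<omega> of l2, and the square root of 8 is below 3. This gives the constant 18 = 2 *
      3^2.\<close>
    moreover have close: "cmod (l - y) \<le> 3 * \<omega>" if "\<bar>Re l - Re y\<bar> \<le> 2 * \<omega>" "\<bar>Im l - Im y\<bar> \<le> 2 * \<omega>" for l
    proof -
      have "(Re l - Re y)\<^sup>2 \<le> (2 * \<omega>)\<^sup>2" "(Im l - Im y)\<^sup>2 \<le> (2 * \<omega>)\<^sup>2"
        using that by (metis abs_ge_zero power2_abs power_mono)+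
      then have "(cmod (l - y))\<^sup>2 \<le> 8 * \<omega>\<^sup>2" by (simp add: cmod_power2 power_mult_distrib)
      also have "\<dots> \<le> (3 * \<omega>)\<^sup>2" by (simp add: power_mult_distrib)
      finally show ?thesis by (rule power2_le_imp_le) (use \<omega> in simp)
    qed
    ultimately have "cmod (l2 - y) \<le> 3 * \<omega>" by blast
    moreover have "cmod (l1 - y) \<le> 3 * \<omega>" using y \<omega> by (intro close) linarith+
    ultimately have "\<exists>i j. i \<noteq> j \<and> pencil_at X B y \<in> near_dependent (2 * (3 * \<omega>)\<^sup>2 * K\<^sup>2 * ?n) i j"
      using B(2) inj by (intro near_dependent_of_two_roots[OF dvd]) auto
    moreover have "2 * (3 * \<omega>)\<^sup>2 * K\<^sup>2 * ?n = 18 * \<omega>\<^sup>2 * K\<^sup>2 * ?n" by (simp add: power_mult_distrib)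
    ultimately show False using gap y(1) by metis
  qed
  have p: "?p \<noteq> 0" "degree ?p = CARD('n)"
  proof -
    have "coeff ?p CARD('n) \<noteq> 0" using det by (simp add: degree_pencil_poly det_uminus_eq_0)
    then show "?p \<noteq> 0" "degree ?p = CARD('n)"
      using degree_pencil_poly(1)[of X B] le_degree by (auto intro: antisym)
  qed
  \<comment> \<open>A double eigenvalue would be a pair inside its own box.\<close>
  have simple: "count (proots ?p) l \<le> 1" for l
  proof (rule ccontr)
    assume "\<not> count (proots ?p) l \<le> 1"
    then have 2: "2 \<le> count (proots ?p) l" by simp
    then have "{#l, l#} \<subseteq># proots ?p" by (auto simp: subseteq_mset_def)
    then have "[:- l, 1:] * [:- l, 1:] dvd ?p" by (simp only: pair_in_proots_iff[OF p(1)])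
    moreover have "l \<in># proots ?p" using 2 by (simp add: count_inI)
    then have "det (pencil_at X B l) = 0" using p(1) by (simp add: poly_pencil_poly)
    ultimately show False using C3 C4 by blast
  qed
  have "size (proots ?p) = card (set_mset (proots ?p))" by (rule size_eq_card_set_mset[OF simple])
  then have card: "card (set_mset (proots ?p)) = CARD('n)" using size_proots_complex[of ?p] p(2) by simp
  then obtain l where l: "bij_betw l (UNIV :: 'n set) (set_mset (proots ?p))"
    using finite_same_card_bij[of "UNIV :: 'n set" "set_mset (proots ?p)"] by auto
  have l_root: "det (pencil_at X B (l i)) = 0" for i
    using bij_betwE[OF l] p(1) by (simp add: poly_pencil_poly)
  have "\<forall>i. \<exists>v. v \<noteq> 0 \<and> pencil_at X B (l i) *v v = 0"
  proof
    fix i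
    obtain u where "norm u = 1" "pencil_at X B (l i) *v u = 0"
      using ex_kernel_vec[of "pencil_at X B (l i)"] l_root by (auto simp: invertible_det_nz)
    then show "\<exists>v. v \<noteq> 0 \<and> pencil_at X B (l i) *v v = 0" by (intro exI[of _ u]) auto
  qed
  then obtain v where v: "\<And>i. v i \<noteq> 0" "\<And>i. pencil_at X B (l i) *v v i = 0" by metis
  have C1: "pencil_at X B y \<notin> small_singular (\<epsilon> * (1 + cmod y))" if y: "y \<in> grid z \<omega> ?s ?s" for y
  proof
    assume "pencil_at X B y \<in> small_singular (\<epsilon> * (1 + cmod y))"
    then obtain u where u: "norm u = 1" "norm (pencil_at X B y *v u) \<le> \<epsilon> * (1 + cmod y)" by (auto simp: small_singular_def)
    obtain j k where jk: "j < ?s" "k < ?s" "y \<in> frontier (grid_box z \<omega> j k)" using y by (auto simp: mem_grid)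
    have box: "Re z + \<omega> * real j \<le> Re y" "Re y \<le> Re z + \<omega> * (real j + 1)"
      "Im z + \<omega> * real k \<le> Im y" "Im y \<le> Im z + \<omega> * (real k + 1)"
      using jk(3) by (auto simp: frontier_grid_box[OF \<omega>(1)] mem_grid_box)
    have line: "(\<exists>m::nat. Re y = Re z + \<omega> * real m) \<or> (\<exists>m::nat. Im y = Im z + \<omega> * real m)"
    proof -
      have "Re y = Re z + \<omega> * real j \<or> Re y = Re z + \<omega> * real (Suc j) \<or> Im y = Im z + \<omega> * real k \<or> Im y = Im z + \<omega> * real (Suc k)"
        using jk(3) box by (auto simp: frontier_grid_box[OF \<omega>(1)] not_less algebra_simps)
      then show ?thesis by blast
    qed
    \<comment> \<open>A row has at most 8/\<omega> + 1 boxes, so coordinates on the grid are at most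
      4 + 2\<omega>, below 4.5, and 1 + cmod y is at most 10. This is the factor 10 in front of
      \<epsilon>.\<close>
    have top: "\<omega> * (real m + 1) \<le> 8 + \<omega>" if "m < ?s" for m
    proof -
      have "real m + 1 \<le> real ?s" using that by linarith
      also have "\<dots> \<le> 8 / \<omega> + 1" using \<omega> by (simp add: le_of_int_ceiling ceiling_correct less_imp_le)
      finally have "\<omega> * (real m + 1) \<le> \<omega> * (8 / \<omega> + 1)" using \<omega> by (intro mult_left_mono) auto
      then show ?thesis using \<omega> by (simp add: algebra_simps)
    qed
    have "0 \<le> \<omega> * real j" "0 \<le> \<omega> * real k" using \<omega> by auto
    then have "\<bar>Re y\<bar> \<le> 45 / 10" "\<bar>Im y\<bar> \<le> 45 / 10"
      using box z \<omega> top[OF jk(1)] top[OF jk(2)] by linarith+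
    then have "1 + cmod y \<le> 10" using cmod_le[of y] by linarith
    then have "norm (pencil_at X B y *v u) \<le> 10 * \<epsilon>"
      using u(2) mult_left_mono[OF _ \<epsilon>, of "1 + cmod y" 10] by linarith
    then have "?n * \<rho> * norm (pencil_at X B y *v u) \<le> ?n * \<rho> * (10 * \<epsilon>)"
      using \<rho> by (intro mult_left_mono) auto
    moreover have "D * norm u \<le> ?n * \<rho> * norm (pencil_at X B y *v u)"
    proof (rule resolvent_bound[OF inj _ v \<rho>])
      show "inj l" using l by (simp add: bij_betw_def)
      show "D \<le> cmod (l i - y)" for i
      proof -
        have "D \<le> \<bar>Re (l i) - Re y\<bar> \<or> D \<le> \<bar>Im (l i) - Im y\<bar>" using line sep[OF l_root[of i]] by fastforce
        then show ?thesis using abs_Re_le_cmod[of "l i - y"] abs_Im_le_cmod[of "l i - y"] by (auto intro: order_trans)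
      qed
      have "0 \<le> ?n * \<rho> * (10 * \<epsilon>)" using \<rho> \<epsilon> by simp
      then show "0 \<le> D" using D by linarith
      fix i and s0 :: real assume "0 < s0"
      have "l i \<in> ball 0 4" using root[OF l_root[of i]] by simp
      then show "\<exists>s. 0 < s \<and> s < s0 \<and> \<not> cball (l i) (\<rho> * s) \<subseteq> {z. pencil_at X B z \<in> small_singular s}"
        using res \<open>0 < s0\<close> by blast
    qed
    ultimately show False using D unfolding u(1) mult_1_right by linarith
  qed
  show ?thesis unfolding shattered_iff[OF \<epsilon> \<omega>(1)] using C1 det C3 C4 by blast
qed

section \<open>Random shifts of the grid\<close>

lemma emeasure_strip:
  assumes "0 < D"
  shows "emeasure lborel (cbox (Complex (c - D) a) (Complex (c + D) (a + w))) \<le> ennreal (2 * D * w)"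
    and "emeasure lborel (cbox (Complex a (c - D)) (Complex (a + w) (c + D))) \<le> ennreal (2 * D * w)"
  using assms by (auto simp: emeasure_lborel_cbox_eq Basis_complex_def mult_ac)

text \<open>Modulo \<open>\<omega>\<close> there are at most three grid lines that can come close to a given point.\<close>
lemma close_line:
  fixes x c \<omega> D :: real and j :: nat
  assumes "0 < D" "D \<le> \<omega>" "- 4 \<le> c" "c \<le> - 4 + \<omega>" "\<bar>x - (c + \<omega> * real j)\<bar> < D"
  shows "\<exists>k\<in>{\<lfloor>(x + 4) / \<omega>\<rfloor> - 1..\<lfloor>(x + 4) / \<omega>\<rfloor> + 1}. \<bar>c - (x - \<omega> * of_int k)\<bar> \<le> D"
proof
  let ?q = "(x + 4) / \<omega>"
  have \<omega>: "0 < \<omega>" using assms by linarith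
  have "\<omega> * real j < x + 4 + \<omega>" "x + 4 - 2 * \<omega> < \<omega> * real j" using assms by linarith+
  then have "real j < ?q + 1" "?q - 2 < real j" using \<omega> by (simp_all add: field_simps)
  then have "real_of_int (int j) < ?q + 1" "?q - 2 < real_of_int (int j)" by simp_all
  then show "int j \<in> {\<lfloor>?q\<rfloor> - 1..\<lfloor>?q\<rfloor> + 1}" by auto linarith+
  show "\<bar>c - (x - \<omega> * of_int (int j))\<bar> \<le> D" using assms by simp
qed

text \<open>Each point excludes three vertical and three horizontal strips of width 2D for the
  corner, of total area at most 12 D \<omega>, out of the area \<omega>^2 of the square.\<close>

lemma emeasure_close_to_lines:
  fixes L :: "complex set"
  assumes L: "finite L" and D: "0 < D" "D \<le> \<omega>"
  defines "Q \<equiv> cbox (Complex (- 4) (- 4)) (Complex (- 4 + \<omega>) (- 4 + \<omega>))"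
  shows "\<exists>W\<in>sets borel. emeasure (uniform_measure lborel Q) W \<le> ennreal (12 * real (card L) * D / \<omega>) \<and>
    {z\<in>Q. \<exists>l\<in>L. \<exists>j::nat. \<bar>Re l - (Re z + \<omega> * real j)\<bar> < D \<or> \<bar>Im l - (Im z + \<omega> * real j)\<bar> < D} \<subseteq> W"
proof -
  have \<omega>: "0 < \<omega>" using D by linarith
  let ?I = "\<lambda>x. {\<lfloor>(x + 4) / \<omega>\<rfloor> - 1..\<lfloor>(x + 4) / \<omega>\<rfloor> + 1}"
  define V where "V l k = cbox (Complex (Re l - \<omega> * of_int k - D) (- 4)) (Complex (Re l - \<omega> * of_int k + D) (- 4 + \<omega>))" for l k
  define H where "H l k = cbox (Complex (- 4) (Im l - \<omega> * of_int k - D)) (Complex (- 4 + \<omega>) (Im l - \<omega> * of_int k + D))" for l k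
  define W where "W = (\<Union>l\<in>L. (\<Union>k\<in>?I (Re l). V l k) \<union> (\<Union>k\<in>?I (Im l). H l k))"
  have VH: "V l k \<in> sets borel" "H l k \<in> sets borel" for l k by (auto simp: V_def H_def)
  have W: "W \<in> sets borel" unfolding W_def using L VH by auto
  have VHe: "emeasure lborel (V l k) \<le> ennreal (2 * D * \<omega>)" "emeasure lborel (H l k) \<le> ennreal (2 * D * \<omega>)" for l k
    unfolding V_def H_def by (intro emeasure_strip D)+
  have three: "emeasure lborel (\<Union>k\<in>?I x. F k) \<le> ennreal (6 * D * \<omega>)"
    if F: "\<And>k. F k \<in> sets borel" "\<And>k. emeasure lborel (F k) \<le> ennreal (2 * D * \<omega>)" for F :: "int \<Rightarrow> complex set" and x
  proof -
    have "emeasure lborel (\<Union>k\<in>?I x. F k) \<le> (\<Sum>k\<in>?I x. emeasure lborel (F k))"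
      using F by (intro emeasure_subadditive_finite) auto
    also have "\<dots> \<le> (\<Sum>k\<in>?I x. ennreal (2 * D * \<omega>))" by (intro sum_mono F)
    also have "\<dots> = ennreal (6 * D * \<omega>)"
    proof -
      have "of_nat 3 * ennreal (2 * D * \<omega>) = ennreal (real 3 * (2 * D * \<omega>))"
        unfolding ennreal_of_nat_eq_real_of_nat by (rule ennreal_mult'[symmetric]) simp
      then show ?thesis by (simp add: mult.assoc)
    qed
    finally show ?thesis .
  qed
  have "emeasure lborel W \<le> (\<Sum>l\<in>L. emeasure lborel ((\<Union>k\<in>?I (Re l). V l k) \<union> (\<Union>k\<in>?I (Im l). H l k)))"
    unfolding W_def using L VH by (intro emeasure_subadditive_finite) auto
  also have "\<dots> \<le> (\<Sum>l\<in>L. ennreal (12 * D * \<omega>))"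
  proof (rule sum_mono)
    fix l
    have "emeasure lborel ((\<Union>k\<in>?I (Re l). V l k) \<union> (\<Union>k\<in>?I (Im l). H l k))
      \<le> emeasure lborel (\<Union>k\<in>?I (Re l). V l k) + emeasure lborel (\<Union>k\<in>?I (Im l). H l k)"
      using VH by (intro emeasure_subadditive) auto
    also have "\<dots> \<le> ennreal (6 * D * \<omega>) + ennreal (6 * D * \<omega>)"
      using VH VHe by (intro add_mono three)
    also have "\<dots> = ennreal (12 * D * \<omega>)" using D \<omega> by (subst ennreal_plus[symmetric]) auto
    finally show "emeasure lborel ((\<Union>k\<in>?I (Re l). V l k) \<union> (\<Union>k\<in>?I (Im l). H l k)) \<le> ennreal (12 * D * \<omega>)" .
  qed
  also have "\<dots> = ennreal (real (card L) * (12 * D * \<omega>))"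
    unfolding sum_constant ennreal_of_nat_eq_real_of_nat by (rule ennreal_mult'[symmetric]) simp
  finally have We: "emeasure lborel W \<le> ennreal (real (card L) * (12 * D * \<omega>))" .
  have Qe: "emeasure lborel Q = ennreal (\<omega>\<^sup>2)"
    using \<omega> by (simp add: Q_def emeasure_lborel_cbox_eq Basis_complex_def power2_eq_square)
  have "emeasure (uniform_measure lborel Q) W = emeasure lborel (Q \<inter> W) / emeasure lborel Q"
    using W by (intro emeasure_uniform_measure) (auto simp: Q_def)
  also have "\<dots> \<le> ennreal (real (card L) * (12 * D * \<omega>)) / ennreal (\<omega>\<^sup>2)"
    unfolding Qe using We W by (intro divide_right_mono_ennreal order_trans[OF emeasure_mono We]) auto
  also have "\<dots> = ennreal (12 * real (card L) * D / \<omega>)"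
    using D \<omega> by (subst divide_ennreal) (auto simp: power2_eq_square)
  finally have "emeasure (uniform_measure lborel Q) W \<le> ennreal (12 * real (card L) * D / \<omega>)" .
  moreover have "{z\<in>Q. \<exists>l\<in>L. \<exists>j::nat. \<bar>Re l - (Re z + \<omega> * real j)\<bar> < D \<or> \<bar>Im l - (Im z + \<omega> * real j)\<bar> < D} \<subseteq> W"
  proof safe
    fix z l and j :: nat
    assume zQ: "z \<in> Q" and l: "l \<in> L"
    have z: "- 4 \<le> Re z" "Re z \<le> - 4 + \<omega>" "- 4 \<le> Im z" "Im z \<le> - 4 + \<omega>"
      using zQ by (auto simp: Q_def in_cbox_complex_iff)
    {
      assume "\<bar>Re l - (Re z + \<omega> * real j)\<bar> < D"
      from close_line[OF D z(1,2) this] obtain k where "k \<in> ?I (Re l)" "\<bar>Re z - (Re l - \<omega> * of_int k)\<bar> \<le> D" by blast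
      then show "z \<in> W" unfolding W_def using l z
        by (intro UN_I[OF l] UnI1 UN_I[of k]) (auto simp: V_def in_cbox_complex_iff abs_le_iff)
    next
      assume "\<bar>Im l - (Im z + \<omega> * real j)\<bar> < D"
      from close_line[OF D z(3,4) this] obtain k where "k \<in> ?I (Im l)" "\<bar>Im z - (Im l - \<omega> * of_int k)\<bar> \<le> D" by blast
      then show "z \<in> W" unfolding W_def using l z
        by (intro UN_I[OF l] UnI2 UN_I[of k]) (auto simp: H_def in_cbox_complex_iff abs_le_iff)
    }
  qed
  ultimately show ?thesis using W by blast
qed

section \<open>Exceptional events\<close>

lemma norm_mult_vec_le_of_unit:
  fixes M :: "complex^'n^'n"
  assumes "\<And>p. norm p = 1 \<Longrightarrow> norm (M *v p) \<le> s"
  shows "norm (M *v u) \<le> s * norm u"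
proof (cases "u = 0")
  case False
  then have "norm (M *v ((1 / norm u) *\<^sub>R u)) \<le> s" by (intro assms) simp
  then show ?thesis using False by (simp add: mult_vec_scaleR field_simps)
qed simp

lemma norm_perturbed_mult_vec:
  fixes A g :: "complex^'n^'n"
  assumes "spectral_norm A \<le> 1" "0 < \<gamma>" "\<gamma> < 1 / 2"
    and "\<not> (\<exists>p. norm p = 1 \<and> 26 / 10 < norm (g *v p))"
  shows "norm ((A + \<gamma> *\<^sub>R g) *v u) \<le> 23 / 10 * norm u"
proof -
  have g: "norm (g *v u) \<le> 26 / 10 * norm u"
    by (rule norm_mult_vec_le_of_unit) (use assms(4) in \<open>auto simp: not_less\<close>)
  have "(A + \<gamma> *\<^sub>R g) *v u = A *v u + \<gamma> *\<^sub>R (g *v u)"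
    by (simp add: matrix_vector_mult_add_rdistrib linear_cmul[OF linear_mult_matrix])
  then have "norm ((A + \<gamma> *\<^sub>R g) *v u) \<le> norm (A *v u) + \<gamma> * norm (g *v u)"
    using norm_triangle_ineq[of "A *v u" "\<gamma> *\<^sub>R (g *v u)"] assms(2) by simp
  also have "\<dots> \<le> 1 * norm u + (1 / 2) * (26 / 10 * norm u)"
    using assms g by (intro add_mono mult_mono) (auto simp: spectral_norm_le)
  finally show ?thesis by simp
qed

lemma exp_minus_le_inverse_square:
  fixes n :: real
  assumes "83 \<le> n"
  shows "exp (- n) \<le> 2 / n\<^sup>2"
proof -
  have "1 + n + n\<^sup>2 / 2 \<le> exp n" using assms by (intro exp_lower_Taylor_quadratic) simp
  then have "n\<^sup>2 / 2 \<le> exp n" using assms by linarith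
  then have "inverse (exp n) \<le> inverse (n\<^sup>2 / 2)" using assms by (intro le_imp_inverse_le) auto
  then show ?thesis by (simp add: exp_minus)
qed

text \<open>The exponents are matched to two requirements. With \<rho> = 3/2 n^(1+\<alpha>) /
  \<gamma> and D = \<omega>/n^2, the fourth claim is the comparison that keeps the pseudospectrum
  off the grid; the fifth controls the union bound over the lattice.\<close>

lemma parameter_bounds:
  fixes n \<gamma> \<alpha> \<omega> \<epsilon> :: real
  assumes n: "83 \<le> n" and \<gamma>: "0 < \<gamma>" "\<gamma> < 1 / 2" and \<alpha>: "1 < \<alpha>"
    and \<omega>: "\<omega> = \<gamma> ^ 4 / 4 * n powr (- ((8 * \<alpha> + 13) / 3))"
    and \<epsilon>: "\<epsilon> = \<gamma> ^ 5 / (64 * n powr ((11 * \<alpha> + 25) / 3) + \<gamma> ^ 5)"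
  shows "0 < \<omega>" "\<omega> \<le> 1 / 64" "0 < \<epsilon>"
    and "n * (3 / 2 * n * n powr \<alpha> / \<gamma>) * (10 * \<epsilon>) < \<omega> / n\<^sup>2"
    and "\<omega>\<^sup>2 * (n powr \<alpha>) ^ 4 * n ^ 6 / \<gamma> ^ 4 \<le> 1 / (256 * n ^ 4)"
proof -
  define a where "a = n powr \<alpha>"
  define P where "P = n powr ((11 * \<alpha> + 25) / 3)"
  define Q where "Q = n powr (- ((8 * \<alpha> + 13) / 3))"
  have pos: "0 < a" "0 < P" "0 < Q" "0 < \<gamma> ^ 4" "0 < \<gamma> ^ 5" using n \<gamma> by (auto simp: a_def P_def Q_def)
  have \<omega>': "\<omega> = \<gamma> ^ 4 / 4 * Q" and \<epsilon>': "\<epsilon> = \<gamma> ^ 5 / (64 * P + \<gamma> ^ 5)" by (simp_all add: \<omega> \<epsilon> P_def Q_def)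
  show "0 < \<omega>" "0 < \<epsilon>" using pos by (auto simp: \<omega>' \<epsilon>' add_pos_pos)
  have g4: "\<gamma> ^ 4 \<le> 1 / 16"
    using power_mono[of \<gamma> "1 / 2" 4] \<gamma> by (simp add: power_divide)
  have "Q \<le> n powr 0" unfolding Q_def using n \<alpha> by (intro powr_mono) auto
  then have "Q \<le> 1" using n by simp
  then have "\<omega> \<le> (1 / 16) / 4 * 1" unfolding \<omega>' using g4 pos by (intro mult_mono divide_right_mono) auto
  then show "\<omega> \<le> 1 / 64" by simp
  have pw: "n ^ k = n powr real k" for k using n by (simp add: powr_realpow)
  \<comment> \<open>The exponents differ by \<alpha> + 4: n \<rho> supplies a n^2 and D another
    n^2.\<close>
  have PQ: "P * Q = a * n ^ 4"
    unfolding P_def Q_def a_def pw powr_add[symmetric]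
    by (rule arg_cong[where f = "\<lambda>x. n powr x"]) (simp add: field_simps)
  have eps: "\<epsilon> < \<gamma> ^ 5 / (64 * P)" unfolding \<epsilon>' using pos
    by (intro divide_strict_left_mono mult_pos_pos add_pos_pos) auto
  have "15 * (a * n ^ 4) * \<epsilon> < 15 * (a * n ^ 4) * (\<gamma> ^ 5 / (64 * P))"
    using eps pos n by (intro mult_strict_left_mono) auto
  also have "\<dots> = 15 / 64 * \<gamma> ^ 5 * Q" unfolding PQ[symmetric] using pos by simp
  \<comment> \<open>15 is 10 from the size of the grid times 3/2 from \<rho>, and 15/64 is just
    below the 1/4 in \<omega>.\<close>
  also have "\<dots> \<le> 1 / 4 * \<gamma> ^ 5 * Q" using pos by (intro mult_right_mono) auto
  also have "\<dots> = \<omega> * \<gamma>" by (simp add: \<omega>' power_numeral_reduce)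
  finally have key: "15 * (a * n ^ 4) * \<epsilon> < \<omega> * \<gamma>" .
  have n0: "0 < n" using n by simp
  have "n * (3 / 2 * n * a / \<gamma>) * (10 * \<epsilon>) = 15 * (a * n ^ 4) * \<epsilon> / (\<gamma> * n\<^sup>2)"
    using n0 \<gamma> by (simp add: field_simps power_numeral_reduce)
  also have "\<dots> < \<omega> * \<gamma> / (\<gamma> * n\<^sup>2)" using key n0 \<gamma> by (intro divide_strict_right_mono) auto
  also have "\<dots> = \<omega> / n\<^sup>2" using \<gamma> by simp
  finally show "n * (3 / 2 * n * n powr \<alpha> / \<gamma>) * (10 * \<epsilon>) < \<omega> / n\<^sup>2" by (simp add: a_def)
  \<comment> \<open>The exponent is (4 - 4\<alpha>)/3, which is negative because \<alpha> >
    1.\<close>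
  have Q2: "Q\<^sup>2 * a ^ 4 * n ^ 10 \<le> 1"
  proof -
    have q2: "Q\<^sup>2 = n powr (2 * (- ((8 * \<alpha> + 13) / 3)))" unfolding Q_def using n0 by (simp add: power2_eq_square flip: powr_add)
    have a4: "a ^ 4 = n powr (4 * \<alpha>)" unfolding a_def using n0 by (simp add: powr_powr[symmetric] powr_realpow[symmetric] mult.commute flip: powr_numeral)
    have "Q\<^sup>2 * a ^ 4 * n ^ 10 = n powr (2 * (- ((8 * \<alpha> + 13) / 3)) + 4 * \<alpha> + 10)"
      unfolding q2 a4 powr_add using pw[of 10] by (simp only: of_nat_numeral)
    also have "\<dots> \<le> n powr 0"
      using n \<alpha> by (intro powr_mono) (simp_all add: field_simps)
    finally show ?thesis using n0 by simp
  qed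
  have "\<omega>\<^sup>2 * a ^ 4 * n ^ 6 / \<gamma> ^ 4 = \<gamma> ^ 4 / 16 * (Q\<^sup>2 * a ^ 4 * n ^ 10) / n ^ 4"
    using n0 \<gamma> by (simp add: \<omega>' field_simps power_numeral_reduce)
  also have "\<dots> \<le> (1 / 16) / 16 * 1 / n ^ 4"
    using Q2 g4 pos n0 by (intro divide_right_mono mult_mono) auto
  finally show "\<omega>\<^sup>2 * (n powr \<alpha>) ^ 4 * n ^ 6 / \<gamma> ^ 4 \<le> 1 / (256 * n ^ 4)" by (simp add: a_def)
qed


lemma exceptional_set:
  fixes A B :: "complex^'n^'n" and \<gamma> \<alpha> \<omega> a :: real
  defines "n \<equiv> real CARD('n)"
  assumes n: "83 \<le> n" and \<gamma>: "0 < \<gamma>" and a: "n \<le> a" and \<omega>: "0 < \<omega>" "\<omega> \<le> 1 / 64"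
    and bound: "\<omega>\<^sup>2 * a ^ 4 * n ^ 6 / \<gamma> ^ 4 \<le> 1 / (256 * n ^ 4)"
  shows "\<exists>S\<in>sets borel. emeasure (gauss n) S \<le> ennreal (1 / n) \<and> (\<forall>g. g \<notin> S \<longrightarrow>
    \<not> (\<exists>p. norm p = 1 \<and> 26 / 10 < norm (g *v p)) \<and>
    \<not> (\<exists>y\<in>box_lattice \<omega>. \<exists>i j. i \<noteq> j \<and>
        pencil_at (A + \<gamma> *\<^sub>R g) B y \<in> near_dependent (18 * \<omega>\<^sup>2 * (23 / 10 * a)\<^sup>2 * n) i j) \<and>
    \<not> (\<exists>y\<in>ball 0 4. \<exists>s0>0. \<forall>s. 0 < s \<and> s < s0 \<longrightarrow>
        cball y (3 / 2 * n * a / \<gamma> * s) \<subseteq> {y. pencil_at (A + \<gamma> *\<^sub>R g) B y \<in> small_singular s}))"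
proof -
  have n0: "0 < n" "0 < a" using n a by linarith+
  define \<rho> where "\<rho> = 3 / 2 * n * a / \<gamma>"
  have \<rho>: "0 < \<rho>" using n0 \<gamma> by (simp add: \<rho>_def)
  define t where "t = 18 * \<omega>\<^sup>2 * (23 / 10 * a)\<^sup>2 * n"
  have t: "0 < t" using n0 \<omega> by (simp add: t_def)
  define S1 where "S1 = {g :: complex^'n^'n. \<exists>p. norm p = 1 \<and> 26 / 10 < norm (g *v p)}"
  define S2 where "S2 = {g. \<exists>z\<in>box_lattice \<omega>. \<exists>i j. i \<noteq> j \<and> pencil_at (A + \<gamma> *\<^sub>R g) B z \<in> near_dependent t i j}"
  have S1: "S1 \<in> sets borel" unfolding S1_def using open_large_norm by (intro borel_open)
  have S2: "S2 \<in> sets borel" unfolding S2_def by (intro emeasure_close_roots(1) \<gamma> t finite_box_lattice)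
  obtain S3 where S3: "S3 \<in> sets borel"
    "{g. \<exists>z\<in>ball 0 4. \<exists>s0>0. \<forall>s. 0 < s \<and> s < s0 \<longrightarrow>
      cball z (\<rho> * s) \<subseteq> {y. pencil_at (A + \<gamma> *\<^sub>R g) B y \<in> small_singular s}} \<subseteq> S3"
    "emeasure (gauss n) S3 \<le> ennreal (16 * exp 1 * (n * (n + 1)) / (\<gamma>\<^sup>2 * \<rho>\<^sup>2))"
    using emeasure_large_residue[OF \<gamma> \<rho>, of A B] unfolding n_def by blast
  have e1: "emeasure (gauss n) S1 \<le> ennreal (1 / 10 / n)"
  proof -
    have "emeasure (gauss n) S1 \<le> ennreal (exp (- n))" unfolding S1_def n_def by (rule emeasure_gauss_norm)
    also have "\<dots> \<le> ennreal (1 / 10 / n)"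
    proof (rule ennreal_leI)
      have "exp (- n) \<le> 2 / n\<^sup>2" by (rule exp_minus_le_inverse_square[OF n])
      also have "\<dots> \<le> 1 / 10 / n" using n by (simp add: field_simps power2_eq_square)
      finally show "exp (- n) \<le> 1 / 10 / n" .
    qed
    finally show ?thesis .
  qed
  have e2: "emeasure (gauss n) S2 \<le> ennreal (1 / 10 / n)"
  proof -
    have "emeasure (gauss n) S2 \<le> ennreal (6 * real (card (box_lattice \<omega>)) * n ^ 4 * t\<^sup>2 / \<gamma> ^ 4)"
      unfolding S2_def n_def by (intro emeasure_close_roots(2) \<gamma> t finite_box_lattice)
    also have "\<dots> \<le> ennreal (1 / 10 / n)"
    proof (rule ennreal_leI)
      have "6 * real (card (box_lattice \<omega>)) * n ^ 4 * t\<^sup>2 / \<gamma> ^ 4 \<le> 6 * (81 / \<omega>\<^sup>2) * n ^ 4 * t\<^sup>2 / \<gamma> ^ 4"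
        using card_box_lattice[of \<omega>] \<omega> n0 by (intro divide_right_mono mult_right_mono mult_left_mono) auto
      also have "\<dots> = 6 * 81 * (18 * 529 / 100)\<^sup>2 * (\<omega>\<^sup>2 * a ^ 4 * n ^ 6 / \<gamma> ^ 4)"
        using \<omega> \<gamma> by (simp add: t_def power_mult_distrib field_simps power_numeral_reduce)
      also have "\<dots> \<le> 6 * 81 * (18 * 529 / 100)\<^sup>2 * (1 / (256 * n ^ 4))" by (intro mult_left_mono bound) simp
      also have "\<dots> \<le> 1 / 10 / n"
      proof -
        have "83 ^ 3 \<le> n ^ 3" using n by (intro power_mono) auto
        then have "n * (10 * 6 * 81 * (18 * 529 / 100)\<^sup>2) \<le> n * (256 * n ^ 3)"
          using n0 by (intro mult_left_mono) (auto simp: power2_eq_square)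
        then show ?thesis using n0 by (simp add: field_simps power_numeral_reduce)
      qed
      finally show "6 * real (card (box_lattice \<omega>)) * n ^ 4 * t\<^sup>2 / \<gamma> ^ 4 \<le> 1 / 10 / n" .
    qed
    finally show ?thesis .
  qed
  have e3: "emeasure (gauss n) S3 \<le> ennreal (8 / 10 / n)"
  proof -
    have "16 * exp 1 * (n * (n + 1)) / (\<gamma>\<^sup>2 * \<rho>\<^sup>2) = 16 * exp 1 * (n + 1) / (9 / 4 * n * a\<^sup>2)"
      using n0 \<gamma> by (simp add: \<rho>_def power_mult_distrib power_divide field_simps power2_eq_square)
    also have "\<dots> \<le> 16 * (272 / 100) * (2 * n) / (9 / 4 * n * n\<^sup>2)"
      using e_less_272 n n0 a by (intro frac_le mult_mono power_mono) auto
    also have "\<dots> \<le> 8 / 10 / n" using n by (simp add: field_simps power2_eq_square)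
    finally have "16 * exp 1 * (n * (n + 1)) / (\<gamma>\<^sup>2 * \<rho>\<^sup>2) \<le> 8 / 10 / n" .
    then show ?thesis using S3(3) ennreal_leI order_trans by blast
  qed
  show ?thesis
  proof (intro bexI[of _ "S1 \<union> S2 \<union> S3"] conjI allI impI)
    show "S1 \<union> S2 \<union> S3 \<in> sets borel" using S1 S2 S3 by auto
    have "emeasure (gauss n) (S1 \<union> S2 \<union> S3) \<le> emeasure (gauss n) S1 + emeasure (gauss n) S2 + emeasure (gauss n) S3"
      using S1 S2 S3(1) by (intro order_trans[OF emeasure_subadditive] add_mono emeasure_subadditive order_refl) auto
    also have "\<dots> \<le> ennreal (1 / 10 / n) + ennreal (1 / 10 / n) + ennreal (8 / 10 / n)"
      by (intro add_mono e1 e2 e3)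
    also have "\<dots> = ennreal (1 / 10 / n + 1 / 10 / n + 8 / 10 / n)" using n0 by (simp flip: ennreal_plus)
    also have "1 / 10 / n + 1 / 10 / n + 8 / 10 / n = 1 / n" using n0 by (simp add: field_simps)
    finally show "emeasure (gauss n) (S1 \<union> S2 \<union> S3) \<le> ennreal (1 / n)" .
    fix g assume g: "g \<notin> S1 \<union> S2 \<union> S3"
    show "\<not> (\<exists>p. norm p = 1 \<and> 26 / 10 < norm (g *v p))" using g by (auto simp: S1_def)
    show "\<not> (\<exists>y\<in>box_lattice \<omega>. \<exists>i j. i \<noteq> j \<and> pencil_at (A + \<gamma> *\<^sub>R g) B y \<in> near_dependent (18 * \<omega>\<^sup>2 * (23 / 10 * a)\<^sup>2 * n) i j)"
      using g unfolding S2_def t_def by blast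
    show "\<not> (\<exists>y\<in>ball 0 4. \<exists>s0>0. \<forall>s. 0 < s \<and> s < s0 \<longrightarrow>
        cball y (3 / 2 * n * a / \<gamma> * s) \<subseteq> {y. pencil_at (A + \<gamma> *\<^sub>R g) B y \<in> small_singular s})"
      using g S3(2) unfolding \<rho>_def by blast
  qed
qed

text \<open>Scaling by a turns the threshold into 6/10. Its square times e is below 1, with enough
  slack for n >= 83 to absorb n(n+1) into n^2.\<close>

lemma good_second_matrix:
  fixes B :: "complex^'n^'n" and \<gamma> a :: real
  defines "n \<equiv> real CARD('n)"
  assumes n: "83 \<le> n" and \<gamma>: "0 < \<gamma>" and a: "0 < a"
  shows "\<exists>E\<in>sets borel. ennreal (1 - n\<^sup>2 / a\<^sup>2 / \<gamma>\<^sup>2 - 4 * exp (- n)) \<le> emeasure (gauss n) E \<and> (\<forall>g\<in>E.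
    \<not> (\<exists>p. norm p = 1 \<and> 26 / 10 < norm (g *v p)) \<and> B + \<gamma> *\<^sub>R g \<notin> small_singular (6 / 10 / a))"
proof -
  have n0: "0 < n" using n by simp
  interpret prob_space "gauss n :: (complex^'n^'n) measure" by (rule prob_space_gauss[OF n0])
  define S1 where "S1 = {g :: complex^'n^'n. \<exists>p. norm p = 1 \<and> 26 / 10 < norm (g *v p)}"
  define S2 where "S2 = {g. B + \<gamma> *\<^sub>R g \<in> small_singular (6 / 10 / a)}"
  have S1: "S1 \<in> sets borel" unfolding S1_def using open_large_norm by (intro borel_open)
  have "closed {g. 6 / 10 / a \<ge> 0 \<and> B + \<gamma> *\<^sub>R g \<in> small_singular (6 / 10 / a)}"
    by (intro closed_small_singular continuous_intros)
  then have S2: "S2 \<in> sets borel" using a by (simp add: S2_def)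
  have p1: "prob S1 \<le> exp (- n)"
    using emeasure_gauss_norm[where 'n = 'n] by (simp add: S1_def n_def[symmetric] emeasure_eq_measure)
  have p2: "prob S2 \<le> n\<^sup>2 / a\<^sup>2 / \<gamma>\<^sup>2"
  proof -
    have "emeasure (gauss n) S2 \<le> ennreal (exp 1 * (n * (n + 1)) * (6 / 10 / a)\<^sup>2 / \<gamma>\<^sup>2)"
      unfolding S2_def n_def using a by (intro emeasure_small_singular \<gamma>) simp
    then have "prob S2 \<le> exp 1 * (n * (n + 1)) * (6 / 10 / a)\<^sup>2 / \<gamma>\<^sup>2"
      using n0 by (simp add: emeasure_eq_measure)
    also have "\<dots> = (36 / 100 * exp 1 * (n + 1)) * (n / a\<^sup>2 / \<gamma>\<^sup>2)"
      by (simp add: power_divide field_simps)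
    also have "\<dots> \<le> n * (n / a\<^sup>2 / \<gamma>\<^sup>2)"
    proof (rule mult_right_mono)
      have "36 / 100 * exp 1 * (n + 1) \<le> 36 / 100 * (272 / 100) * (n + 1)"
        using e_less_272 n0 by (intro mult_right_mono mult_left_mono) auto
      also have "\<dots> \<le> n" using n by simp
      finally show "36 / 100 * exp 1 * (n + 1) \<le> n" .
    qed (use n0 in simp)
    finally show ?thesis by (simp add: power2_eq_square)
  qed
  have "prob (S1 \<union> S2) \<le> prob S1 + prob S2" using S1 S2 by (intro measure_Un_le) auto
  moreover have "prob (- (S1 \<union> S2)) = 1 - prob (S1 \<union> S2)"
    using S1 S2 prob_compl[of "S1 \<union> S2"] by (simp add: Compl_eq_Diff_UNIV)
  ultimately have "1 - n\<^sup>2 / a\<^sup>2 / \<gamma>\<^sup>2 - 4 * exp (- n) \<le> prob (- (S1 \<union> S2))"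
    using p1 p2 exp_ge_zero[of "- n"] by linarith
  then have "ennreal (1 - n\<^sup>2 / a\<^sup>2 / \<gamma>\<^sup>2 - 4 * exp (- n)) \<le> emeasure (gauss n) (- (S1 \<union> S2))"
    by (simp add: emeasure_eq_measure ennreal_leI)
  moreover have "- (S1 \<union> S2) \<in> sets borel" using S1 S2 by auto
  ultimately show ?thesis by (intro bexI[of _ "- (S1 \<union> S2)"]) (auto simp: S1_def S2_def)
qed

lemma not_small_singularD:
  fixes M :: "complex^'n^'n"
  assumes "M \<notin> small_singular s"
  shows "s * norm u \<le> norm (M *v u)"
proof (cases "u = 0")
  case False
  then show ?thesis using small_singularI[of M u s] assms by linarith
qed simp

text \<open>With both matrices fixed only the shift is random. There are at most n eigenvalues, and
  with D = \<omega>/n^2 each of them costs probability 12/n^2.\<close>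

lemma prob_shattered_given_matrices:
  fixes A B g1 g2 :: "complex^'n^'n" and \<gamma> a \<omega> \<epsilon> :: real
  defines "n \<equiv> real CARD('n)"
    and "Q \<equiv> cbox (Complex (- 4) (- 4)) (Complex (- 4 + \<omega>) (- 4 + \<omega>))"
    and "X \<equiv> A + \<gamma> *\<^sub>R g1" and "Y \<equiv> B + \<gamma> *\<^sub>R g2"
  defines "G \<equiv> {z. spectral_norm X \<le> 3 \<and> spectral_norm Y \<le> 3 \<and>
    shattered \<epsilon> X (a *\<^sub>R Y) z \<omega> (nat \<lceil>8 / \<omega>\<rceil>) (nat \<lceil>8 / \<omega>\<rceil>)}"
  assumes n: "83 \<le> n" and \<gamma>: "0 < \<gamma>" "\<gamma> < 1 / 2" and a: "0 < a"
    and \<omega>: "0 < \<omega>" "\<omega> \<le> 1 / 64" and \<epsilon>: "0 < \<epsilon>"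
    and A: "spectral_norm A \<le> 1" and B: "spectral_norm B \<le> 1"
    and D: "n * (3 / 2 * n * a / \<gamma>) * (10 * \<epsilon>) < \<omega> / n\<^sup>2"
    and g1: "\<not> (\<exists>p. norm p = 1 \<and> 26 / 10 < norm (g1 *v p))"
    and g2: "\<not> (\<exists>p. norm p = 1 \<and> 26 / 10 < norm (g2 *v p))"
    and Ysing: "Y \<notin> small_singular (6 / 10 / a)"
    and gap: "\<not> (\<exists>y\<in>box_lattice \<omega>. \<exists>i j. i \<noteq> j \<and>
        pencil_at X (a *\<^sub>R Y) y \<in> near_dependent (18 * \<omega>\<^sup>2 * (23 / 10 * a)\<^sup>2 * n) i j)"
    and res: "\<not> (\<exists>y\<in>ball 0 4. \<exists>s0>0. \<forall>s. 0 < s \<and> s < s0 \<longrightarrow>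
        cball y (3 / 2 * n * a / \<gamma> * s) \<subseteq> {y. pencil_at X (a *\<^sub>R Y) y \<in> small_singular s})"
    and G: "G \<in> sets borel"
  shows "ennreal (1 - 12 / n) \<le> emeasure (uniform_measure lborel Q) G"
proof -
  have n0: "0 < n" using n by simp
  have Xn: "norm (X *v u) \<le> 23 / 10 * norm u" for u
    unfolding X_def by (rule norm_perturbed_mult_vec[OF A \<gamma> g1])
  have Yn: "norm (Y *v u) \<le> 23 / 10 * norm u" for u
    unfolding Y_def by (rule norm_perturbed_mult_vec[OF B \<gamma> g2])
  have "norm (M *v u) \<le> 3 * norm u" if "norm (M *v u) \<le> 23 / 10 * norm u" for M :: "complex^'n^'n" and u
    using that norm_ge_zero[of u] by linarith
  then have sp: "spectral_norm X \<le> 3" "spectral_norm Y \<le> 3" using Xn Yn by (auto simp: spectral_norm_le)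
  let ?B = "a *\<^sub>R Y"
  have Bv: "?B *v u = a *\<^sub>R (Y *v u)" for u by (rule linear_cmul[OF linear_mult_matrix])
  have B1: "6 / 10 * norm u \<le> norm (?B *v u)" for u
    using not_small_singularD[OF Ysing, of u] a by (simp add: Bv field_simps)
  have B2: "norm (?B *v u) \<le> 23 / 10 * a * norm u" for u
    using mult_left_mono[OF Yn[of u], of a] a by (simp add: Bv)
  have "\<not> det ?B = 0"
  proof
    assume "det ?B = 0"
    then obtain u where "norm u = 1" "?B *v u = 0" using ex_kernel_vec[of ?B] by (auto simp: invertible_det_nz)
    then show False using B1[of u] by simp
  qed
  then have "coeff (pencil_poly X ?B) CARD('n) \<noteq> 0" by (simp add: degree_pencil_poly det_uminus_eq_0)
  then have p: "pencil_poly X ?B \<noteq> 0" by auto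
  define L where "L = {l. poly (pencil_poly X ?B) l = 0}"
  have L: "finite L" "card L \<le> CARD('n)"
    unfolding L_def using poly_roots_finite[OF p] card_poly_roots_bound[OF p] degree_pencil_poly(1)[of X ?B] by auto
  define D where "D = \<omega> / n\<^sup>2"
  have D0: "0 < D" "D \<le> \<omega>"
  proof -
    have "1 \<le> n\<^sup>2" using n by (simp add: power_strict_increasing one_le_power)
    then show "0 < D" "D \<le> \<omega>" using \<omega> n0 by (auto simp: D_def divide_le_eq mult_left_le)
  qed
  obtain W where W: "W \<in> sets borel" "emeasure (uniform_measure lborel Q) W \<le> ennreal (12 * real (card L) * D / \<omega>)"
    "{z\<in>Q. \<exists>l\<in>L. \<exists>j::nat. \<bar>Re l - (Re z + \<omega> * real j)\<bar> < D \<or> \<bar>Im l - (Im z + \<omega> * real j)\<bar> < D} \<subseteq> W"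
    using emeasure_close_to_lines[OF L(1) D0] unfolding Q_def by blast
  have sub: "Q \<subseteq> G \<union> W"
  proof
    fix z assume z: "z \<in> Q"
    show "z \<in> G \<union> W"
    proof (rule UnCI)
      assume "z \<notin> W"
      then have far: "D \<le> \<bar>Re l - (Re z + \<omega> * real j)\<bar>" "D \<le> \<bar>Im l - (Im z + \<omega> * real j)\<bar>" if "l \<in> L" for l and j :: nat
      proof -
        have "\<not> (\<bar>Re l - (Re z + \<omega> * real j)\<bar> < D \<or> \<bar>Im l - (Im z + \<omega> * real j)\<bar> < D)"
          using W(3) z that \<open>z \<notin> W\<close> by blast
        then show "D \<le> \<bar>Re l - (Re z + \<omega> * real j)\<bar>" "D \<le> \<bar>Im l - (Im z + \<omega> * real j)\<bar>" by linarith+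
      qed
      have "shattered \<epsilon> X ?B z \<omega> (nat \<lceil>8 / \<omega>\<rceil>) (nat \<lceil>8 / \<omega>\<rceil>)"
      proof (rule shattered_good[where \<rho> = "3 / 2 * n * a / \<gamma>" and D = D and K = "23 / 10 * a"])
        show "- 4 \<le> Re z" "Re z \<le> - 4 + \<omega>" "- 4 \<le> Im z" "Im z \<le> - 4 + \<omega>"
          using z by (auto simp: Q_def in_cbox_complex_iff)
        show "real CARD('n) * (3 / 2 * n * a / \<gamma>) * (10 * \<epsilon>) < D" using D by (simp add: D_def n_def)
        show "0 < 3 / 2 * n * a / \<gamma>" using n0 a \<gamma> by simp
        show "D \<le> \<bar>Re l - (Re z + \<omega> * real j)\<bar> \<and> D \<le> \<bar>Im l - (Im z + \<omega> * real j)\<bar>"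
          if "det (pencil_at X ?B l) = 0" for l j
          using far[of l j] that by (simp add: L_def poly_pencil_poly)
      qed (use \<omega> \<epsilon> Xn B1 B2 gap res in \<open>auto simp: n_def\<close>)
      then show "z \<in> G" using sp by (simp add: G_def)
    qed
  qed
  have Qe: "emeasure lborel Q = ennreal (\<omega>\<^sup>2)"
    using \<omega> by (simp add: Q_def emeasure_lborel_cbox_eq Basis_complex_def power2_eq_square)
  interpret U: prob_space "uniform_measure lborel Q"
    using \<omega> by (intro prob_space_uniform_measure) (auto simp: Qe)
  have "emeasure (uniform_measure lborel Q) Q = emeasure lborel (Q \<inter> Q) / emeasure lborel Q"
    by (intro emeasure_uniform_measure) (auto simp: Q_def)
  also have "\<dots> = 1" unfolding Qe Int_absorb using \<omega> by (simp add: divide_ennreal)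
  finally have "U.prob Q = 1" by (simp add: U.emeasure_eq_measure)
  moreover have "U.prob Q \<le> U.prob (G \<union> W)" using sub G W(1) by (intro U.finite_measure_mono) auto
  moreover have "U.prob (G \<union> W) \<le> U.prob G + U.prob W" using G W(1) by (intro measure_Un_le) auto
  moreover have "U.prob W \<le> 12 / n"
  proof -
    have "U.prob W \<le> 12 * real (card L) * D / \<omega>"
      using W(2) D0 \<omega> by (simp add: U.emeasure_eq_measure)
    also have "\<dots> \<le> 12 * n * D / \<omega>"
      using L(2) D0 \<omega> by (intro divide_right_mono mult_right_mono mult_left_mono) (auto simp: n_def)
    also have "\<dots> = 12 / n" using \<omega> n0 by (simp add: D_def power2_eq_square)
    finally show ?thesis .
  qed
  ultimately have "1 - 12 / n \<le> U.prob G" by linarith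
  then show ?thesis by (simp add: U.emeasure_eq_measure ennreal_leI)
qed

theorem theorem3p12:
  fixes M :: "'a measure"
    and \<alpha> \<gamma> \<omega> \<epsilon> n :: real
    and A B :: "complex^'n^'n"
    and G1 G2 :: "'a \<Rightarrow> complex^'n^'n"
    and Z :: "'a \<Rightarrow> complex"
  assumes "prob_space M"
    and "n = real CARD('n)"
    and "0 < \<alpha>"
    and "spectral_norm A \<le> 1"
    and "spectral_norm B \<le> 1"
    and "complex_ginibre M G1"
    and "complex_ginibre M G2"
    and "indep_random_variables M borel G1 borel G2"
    and "0 < \<gamma>" and "\<gamma> < 1 / 2"
    and "\<omega> = \<gamma> ^ 4 / 4 * n powr (- ((8 * \<alpha> + 13) / 3))"
    and "distr M borel Z =
           uniform_measure lborel (cbox (Complex (-4) (-4)) (Complex (-4 + \<omega>) (-4 + \<omega>)))"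
    and "indep_random_variables M borel (\<lambda>x. (G1 x, G2 x)) borel Z"
    and "\<epsilon> = \<gamma> ^ 5 / (64 * n powr ((11 * \<alpha> + 25) / 3) + \<gamma> ^ 5)"
    and "0 \<le> 1 - 82 / n - 531441 / (16 * n ^ 2)"
    and "0 \<le> 1 - n powr (2 - 2 * \<alpha>) / \<gamma> ^ 2 - 4 * exp (- n)"
  shows "\<P>(x in M.
            spectral_norm (A + \<gamma> *\<^sub>R G1 x) \<le> 3 \<and>
            spectral_norm (B + \<gamma> *\<^sub>R G2 x) \<le> 3 \<and>
            shattered \<epsilon> (A + \<gamma> *\<^sub>R G1 x) (n powr \<alpha> *\<^sub>R (B + \<gamma> *\<^sub>R G2 x))
              (Z x) \<omega> (nat \<lceil>8 / \<omega>\<rceil>) (nat \<lceil>8 / \<omega>\<rceil>))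
         \<ge> (1 - 82 / n - 531441 / (16 * n ^ 2)) *
            (1 - n powr (2 - 2 * \<alpha>) / \<gamma> ^ 2 - 4 * exp (- n))"
proof -
  note \<gamma> = \<open>0 < \<gamma>\<close> \<open>\<gamma> < 1 / 2\<close> and n_def = \<open>n = real CARD('n)\<close>
  interpret prob_space M by fact
  define a where "a = n powr \<alpha>"
  define s where "s = nat \<lceil>8 / \<omega>\<rceil>"
  define Q where "Q = cbox (Complex (-4) (-4)) (Complex (-4 + \<omega>) (-4 + \<omega>))"
  have n0: "0 < n" by (simp add: n_def)
  \<comment> \<open>Nonnegativity of the first factor gives 82/n < 1, and n is an integer.\<close>
  have n83: "83 \<le> n"
  proof -
    have "0 < 531441 / (16 * n\<^sup>2)" using n0 by simp
    then have "82 / n < 1" using assms(15) by linarith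
    then have "82 < n" using n0 by simp
    then have "82 < CARD('n)" unfolding n_def by (simp only: numeral_less_real_of_nat_iff)
    then have "83 \<le> CARD('n)" by linarith
    then show ?thesis unfolding n_def by (simp only: numeral_le_real_of_nat_iff)
  qed
  \<comment> \<open>For \<alpha> at most 1 the subtracted quotient would be at least 1/\<gamma>^2 >
    1, and the second factor would be negative.\<close>
  have \<alpha>: "1 < \<alpha>"
  proof (rule ccontr)
    assume "\<not> 1 < \<alpha>"
    then have "n powr 0 \<le> n powr (2 - 2 * \<alpha>)" using n83 by (intro powr_mono) auto
    then have "1 \<le> n powr (2 - 2 * \<alpha>)" using n0 by simp
    moreover have "\<gamma>\<^sup>2 < 1" using power_strict_mono[of \<gamma> 1 2] \<gamma> by simp
    ultimately have "\<gamma>\<^sup>2 < n powr (2 - 2 * \<alpha>)" by linarith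
    then have "1 < n powr (2 - 2 * \<alpha>) / \<gamma>\<^sup>2" using \<gamma> by simp
    then show False using assms(16) exp_ge_zero[of "- n"] by linarith
  qed
  have a: "n \<le> a" "0 < a"
    using powr_mono[of 1 \<alpha> n] n83 \<alpha> by (auto simp: a_def)
  note par = parameter_bounds[OF n83 \<gamma> \<alpha> assms(11,14)]
  have [measurable]: "G1 \<in> borel_measurable M" "G2 \<in> borel_measurable M" "Z \<in> borel_measurable M"
    using assms(8,13) by (auto simp: indep_random_variables_def)
  let ?\<mu> = "gauss n :: (complex^'n^'n) measure" and ?U = "uniform_measure lborel Q"
  have law1: "distr M borel G1 = ?\<mu>" and law2: "distr M borel G2 = ?\<mu>"
    unfolding n_def by (intro distr_complex_ginibre assms(1,6,7); simp)+
  interpret \<mu>: prob_space ?\<mu> by (rule prob_space_gauss[OF n0])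
  interpret \<mu>\<mu>: pair_prob_space ?\<mu> ?\<mu> ..
  interpret U: prob_space ?U
    using prob_space_distr[of Z borel] assms(12) by (simp add: Q_def)
  have law12: "distr M borel (\<lambda>x. (G1 x, G2 x)) = ?\<mu> \<Otimes>\<^sub>M ?\<mu>"
    using distr_pair_indep_random_variables[OF assms(1,8)] by (simp add: law1 law2 borel_prod)
  have law: "distr M (borel \<Otimes>\<^sub>M borel) (\<lambda>x. ((G1 x, G2 x), Z x)) = (?\<mu> \<Otimes>\<^sub>M ?\<mu>) \<Otimes>\<^sub>M ?U"
    using distr_pair_indep_random_variables[OF assms(1,13)] by (simp add: law12 assms(12) Q_def)
  define H where "H = {p :: ((complex^'n^'n) \<times> (complex^'n^'n)) \<times> complex.
    spectral_norm (A + \<gamma> *\<^sub>R fst (fst p)) \<le> 3 \<and> spectral_norm (B + \<gamma> *\<^sub>R snd (fst p)) \<le> 3 \<and>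
    shattered \<epsilon> (A + \<gamma> *\<^sub>R fst (fst p)) (a *\<^sub>R (B + \<gamma> *\<^sub>R snd (fst p))) (snd p) \<omega> s s}"
  have H: "H \<in> sets (borel \<Otimes>\<^sub>M borel)"
  proof -
    let ?f = "\<lambda>p :: ((complex^'n^'n) \<times> (complex^'n^'n)) \<times> complex. ((A + \<gamma> *\<^sub>R fst (fst p), a *\<^sub>R (B + \<gamma> *\<^sub>R snd (fst p))), snd p)"
    have "?f -` {p. shattered \<epsilon> (fst (fst p)) (snd (fst p)) (snd p) \<omega> s s} \<inter> space borel \<in> sets borel"
      by (rule measurable_sets[OF _ borel_shattered[OF less_imp_le[OF par(3)] par(1)]])
         (intro borel_measurable_continuous_onI continuous_intros)
    moreover have "closed {p :: ((complex^'n^'n) \<times> (complex^'n^'n)) \<times> complex. \<forall>u. norm ((A + \<gamma> *\<^sub>R fst (fst p)) *v u) \<le> 3 * norm u}"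
      by (intro closed_Collect_all closed_Collect_le continuous_intros)
    moreover have "closed {p :: ((complex^'n^'n) \<times> (complex^'n^'n)) \<times> complex. \<forall>u. norm ((B + \<gamma> *\<^sub>R snd (fst p)) *v u) \<le> 3 * norm u}"
      by (intro closed_Collect_all closed_Collect_le continuous_intros)
    moreover have "H = {p. \<forall>u. norm ((A + \<gamma> *\<^sub>R fst (fst p)) *v u) \<le> 3 * norm u} \<inter>
      {p. \<forall>u. norm ((B + \<gamma> *\<^sub>R snd (fst p)) *v u) \<le> 3 * norm u} \<inter>
      (?f -` {p. shattered \<epsilon> (fst (fst p)) (snd (fst p)) (snd p) \<omega> s s} \<inter> space borel)"
      by (auto simp: H_def spectral_norm_le)
    ultimately show ?thesis unfolding borel_prod by (simp only: sets.Int borel_closed)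
  qed
  \<comment> \<open>The conditional probability of success over the shift, given the pair of
    matrices.\<close>
  define f where "f p = emeasure ?U (Pair p -` H)" for p
  have H': "H \<in> sets ((?\<mu> \<Otimes>\<^sub>M ?\<mu>) \<Otimes>\<^sub>M ?U)"
    using H by (simp add: borel_prod[symmetric] cong: sets_pair_measure_cong)
  have f[measurable]: "f \<in> borel_measurable (?\<mu> \<Otimes>\<^sub>M ?\<mu>)"
    unfolding f_def using H' by (rule U.measurable_emeasure_Pair)
  \<comment> \<open>The losses once the second matrix is good: 1/n for the first matrix and 12/n for
    the shift. The product is at least 1 - 13/n, far above the required 1 - 82/n.\<close>
  define q where "q = (1 - 1 / n) * (1 - 12 / n)"
  have n13: "1 / n \<le> 1 / 83" "12 / n \<le> 12 / 83" using n83 by (auto simp: field_simps)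
  obtain E where E: "E \<in> sets borel"
    "ennreal (1 - n\<^sup>2 / a\<^sup>2 / \<gamma>\<^sup>2 - 4 * exp (- n)) \<le> emeasure ?\<mu> E"
    "\<And>g. g \<in> E \<Longrightarrow> \<not> (\<exists>p. norm p = 1 \<and> 26 / 10 < norm (g *v p)) \<and> B + \<gamma> *\<^sub>R g \<notin> small_singular (6 / 10 / a)"
    using good_second_matrix[where 'n = 'n, OF _ \<gamma>(1) a(2), of B] n83 unfolding n_def by blast
  \<comment> \<open>\<open>g2\<close> is fixed first because the exceptional set of
    \<open>g1\<close> depends on it.\<close>
  have inner: "ennreal q \<le> (\<integral>\<^sup>+g1. f (g1, g2) \<partial>?\<mu>)" if g2: "g2 \<in> E" for g2
  proof -
    let ?good = "\<lambda>g. \<not> (\<exists>p. norm p = 1 \<and> 26 / 10 < norm (g *v p)) \<and>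
        \<not> (\<exists>y\<in>box_lattice \<omega>. \<exists>i j. i \<noteq> j \<and>
          pencil_at (A + \<gamma> *\<^sub>R g) (a *\<^sub>R (B + \<gamma> *\<^sub>R g2)) y \<in> near_dependent (18 * \<omega>\<^sup>2 * (23 / 10 * a)\<^sup>2 * n) i j) \<and>
        \<not> (\<exists>y\<in>ball 0 4. \<exists>s0>0. \<forall>s. 0 < s \<and> s < s0 \<longrightarrow>
          cball y (3 / 2 * n * a / \<gamma> * s) \<subseteq> {y. pencil_at (A + \<gamma> *\<^sub>R g) (a *\<^sub>R (B + \<gamma> *\<^sub>R g2)) y \<in> small_singular s})"
    have "\<exists>S\<in>sets borel. emeasure ?\<mu> S \<le> ennreal (1 / n) \<and> (\<forall>g. g \<notin> S \<longrightarrow> ?good g)"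
      by (rule exceptional_set[where 'n = 'n, folded n_def, OF n83 \<gamma>(1) a(1) par(1,2) par(5)[folded a_def]])
    then obtain S where S: "S \<in> sets borel" "emeasure ?\<mu> S \<le> ennreal (1 / n)"
      and S'': "\<forall>g. g \<notin> S \<longrightarrow> ?good g" by (elim bexE conjE) (rule that)
    have S': "?good g" if "g \<notin> S" for g using that by (rule S''[THEN spec, THEN mp])
    have low: "ennreal (1 - 12 / n) \<le> f (g1, g2)" if g1: "g1 \<notin> S" for g1
    proof -
      have eq: "Pair (g1, g2) -` H = {z. spectral_norm (A + \<gamma> *\<^sub>R g1) \<le> 3 \<and> spectral_norm (B + \<gamma> *\<^sub>R g2) \<le> 3 \<and>
        shattered \<epsilon> (A + \<gamma> *\<^sub>R g1) (a *\<^sub>R (B + \<gamma> *\<^sub>R g2)) z \<omega> (nat \<lceil>8 / \<omega>\<rceil>) (nat \<lceil>8 / \<omega>\<rceil>)}"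
        by (auto simp: H_def s_def)
      have m: "Pair (g1, g2) -` H \<in> sets borel" using sets_Pair1[OF H'] by simp
      note good = S'[OF g1] and E = E(3)[OF g2]
      show ?thesis
        unfolding f_def eq Q_def
        by (rule prob_shattered_given_matrices[where 'n = 'n, folded n_def, OF n83 \<gamma> a(2) par(1,2,3)
              assms(4,5) par(4)[folded a_def] conjunct1[OF good] conjunct1[OF E] conjunct2[OF E]
              conjunct1[OF conjunct2[OF good]] conjunct2[OF conjunct2[OF good]] m[unfolded eq]])
    qed
    have "\<mu>.prob (- S) = 1 - \<mu>.prob S" using S(1) \<mu>.prob_compl[of S] by (simp add: Compl_eq_Diff_UNIV)
    moreover have "\<mu>.prob S \<le> 1 / n" using S(2) n0 by (simp add: \<mu>.emeasure_eq_measure)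
    ultimately have "(1 - 1 / n) \<le> \<mu>.prob (- S)" by linarith
    then have "ennreal q \<le> ennreal (\<mu>.prob (- S) * (1 - 12 / n))"
      unfolding q_def using n13 by (intro ennreal_leI mult_right_mono) auto
    also have "\<dots> = ennreal (1 - 12 / n) * emeasure ?\<mu> (- S)"
      using n13 by (simp add: \<mu>.emeasure_eq_measure mult.commute flip: ennreal_mult')
    also have "\<dots> = (\<integral>\<^sup>+g1. ennreal (1 - 12 / n) * indicator (- S) g1 \<partial>?\<mu>)"
      using S(1) by (intro nn_integral_cmult_indicator[symmetric]) auto
    also have "\<dots> \<le> (\<integral>\<^sup>+g1. f (g1, g2) \<partial>?\<mu>)"
      by (intro nn_integral_mono) (auto simp: indicator_def low)
    finally show ?thesis .
  qed
  have a2: "n powr (2 - 2 * \<alpha>) = n\<^sup>2 / a\<^sup>2"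
    using n0 by (simp add: a_def powr_diff powr_powr[symmetric] mult.commute flip: powr_numeral powr_add)
  let ?r = "1 - n powr (2 - 2 * \<alpha>) / \<gamma> ^ 2 - 4 * exp (- n)"
  have "(1 - 82 / n - 531441 / (16 * n ^ 2)) * ?r \<le> q * ?r"
  proof (rule mult_right_mono[OF _ assms(16)])
    have "0 \<le> 531441 / (16 * n ^ 2)" by simp
    moreover have "q = 1 - 13 / n + 12 / n\<^sup>2" using n0 by (simp add: q_def field_simps power2_eq_square)
    moreover have "0 \<le> 12 / n\<^sup>2" "13 / n \<le> 82 / n" using n0 by (auto intro: divide_right_mono)
    ultimately show "1 - 82 / n - 531441 / (16 * n ^ 2) \<le> q" by linarith
  qed
  also have "q * ?r \<le> measure M {x \<in> space M. ((G1 x, G2 x), Z x) \<in> H}"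
  proof -
    have q0: "0 \<le> q" unfolding q_def using n13 by simp
    have "ennreal (q * ?r) = ennreal q * ennreal ?r" using q0 by (rule ennreal_mult')
    also have "\<dots> \<le> ennreal q * emeasure ?\<mu> E" using E(2) by (intro mult_left_mono) (simp_all add: a2)
    also have "\<dots> = (\<integral>\<^sup>+g2. ennreal q * indicator E g2 \<partial>?\<mu>)"
      using E(1) by (intro nn_integral_cmult_indicator[symmetric]) simp
    also have "\<dots> \<le> (\<integral>\<^sup>+g2. \<integral>\<^sup>+g1. f (g1, g2) \<partial>?\<mu> \<partial>?\<mu>)"
      by (intro nn_integral_mono) (auto simp: indicator_def inner)
    also have "\<dots> = (\<integral>\<^sup>+p. f p \<partial>(?\<mu> \<Otimes>\<^sub>M ?\<mu>))" by (rule \<mu>\<mu>.nn_integral_snd[OF f])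
    also have "\<dots> = emeasure ((?\<mu> \<Otimes>\<^sub>M ?\<mu>) \<Otimes>\<^sub>M ?U) H"
      unfolding f_def by (rule U.emeasure_pair_measure_alt[OF H', symmetric])
    also have "\<dots> = emeasure M ((\<lambda>x. ((G1 x, G2 x), Z x)) -` H \<inter> space M)"
      unfolding law[symmetric] using H by (subst emeasure_distr) (auto simp: borel_prod[symmetric])
    also have "(\<lambda>x. ((G1 x, G2 x), Z x)) -` H \<inter> space M = {x \<in> space M. ((G1 x, G2 x), Z x) \<in> H}" by auto
    finally have "ennreal (q * ?r) \<le> ennreal (measure M {x \<in> space M. ((G1 x, G2 x), Z x) \<in> H})"
      by (simp add: emeasure_eq_measure)
    then show ?thesis by simp
  qed
  also have "{x \<in> space M. ((G1 x, G2 x), Z x) \<in> H} = {x \<in> space M.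
      spectral_norm (A + \<gamma> *\<^sub>R G1 x) \<le> 3 \<and> spectral_norm (B + \<gamma> *\<^sub>R G2 x) \<le> 3 \<and>
      shattered \<epsilon> (A + \<gamma> *\<^sub>R G1 x) (n powr \<alpha> *\<^sub>R (B + \<gamma> *\<^sub>R G2 x)) (Z x) \<omega> (nat \<lceil>8 / \<omega>\<rceil>) (nat \<lceil>8 / \<omega>\<rceil>)}"
    by (simp add: H_def a_def s_def)
  finally show ?thesis .
qed

end
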